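(* Let $d\ge1$ and let $\Phi$ be a stationary Poisson hyperplane process in $\mathbb{R}^d$ with intensity $\lambda>0$ and nondegenerate spherical orientation distribution $\Theta$, i.e. $\Theta(L\cap S_+^{d-1})<1$ for every $(d-1)$-dimensional linear subspace $L$ of $\mathbb{R}^d$. With the random variables $Z_{k,r}^{(d)}(\chi)$, $Z_{k,r}^{(d)}(\nu)$ and the numbers $\sigma_{\chi,k,l}^{(1,d-k,d-l)}$, $\sigma_{\nu,k,l}^{(1,d-k,d-l)}$ defined in the context, $$\big(Z_{k,r}^{(d)}(\chi)\big)_{k=0}^{d-1}\xrightarrow[r\to\infty]{\mathrm{d}}\mathcal{N}(o,\Sigma(\chi))\qquad\text{and}\qquad\big(Z_{k,r}^{(d)}(\nu)\big)_{k=0}^{d-1}\xrightarrow[r\to\infty]{\mathrm{d}}\mathcal{N}(o,\Sigma(\nu)),$$ where $\mathcal{N}(o,\Sigma(\chi))$ and $\mathcal{N}(o,\Sigma(\nu))$ are $d$-dimensional Gaussian random vectors with mean $o=(0,\ldots,0)^\top$ and covariance matrices $\Sigma(\chi)=\big(\sigma_{\chi,k,l}^{(1,d-k,d-l)}\big)_{k,l=0}^{d-1}$ and $\Sigma(\nu)=\big(\sigma_{\nu,k,l}^{(1,d-k,d-l)}\big)_{k,l=0}^{d-1}$, respectively.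
   Context: Notation. $B_r^d=\{x\in\mathbb{R}^d:\|x\|\le r\}$; $S_+^{d-1}=\{x\in\mathbb{R}^d:\|x\|=1,\ x_d\ge 0\}$; $H(p,v)=\{x\in\mathbb{R}^d:\langle x,v\rangle=p\}$, and $H(x)=H(p,v)$ for $x=(p,v)$; $\chi(K)=1$ if $K\ne\varnothing$, $\chi(\varnothing)=0$; $\nu_k$ is $k$-dimensional volume (Hausdorff measure) in $\mathbb{R}^d$, $\nu_0$ the counting measure; $\xrightarrow{\mathrm{d}}$ is convergence in distribution. Poisson hyperplane process. $\Phi$ is the random collection of hyperplanes $H(P_i,V_i)$, $i\ge1$, where $\sum_{i\ge1}\delta_{(P_i,V_i)}$ is a Poisson process on $\mathbb{R}\times S_+^{d-1}$ with intensity measure $\lambda\,dp\,\Theta(dv)$. For $k\in\{0,\dots,d-1\}$ and $r>0$ define $$\Psi_k(B_r^d)=\frac1{(d-k)!}\sum^{*}\chi\Big(\bigcap_{j=1}^{d-k}H(P_{i_j},V_{i_j})\cap B_r^d\Big),\qquad \zeta_k(B_r^d)=\frac1{(d-k)!}\sum^{*}\nu_k\Big(\bigcap_{j=1}^{d-k}H(P_{i_j},V_{i_j})\cap B_r^d\Big),$$ the sums running over all tuples of pairwise distinct indices, and $$Z_{k,r}^{(d)}(\chi)=\frac{(d-k-1)!}{(2\lambda r)^{d-k-1/2}}\big(\Psi_k(B_r^d)-\mathbb{E}\Psi_k(B_r^d)\big),\qquad Z_{k,r}^{(d)}(\nu)=\frac{(d-k-1)!\,r^{-k}}{(2\lambda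 r)^{d-k-1/2}}\big(\zeta_k(B_r^d)-\mathbb{E}\zeta_k(B_r^d)\big).$$ Auxiliary variables. For given $r>0$, $X_1,X_2,\ldots$ are i.i.d. random elements $X_i=(P_i,V_i)$ of $[-r,r]\times S_+^{d-1}$ with independent components, $P_i$ uniform on $[-r,r]$, $V_i\sim\Theta$. For $k,l\in\{0,\dots,d-1\}$ put $$\sigma_{\chi,k,l}^{(1,d-k,d-l)}=\mathbb{E}\Big(\chi\Big(\bigcap_{i=1}^{d-k}H(X_i)\cap B_r^d\Big)\chi\Big(\bigcap_{i=d-k}^{2d-k-l-1}H(X_i)\cap B_r^d\Big)\Big),$$ $$\sigma_{\nu,k,l}^{(1,d-k,d-l)}=r^{-(k+l)}\,\mathbb{E}\Big(\nu_k\Big(\bigcap_{i=1}^{d-k}H(X_i)\cap B_r^d\Big)\nu_l\Big(\bigcap_{i=d-k}^{2d-k-l-1}H(X_i)\cap B_r^d\Big)\Big).$$ These quantities do not depend on $r>0$. *)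

theory Defs
  imports "HOL-Probability.Probability"
begin

section \<open>Geometry\<close>

definition hyperplane :: "real \<times> 'a::real_inner \<Rightarrow> 'a set" where
  "hyperplane x = {y. y \<bullet> snd x = fst x}"

text \<open>
  The dimension is \<open>d = CARD('n)\<close>; the linear order of the index type enumerates the
  coordinates, so that the last coordinate is the one with index \<open>Max UNIV\<close>.
\<close>

definition half_sphere :: "(real ^ 'n::{finite,linorder}) set" where
  "half_sphere = {x. norm x = 1 \<and> x $ Max UNIV \<ge> 0}"

definition chi :: "'a set \<Rightarrow> real" where
  "chi K = (if K = {} then 0 else 1)"

text \<open>
  \<open>k\<close>-dimensional Hausdorff measure, normalised by the volume of the \<open>k\<close>-dimensional unit
  ball. Because the power has a natural exponent and empty covering sets are counted with
  weight \<open>0\<close>, the case \<open>k = 0\<close> is the counting measure.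
\<close>

definition hausdorff_pre :: "nat \<Rightarrow> real \<Rightarrow> 'a::metric_space set \<Rightarrow> ennreal" where
  "hausdorff_pre k \<delta> A =
     (INF U \<in> {U :: nat \<Rightarrow> 'a set. A \<subseteq> (\<Union>i. U i) \<and> (\<forall>i. bounded (U i) \<and> diameter (U i) \<le> \<delta>)}.
        \<Sum>i. if U i = {} then 0 else ennreal (unit_ball_vol (real k) * (diameter (U i) / 2) ^ k))"

definition hausdorff :: "nat \<Rightarrow> 'a::metric_space set \<Rightarrow> ennreal" where
  "hausdorff k A = (SUP \<delta> \<in> {0<..}. hausdorff_pre k \<delta> A)"

text \<open>
  Real-valued version. It replaces the value \<open>\<infinity>\<close> by \<open>0\<close>, which matters only on null events:
  almost surely, \<open>d - k\<close> of the hyperplanes meet in a \<open>k\<close>-dimensional flat or not at all.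
\<close>

definition vol :: "nat \<Rightarrow> 'a::metric_space set \<Rightarrow> real" where
  "vol k A = enn2real (hausdorff k A)"

section \<open>Poisson processes\<close>

definition point_count :: "(nat \<Rightarrow> 'w \<Rightarrow> 'b) \<Rightarrow> 'b set \<Rightarrow> 'w \<Rightarrow> ennreal" where
  "point_count X A w = emeasure (count_space UNIV) {i. X i w \<in> A}"

text \<open>
  \<open>X\<close> enumerates the points of a Poisson process with intensity measure \<open>\<Lambda>\<close> of infinite total
  mass (so that there are infinitely many points).
\<close>

definition poisson_process :: "'w measure \<Rightarrow> 'b measure \<Rightarrow> (nat \<Rightarrow> 'w \<Rightarrow> 'b) \<Rightarrow> bool" where
  "poisson_process M \<Lambda> X \<longleftrightarrow>
     prob_space M \<and>
     (\<forall>i. X i \<in> measurable M \<Lambda>) \<and>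
     (\<forall>A \<in> sets \<Lambda>. emeasure \<Lambda> A < \<infinity> \<longrightarrow>
        (\<forall>n::nat. measure M {w \<in> space M. point_count X A w = of_nat n}
                   = exp (- measure \<Lambda> A) * measure \<Lambda> A ^ n / fact n)) \<and>
     (\<forall>A \<in> sets \<Lambda>. emeasure \<Lambda> A = \<infinity> \<longrightarrow> (AE w in M. point_count X A w = \<infinity>)) \<and>
     (\<forall>(n::nat) A. A ` {..<n} \<subseteq> sets \<Lambda> \<and> disjoint_family_on A {..<n} \<longrightarrow>
        prob_space.indep_vars M (\<lambda>_. borel) (\<lambda>j. point_count X (A j)) {..<n})"

text \<open>The intensity measure \<open>\<lambda> dp \<Theta>(dv)\<close>, where \<open>\<Theta>\<close> is a measure on \<open>half_sphere\<close>.\<close>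

definition hyperplane_intensity ::
    "real \<Rightarrow> (real ^ 'n::{finite,linorder}) measure \<Rightarrow> (real \<times> (real ^ 'n::{finite,linorder})) measure" where
  "hyperplane_intensity lam \<Theta> = scale_measure (ennreal lam) (lborel \<Otimes>\<^sub>M \<Theta>)"

definition orientation_distribution :: "(real ^ 'n::{finite,linorder}) measure \<Rightarrow> bool" where
  "orientation_distribution \<Theta> \<longleftrightarrow>
     prob_space \<Theta> \<and> sets \<Theta> = sets (restrict_space borel half_sphere)"

definition nondegenerate :: "(real ^ 'n::{finite,linorder}) measure \<Rightarrow> bool" where
  "nondegenerate \<Theta> \<longleftrightarrow>
     (\<forall>L. subspace L \<and> dim L = CARD('n) - 1 \<longrightarrow> measure \<Theta> (L \<inter> half_sphere) < 1)"

section \<open>The functionals of the intersection process\<close>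

text \<open>
  \<open>x\<close> is a realization of the points \<open>(P\<^sub>i, V\<^sub>i)\<close>. Tuples of pairwise distinct indices are
  distinct lists; the infinite sum has almost surely only finitely many nonzero terms.
\<close>

definition flat_section ::
    "real \<Rightarrow> (nat \<Rightarrow> real \<times> (real ^ 'n)) \<Rightarrow> nat set \<Rightarrow> (real ^ 'n) set" where
  "flat_section r x I = (\<Inter>i\<in>I. hyperplane (x i)) \<inter> cball 0 r"

definition Psi :: "nat \<Rightarrow> real \<Rightarrow> (nat \<Rightarrow> real \<times> (real ^ 'n)) \<Rightarrow> real" where
  "Psi k r x = 1 / fact (CARD('n) - k) *
     (\<Sum>\<^sub>\<infinity>js\<in>{js. length js = CARD('n) - k \<and> distinct js}. chi (flat_section r x (set js)))"

definition zeta :: "nat \<Rightarrow> real \<Rightarrow> (nat \<Rightarrow> real \<times> (real ^ 'n)) \<Rightarrow> real" where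
  "zeta k r x = 1 / fact (CARD('n) - k) *
     (\<Sum>\<^sub>\<infinity>js\<in>{js. length js = CARD('n) - k \<and> distinct js}. vol k (flat_section r x (set js)))"

definition Z_chi ::
    "'w measure \<Rightarrow> real \<Rightarrow> (nat \<Rightarrow> 'w \<Rightarrow> real \<times> (real ^ 'n)) \<Rightarrow> nat \<Rightarrow> real \<Rightarrow> 'w \<Rightarrow> real" where
  "Z_chi M lam X k r w =
     fact (CARD('n) - k - 1) / (2 * lam * r) powr (real CARD('n) - real k - 1 / 2) *
     (Psi k r (\<lambda>i. X i w) - (\<integral>w'. Psi k r (\<lambda>i. X i w') \<partial>M))"

definition Z_nu ::
    "'w measure \<Rightarrow> real \<Rightarrow> (nat \<Rightarrow> 'w \<Rightarrow> real \<times> (real ^ 'n)) \<Rightarrow> nat \<Rightarrow> real \<Rightarrow> 'w \<Rightarrow> real" where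
  "Z_nu M lam X k r w =
     fact (CARD('n) - k - 1) * r powi (- int k)
       / (2 * lam * r) powr (real CARD('n) - real k - 1 / 2) *
     (zeta k r (\<lambda>i. X i w) - (\<integral>w'. zeta k r (\<lambda>i. X i w') \<partial>M))"

section \<open>The asymptotic covariances\<close>

text \<open>The joint law of the i.i.d. sequence \<open>X\<^sub>1, X\<^sub>2, \<dots>\<close> (the coordinate with index \<open>0\<close> is not used).\<close>

definition iid_law ::
    "real \<Rightarrow> (real ^ 'n::{finite,linorder}) measure \<Rightarrow> (nat \<Rightarrow> real \<times> (real ^ 'n::{finite,linorder})) measure" where
  "iid_law r \<Theta> = (\<Pi>\<^sub>M i\<in>UNIV. uniform_measure lborel {-r..r} \<Otimes>\<^sub>M \<Theta>)"

definition sigma_chi :: "real \<Rightarrow> (real ^ 'n::{finite,linorder}) measure \<Rightarrow> nat \<Rightarrow> nat \<Rightarrow> real" where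
  "sigma_chi r \<Theta> k l = (let d = CARD('n) in
     \<integral>x. chi (flat_section r x {1..d - k}) * chi (flat_section r x {d - k..2 * d - k - l - 1})
       \<partial>iid_law r \<Theta>)"

definition sigma_nu :: "real \<Rightarrow> (real ^ 'n::{finite,linorder}) measure \<Rightarrow> nat \<Rightarrow> nat \<Rightarrow> real" where
  "sigma_nu r \<Theta> k l = (let d = CARD('n) in
     r powi (- int (k + l)) *
     (\<integral>x. vol k (flat_section r x {1..d - k}) * vol l (flat_section r x {d - k..2 * d - k - l - 1})
       \<partial>iid_law r \<Theta>))"

section \<open>Vectors indexed by \<open>0, \<dots>, d - 1\<close>, Gaussian vectors, convergence in distribution\<close>

text \<open>The order isomorphism from the index type onto \<open>{0, \<dots>, d - 1}\<close>.\<close>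

definition pos :: "'n::{finite,linorder} \<Rightarrow> nat" where
  "pos i = card {j. j < i}"

definition vec_of :: "(nat \<Rightarrow> real) \<Rightarrow> real ^ 'n::{finite,linorder}" where
  "vec_of a = (\<chi> i. a (pos i))"

definition mat_of :: "(nat \<Rightarrow> nat \<Rightarrow> real) \<Rightarrow> real ^ 'n::{finite,linorder} ^ 'n::{finite,linorder}" where
  "mat_of a = (\<chi> i j. a (pos i) (pos j))"

text \<open>The normal law with mean \<open>m\<close> and variance \<open>v \<ge> 0\<close>, a point mass for \<open>v = 0\<close>.\<close>

definition normal_law :: "real \<Rightarrow> real \<Rightarrow> real measure" where
  "normal_law m v = (if v = 0 then return borel m
     else density lborel (\<lambda>x. ennreal (normal_density m (sqrt v) x)))"

text \<open>
  \<open>N\<close> is the law of a (possibly degenerate) Gaussian vector with mean \<open>\<mu>\<close> and covariance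
  matrix \<open>S\<close>: every linear functional is univariate normal.
\<close>

definition gaussian_law ::
    "real ^ 'n \<Rightarrow> real ^ 'n ^ 'n \<Rightarrow> (real ^ 'n) measure \<Rightarrow> bool" where
  "gaussian_law \<mu> S N \<longleftrightarrow>
     prob_space N \<and> sets N = sets borel \<and>
     (\<forall>t. \<exists>m v. v \<ge> 0 \<and> distr N borel (\<lambda>x. t \<bullet> x) = normal_law m v) \<and>
     (\<forall>i. (\<integral>x. x $ i \<partial>N) = \<mu> $ i) \<and>
     (\<forall>i j. (\<integral>x. (x $ i - \<mu> $ i) * (x $ j - \<mu> $ j) \<partial>N) = S $ i $ j)"

definition converges_in_distribution ::
    "'w measure \<Rightarrow> ('i \<Rightarrow> 'w \<Rightarrow> 'a::metric_space) \<Rightarrow> 'a measure \<Rightarrow> 'i filter \<Rightarrow> bool" where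
  "converges_in_distribution M Y N F \<longleftrightarrow>
     prob_space N \<and> sets N = sets borel \<and>
     (\<forall>\<^sub>F r in F. Y r \<in> borel_measurable M) \<and>
     (\<forall>f :: 'a \<Rightarrow> real. continuous_on UNIV f \<and> bounded (range f) \<longrightarrow>
        ((\<lambda>r. \<integral>w. f (Y r w) \<partial>M) \<longlongrightarrow> (\<integral>x. f x \<partial>N)) F)"

end

theory Submission
  imports Defs
begin

text \<open>A hyperplane H(p, v) with unit normal v meets the ball of radius r exactly when p lies
  between -r and r, so the number of hyperplanes that matter is Poisson with mean \<mu> = 2 lam r.
  Shrinking space by the factor \<rho> / r turns these hyperplanes into a Poisson process with
  intensity \<mu> times a fixed probability law \<kappa>, the \<open>mark_law\<close>, seen through
  a fixed window (\<open>poisson_on_window\<close>). Since \<open>chi\<close> and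
  \<open>vol k\<close> are homogeneous of degree 0 and k, the functionals \<open>Psi k\<close> and
  \<open>zeta k\<close> become, up to 1 / m! and a power of r, Poisson U-statistics of order m = d -
  k: sums over all lists of m distinct points of a bounded symmetric kernel h that does not depend
  on r. Only \<mu> grows.

  The mean of such a U-statistic is \<mu>^m times the integral of h (\<open>campbell\<close>, from
  \<open>factorial_moment_measure\<close>). Second moments come from sorting pairs of lists by their
  overlap (\<open>dlists_product_split\<close>, \<open>usum_product\<close>). Disjoint lists
  reproduce the product of the means. Lists sharing one point contribute m n \<mu>^(m + n - 1) times
  the integral of the product of the projections g(x) = E h(x, X_2, ..., X_m). Larger overlaps are
  of order \<mu>^(m + n - 2). Hence the centred U-statistic equals m \<mu>^(m - 1) times the centred
  sum of g over the points, up to a term of lower order in L2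
  (\<open>usum_linear_approximation\<close>), which disappears after normalization
  (\<open>normalized_approximation\<close>).

  A linear combination of the linear parts is a compensated Poisson sum of q / sqrt \<mu> with q =
  sum of t_k g_k. The logarithm of its characteristic function is \<mu> times the integral of exp(i
  q / sqrt \<mu>) - 1 - i q / sqrt \<mu> (\<open>characteristic_functional\<close>,
  \<open>char_linear_part\<close>), which tends to minus half the integral of q^2
  (\<open>poisson_exponent_tendsto\<close>). This is the exponent of a Gaussian vector whose
  covariances are the integrals of g_k g_l, and these are the sigma numbers, because there the two
  groups of hyperplanes share exactly one (\<open>integral_overlap\<close>). Convergence of cosine
  expectations, together with tightness from bounded second moments, is convergence in distribution
  (\<open>weak_convergence_trig\<close>); \<open>poisson_clt\<close> assembles all this.

  The geometric input is that the kernels are measurable and bounded. Sections of the ball vary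
  upper semicontinuously with the hyperplanes (\<open>open_section_subset\<close>), which makes
  their Hausdorff measure measurable by way of open covers (\<open>vol_measurable\<close>). Almost
  surely, hyperplanes with a common point have linearly independent normals, so that the section
  lies in a k-flat and has volume at most a constant (\<open>AE_vol_section_bound\<close>).
  \<open>intersection_clt\<close> joins both sides for an abstract homogeneous functional.\<close>

section \<open>Trigonometric polynomials and weak convergence\<close>

text \<open>The phase b covers sines, and t = 0 gives the constants, so cosines are the only
  generators; convergence of integrals has to be checked for them alone.\<close>

inductive trig_poly :: "('a::euclidean_space \<Rightarrow> real) \<Rightarrow> bool" where
  cos: "trig_poly (\<lambda>x. cos (t \<bullet> x + b))"
| scale: "trig_poly f \<Longrightarrow> trig_poly (\<lambda>x. c * f x)"
| add: "trig_poly f \<Longrightarrow> trig_poly g \<Longrightarrow> trig_poly (\<lambda>x. f x + g x)"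

lemma trig_poly_const: "trig_poly (\<lambda>x. c)"
  using trig_poly.scale[OF trig_poly.cos[of 0 0], of c] by simp

lemma trig_poly_sum:
  "finite A \<Longrightarrow> (\<And>i. i \<in> A \<Longrightarrow> trig_poly (f i)) \<Longrightarrow> trig_poly (\<lambda>x. \<Sum>i\<in>A. f i x)"
  by (induction A rule: finite_induct) (auto intro: trig_poly.add trig_poly_const)

lemma trig_poly_mult: "trig_poly f \<Longrightarrow> trig_poly g \<Longrightarrow> trig_poly (\<lambda>x. f x * g x)"
proof (induction rule: trig_poly.induct)
  case (cos t b)
  from cos show ?case
  proof (induction rule: trig_poly.induct)
    case (cos u c)
    have "trig_poly (\<lambda>x. (1/2) * cos ((t - u) \<bullet> x + (b - c)) + (1/2) * cos ((t + u) \<bullet> x + (b + c)))"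
      by (intro trig_poly.intros)
    moreover have "cos (t \<bullet> x + b) * cos (u \<bullet> x + c) =
        (1/2) * cos ((t - u) \<bullet> x + (b - c)) + (1/2) * cos ((t + u) \<bullet> x + (b + c))" for x
      unfolding cos_times_cos by (simp add: inner_diff_left inner_add_left algebra_simps add_divide_distrib)
    ultimately show ?case by simp
  next
    case (scale f c)
    then show ?case using trig_poly.scale[of "\<lambda>x. cos (t \<bullet> x + b) * f x" c] by (simp add: mult_ac)
  next
    case (add f g)
    then show ?case using trig_poly.add by (fastforce simp: algebra_simps)
  qed
next
  case (scale f c)
  then show ?case using trig_poly.scale[of "\<lambda>x. f x * g x" c] by (simp add: mult_ac)
next
  case (add f f')
  then show ?case using trig_poly.add[of "\<lambda>x. f x * g x" "\<lambda>x. f' x * g x"] by (simp add: algebra_simps)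
qed

lemma trig_poly_sin: "trig_poly (\<lambda>x. sin (t \<bullet> x))"
  using trig_poly.cos[of t "- (pi / 2)"] by (simp add: cos_diff)

text \<open>Trigonometric polynomials form an algebra containing the sines. This is the bridge from
  Stone-Weierstrass, which yields ordinary polynomials, to test functions whose expectations are
  known to converge.\<close>

lemma real_polynomial_of_sin_trig_poly:
  assumes "real_polynomial_function p"
  shows "trig_poly (\<lambda>x::'a::euclidean_space. p (\<Sum>b\<in>Basis. sin (\<omega> * (x \<bullet> b)) *\<^sub>R b))"
  using assms
proof (induction rule: real_polynomial_function.induct)
  case (linear f)
  interpret bounded_linear f by fact
  have "trig_poly (\<lambda>x::'a. \<Sum>b\<in>Basis. f b * sin ((\<omega> *\<^sub>R b) \<bullet> x))"
    by (intro trig_poly_sum trig_poly.scale trig_poly_sin) auto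
  then show ?case by (simp add: sum scaleR inner_commute mult_ac)
qed (auto intro: trig_poly_const trig_poly_mult trig_poly.add)

lemma trig_poly_continuous: "trig_poly f \<Longrightarrow> continuous_on UNIV f"
  by (induction rule: trig_poly.induct) (auto intro!: continuous_intros)

lemma trig_poly_bounded: "trig_poly f \<Longrightarrow> \<exists>B. \<forall>x. \<bar>f x\<bar> \<le> B"
proof (induction rule: trig_poly.induct)
  case (scale f c)
  then obtain B where "\<And>x. \<bar>f x\<bar> \<le> B" by auto
  then have "\<bar>c * f x\<bar> \<le> \<bar>c\<bar> * B" for x by (simp add: abs_mult mult_left_mono)
  then show ?case by auto
next
  case (add f g)
  then obtain B B' where "\<And>x. \<bar>f x\<bar> \<le> B" "\<And>x. \<bar>g x\<bar> \<le> B'" by auto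
  then have "\<bar>f x + g x\<bar> \<le> B + B'" for x by (meson abs_triangle_ineq add_mono order_trans)
  then show ?case by auto
qed (auto intro: exI[of _ 1])

lemma (in prob_space) integrable_bounded_continuous:
  fixes f :: "'b::euclidean_space \<Rightarrow> real"
  assumes "Y \<in> borel_measurable M" "continuous_on UNIV f" "\<And>x. \<bar>f x\<bar> \<le> B"
  shows "integrable M (\<lambda>w. f (Y w))"
  using assms borel_measurable_continuous_onI[OF assms(2)]
  by (intro integrable_const_bound[where B = B]) (auto intro: measurable_compose)

lemma trig_poly_integral_tendsto:
  fixes Y :: "'i \<Rightarrow> 'w \<Rightarrow> 'a::euclidean_space"
  assumes M: "prob_space M" and N: "prob_space N" and sN: "sets N = sets borel"
    and Y: "\<forall>\<^sub>F r in F. Y r \<in> borel_measurable M"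
    and lim: "\<And>t b. ((\<lambda>r. \<integral>w. cos (t \<bullet> Y r w + b) \<partial>M) \<longlongrightarrow> (\<integral>x. cos (t \<bullet> x + b) \<partial>N)) F"
    and "trig_poly q"
  shows "((\<lambda>r. \<integral>w. q (Y r w) \<partial>M) \<longlongrightarrow> (\<integral>x. q x \<partial>N)) F"
  using \<open>trig_poly q\<close>
proof (induction rule: trig_poly.induct)
  case (cos t b)
  then show ?case by (rule lim)
next
  case (scale f c)
  then show ?case by (auto intro!: tendsto_intros)
next
  case (add f g)
  interpret M: prob_space M by fact
  interpret N: prob_space N by fact
  have id: "(\<lambda>x. x) \<in> borel_measurable N" using sN by (simp add: measurable_def sets_eq_imp_space_eq)
  have iN: "integrable N h" and iM: "\<forall>\<^sub>F r in F. integrable M (\<lambda>w. h (Y r w))" if h: "trig_poly h" for h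
  proof -
    obtain B where B: "\<And>x. \<bar>h x\<bar> \<le> B" using trig_poly_bounded[OF h] by auto
    show "integrable N h"
      using N.integrable_bounded_continuous[OF id trig_poly_continuous[OF h] B] .
    show "\<forall>\<^sub>F r in F. integrable M (\<lambda>w. h (Y r w))"
      using Y by eventually_elim (rule M.integrable_bounded_continuous[OF _ trig_poly_continuous[OF h] B])
  qed
  have "((\<lambda>r. (\<integral>w. f (Y r w) \<partial>M) + (\<integral>w. g (Y r w) \<partial>M)) \<longlongrightarrow> (\<integral>x. f x \<partial>N) + (\<integral>x. g x \<partial>N)) F"
    by (intro tendsto_intros add)
  moreover have "\<forall>\<^sub>F r in F. (\<integral>w. f (Y r w) \<partial>M) + (\<integral>w. g (Y r w) \<partial>M) = (\<integral>w. f (Y r w) + g (Y r w) \<partial>M)"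
    using iM[OF add.hyps(1)] iM[OF add.hyps(2)] by eventually_elim (rule Bochner_Integration.integral_add[symmetric])
  ultimately show ?case
    using iN[OF add.hyps(1)] iN[OF add.hyps(2)] by (simp add: tendsto_cong)
qed

text \<open>
  The triangle wave \<open>arcsin (sin y)\<close> turns \<open>f\<close> into a function that agrees with \<open>f\<close> on a box and
  depends on \<open>x\<close> only through sines, so that uniform approximation by polynomials in these
  sines is available; unlike polynomials in \<open>x\<close>, the approximants stay bounded on the whole space.
\<close>

lemma trig_poly_approx:
  fixes f :: "'a::euclidean_space \<Rightarrow> real"
  assumes f: "continuous_on UNIV f" and B: "\<And>x. \<bar>f x\<bar> \<le> B" and "R > 0" "e > 0"
  obtains q where "trig_poly q" "\<And>x. \<bar>q x\<bar> \<le> B + e" "\<And>x. norm x \<le> R \<Longrightarrow> \<bar>f x - q x\<bar> \<le> e"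
proof -
  define Q where "Q = cbox (- One :: 'a) One"
  \<comment> \<open>The frequency pi / (2 R) sends coordinates in [-R, R] to [-pi/2, pi/2], where
    arcsin inverts sin; hence \<open>G (T x) = x\<close> for \<open>norm x \<le> R\<close>, while
    \<open>T x\<close> stays in the compact cube Q for every x.\<close>
  define T where "T = (\<lambda>x::'a. \<Sum>b\<in>Basis. sin (pi / (2 * R) * (x \<bullet> b)) *\<^sub>R b)"
  define G where "G = (\<lambda>s::'a. \<Sum>b\<in>Basis. (2 * R / pi * arcsin (s \<bullet> b)) *\<^sub>R b)"
  have "continuous_on Q (\<lambda>s. arcsin (s \<bullet> b))" if "b \<in> Basis" for b
    using that by (intro continuous_on_arcsin continuous_intros) (auto simp: Q_def mem_box)
  then have "continuous_on Q G"
    unfolding G_def by (intro continuous_on_sum continuous_on_scaleR continuous_on_mult continuous_on_const)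
  then have cont: "continuous_on Q (\<lambda>s. f (G s))"
    by (rule continuous_on_compose2[OF f]) auto
  obtain p where p: "real_polynomial_function p" "\<And>x. x \<in> Q \<Longrightarrow> \<bar>f (G x) - p x\<bar> < e"
    using Stone_Weierstrass_real_polynomial_function[OF _ cont \<open>e > 0\<close>] unfolding Q_def
    by (metis compact_cbox)
  have TQ: "T x \<in> Q" for x
    by (auto simp: Q_def T_def mem_box)
  have GT: "G (T x) = x" if "norm x \<le> R" for x
  proof -
    have "2 * R / pi * arcsin (sin (pi / (2 * R) * (x \<bullet> b))) = x \<bullet> b" if b: "b \<in> Basis" for b
    proof -
      have xb: "\<bar>x \<bullet> b\<bar> \<le> R" using Basis_le_norm[OF b, of x] \<open>norm x \<le> R\<close> by simp
      have "\<bar>pi / (2 * R) * (x \<bullet> b)\<bar> = pi / (2 * R) * \<bar>x \<bullet> b\<bar>" using \<open>R > 0\<close> by (simp add: abs_mult)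
      also have "\<dots> \<le> pi / (2 * R) * R" using xb \<open>R > 0\<close> by (intro mult_left_mono) auto
      finally have "\<bar>pi / (2 * R) * (x \<bullet> b)\<bar> \<le> pi / 2" using \<open>R > 0\<close> by simp
      then have "arcsin (sin (pi / (2 * R) * (x \<bullet> b))) = pi / (2 * R) * (x \<bullet> b)"
        by (intro arcsin_sin; linarith)
      then show ?thesis using \<open>R > 0\<close> by simp
    qed
    moreover have "T x \<bullet> b = sin (pi / (2 * R) * (x \<bullet> b))" if "b \<in> Basis" for b
      unfolding T_def using that by (rule inner_sum_left_Basis)
    ultimately have "G (T x) = (\<Sum>b\<in>Basis. (x \<bullet> b) *\<^sub>R b)" unfolding G_def by (intro sum.cong refl) simp
    then show ?thesis by (simp add: euclidean_representation)
  qed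
  show ?thesis
  proof
    show "trig_poly (\<lambda>x. p (T x))"
      unfolding T_def by (rule real_polynomial_of_sin_trig_poly[OF p(1)])
    show "\<bar>p (T x)\<bar> \<le> B + e" for x
      using p(2)[OF TQ[of x]] B[of "G (T x)"] by linarith
    show "\<bar>f x - p (T x)\<bar> \<le> e" if "norm x \<le> R" for x
      using p(2)[OF TQ[of x]] GT[OF that] by simp
  qed
qed

text \<open>Up to tightness, bounded continuous functions are limits of trigonometric polynomials: f
  and its approximant q differ by at most d on a large ball, and by at most 2 B + 1 on the
  complement, which has small probability for the limit law and, eventually, for \<open>Y r\<close>.
  This plays the role of the continuity theorem in several dimensions.\<close>

theorem weak_convergence_trig:
  fixes Y :: "'i \<Rightarrow> 'w \<Rightarrow> 'a::euclidean_space" and f :: "'a \<Rightarrow> real"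
  assumes M: "prob_space M" and N: "prob_space N" and sN: "sets N = sets borel"
    and Y: "\<forall>\<^sub>F r in F. Y r \<in> borel_measurable M"
    and lim: "\<And>t b. ((\<lambda>r. \<integral>w. cos (t \<bullet> Y r w + b) \<partial>M) \<longlongrightarrow> (\<integral>x. cos (t \<bullet> x + b) \<partial>N)) F"
    and tight: "\<And>e. e > 0 \<Longrightarrow> \<exists>R. \<forall>\<^sub>F r in F. measure M {w \<in> space M. norm (Y r w) > R} \<le> e"
    and f: "continuous_on UNIV f" "bounded (range f)"
  shows "((\<lambda>r. \<integral>w. f (Y r w) \<partial>M) \<longlongrightarrow> (\<integral>x. f x \<partial>N)) F"
proof (rule tendstoI)
  fix e :: real assume "e > 0"
  interpret M: prob_space M by fact
  interpret N: prob_space N by fact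
  obtain B where "B > 0" and B: "\<And>x. \<bar>f x\<bar> \<le> B" using f(2) by (auto simp: bounded_pos)
  have id: "(\<lambda>x. x) \<in> borel_measurable N" using sN by (simp add: measurable_def sets_eq_imp_space_eq)
  have spN: "space N = UNIV" using sets_eq_imp_space_eq[OF sN] by simp
  \<comment> \<open>The errors add up to 2 (d + (2 B + 1) d) + d = (4 B + 5) d, below 8 (B + 1) d
    \<le> e. The bound d \<le> 1 replaces 2 B + d by 2 B + 1 off the ball.\<close>
  define d where "d = min 1 (e / (8 * (B + 1)))"
  have d: "d > 0" "d \<le> 1"
    using \<open>e > 0\<close> \<open>B > 0\<close> by (auto simp: d_def)
  have "d \<le> e / (8 * (B + 1))" by (simp add: d_def)
  then have d3: "8 * (B + 1) * d \<le> e"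
    using \<open>B > 0\<close> by (subst (asm) pos_le_divide_eq) (auto simp: mult_ac)
  obtain R1 where R1: "\<forall>\<^sub>F r in F. measure M {w \<in> space M. norm (Y r w) > R1} \<le> d"
    using tight[OF \<open>d > 0\<close>] by auto
  have "(\<lambda>n. measure N {x. norm x > real n}) \<longlonglongrightarrow> measure N (\<Inter>n::nat. {x. norm x > real n})"
    using sN by (intro N.finite_Lim_measure_decseq) (auto simp: decseq_def intro!: borel_open open_Collect_less continuous_intros)
  moreover have "(\<Inter>n::nat. {x::'a. norm x > real n}) = {}"
    by (auto simp: not_less) (meson not_less real_arch_simple)
  ultimately have "(\<lambda>n. measure N {x. norm x > real n}) \<longlonglongrightarrow> 0" by simp
  then have "\<forall>\<^sub>F n in sequentially. measure N {x. norm x > real n} < d"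
    using \<open>d > 0\<close> by (rule order_tendstoD)
  then obtain n where n: "measure N {x. norm x > real n} < d"
    by (meson eventually_happens sequentially_bot)
  \<comment> \<open>Large enough for both tails, that of \<open>Y r\<close> and that of N; the
    maximum with 1 makes it positive.\<close>
  define R where "R = max (max R1 (real n)) 1"
  have "R > 0" by (simp add: R_def)
  obtain q where q: "trig_poly q" "\<And>x. \<bar>q x\<bar> \<le> B + d" "\<And>x. norm x \<le> R \<Longrightarrow> \<bar>f x - q x\<bar> \<le> d"
    using trig_poly_approx[OF f(1) B \<open>R > 0\<close> \<open>d > 0\<close>] by blast
  \<comment> \<open>Stated for an arbitrary probability space because it is applied twice: to N with
    the identity and to M with \<open>Y r\<close>.\<close>
  have key: "\<bar>(\<integral>w. f (V w) \<partial>P) - (\<integral>w. q (V w) \<partial>P)\<bar> \<le> d + (2 * B + 1) * d"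
    if P: "prob_space P" and V[measurable]: "V \<in> borel_measurable P"
      and tail: "measure P {w \<in> space P. norm (V w) > R} \<le> d" for P :: "'z measure" and V
  proof -
    interpret P: prob_space P by fact
    have i: "integrable P (\<lambda>w. f (V w))" "integrable P (\<lambda>w. q (V w))"
      using P.integrable_bounded_continuous[OF V f(1) B]
        P.integrable_bounded_continuous[OF V trig_poly_continuous[OF q(1)] q(2)] .
    let ?A = "{w \<in> space P. norm (V w) > R}"
    have A[measurable]: "?A \<in> sets P" by measurable
    have "\<bar>(\<integral>w. f (V w) \<partial>P) - (\<integral>w. q (V w) \<partial>P)\<bar> = \<bar>\<integral>w. f (V w) - q (V w) \<partial>P\<bar>"
      using i by simp
    also have "\<dots> \<le> (\<integral>w. \<bar>f (V w) - q (V w)\<bar> \<partial>P)"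
      by (rule integral_abs_bound)
    also have "\<dots> \<le> (\<integral>w. d + (2 * B + 1) * indicator ?A w \<partial>P)"
    proof (rule integral_mono)
      show "integrable P (\<lambda>w. \<bar>f (V w) - q (V w)\<bar>)" using i by auto
      show "integrable P (\<lambda>w. d + (2 * B + 1) * indicator ?A w)"
        by (intro Bochner_Integration.integrable_add integrable_mult_right integrable_real_indicator) (auto simp: less_top[symmetric])
      fix w assume "w \<in> space P"
      then show "\<bar>f (V w) - q (V w)\<bar> \<le> d + (2 * B + 1) * indicator ?A w"
        using q(3)[of "V w"] q(2)[of "V w"] B[of "V w"] d(1,2) by (auto simp: indicator_def)
    qed
    also have "\<dots> = d + (2 * B + 1) * measure P ?A"
      by (subst Bochner_Integration.integral_add)
        (auto intro!: integrable_mult_right integrable_real_indicator simp: less_top[symmetric] P.prob_space)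
    also have "\<dots> \<le> d + (2 * B + 1) * d"
      using tail \<open>B > 0\<close> by (intro add_left_mono mult_left_mono) auto
    finally show ?thesis .
  qed
  have "measure N {x. norm x > R} \<le> measure N {x. norm x > real n}"
    using sN by (intro N.finite_measure_mono) (auto simp: R_def intro!: borel_open open_Collect_less continuous_intros)
  then have kN: "\<bar>(\<integral>x. f x \<partial>N) - (\<integral>x. q x \<partial>N)\<bar> \<le> d + (2 * B + 1) * d"
    using key[OF N id] n spN by simp
  have kM: "\<forall>\<^sub>F r in F. \<bar>(\<integral>w. f (Y r w) \<partial>M) - (\<integral>w. q (Y r w) \<partial>M)\<bar> \<le> d + (2 * B + 1) * d"
    using Y R1
  proof eventually_elim
    case (elim r)
    have [measurable]: "Y r \<in> borel_measurable M" by fact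
    have "measure M {w \<in> space M. norm (Y r w) > R} \<le> measure M {w \<in> space M. norm (Y r w) > R1}"
      by (intro M.finite_measure_mono) (auto simp: R_def)
    with elim show ?case by (intro key[OF M]) auto
  qed
  have "\<forall>\<^sub>F r in F. dist (\<integral>w. q (Y r w) \<partial>M) (\<integral>x. q x \<partial>N) < d"
    using trig_poly_integral_tendsto[OF M N sN Y lim q(1)] \<open>d > 0\<close> by (rule tendstoD)
  with kM show "\<forall>\<^sub>F r in F. dist (\<integral>w. f (Y r w) \<partial>M) (\<integral>x. f x \<partial>N) < e"
  proof eventually_elim
    case (elim r)
    have "dist (\<integral>w. f (Y r w) \<partial>M) (\<integral>x. f x \<partial>N) < 2 * (d + (2 * B + 1) * d) + d"
      using elim kN by (auto simp: dist_real_def)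
    also have "\<dots> \<le> 8 * (B + 1) * d" using d(1) \<open>B > 0\<close> by (simp add: algebra_simps)
    finally show ?case using d3 by simp
  qed
qed

section \<open>Covariance matrices and Gaussian laws\<close>

lemma sum_sum_insert_symmetric:
  fixes S :: "'i \<Rightarrow> 'i \<Rightarrow> real"
  assumes "finite I" "p \<notin> I" and sym: "\<And>i j. S i j = S j i"
  shows "(\<Sum>i\<in>insert p I. \<Sum>j\<in>insert p I. c i * c j * S i j) =
    (\<Sum>i\<in>I. \<Sum>j\<in>I. c i * c j * S i j) + 2 * c p * (\<Sum>i\<in>I. c i * S i p) + (c p)\<^sup>2 * S p p"
proof -
  have "(\<Sum>i\<in>insert p I. \<Sum>j\<in>insert p I. c i * c j * S i j) =
      (c p * c p * S p p + (\<Sum>j\<in>I. c p * c j * S p j)) +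
      ((\<Sum>i\<in>I. c i * c p * S i p) + (\<Sum>i\<in>I. \<Sum>j\<in>I. c i * c j * S i j))"
    using assms(1,2) by (simp add: sum.distrib)
  moreover have "(\<Sum>j\<in>I. c p * c j * S p j) = c p * (\<Sum>i\<in>I. c i * S i p)"
    unfolding sum_distrib_left by (intro sum.cong refl) (simp add: sym[of p])
  moreover have "(\<Sum>i\<in>I. c i * c p * S i p) = c p * (\<Sum>i\<in>I. c i * S i p)"
    unfolding sum_distrib_left by (intro sum.cong refl) simp
  ultimately show ?thesis by (simp add: power2_eq_square)
qed

text \<open>Cholesky decomposition; the induction step passes to the Schur complement.\<close>

lemma psd_factorization:
  fixes S :: "'i \<Rightarrow> 'i \<Rightarrow> real"
  assumes "finite I" and "\<And>i j. S i j = S j i"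
    and "\<And>c. 0 \<le> (\<Sum>i\<in>I. \<Sum>j\<in>I. c i * c j * S i j)"
  shows "\<exists>a. \<forall>i\<in>I. \<forall>j\<in>I. S i j = (\<Sum>k\<in>I. a i k * a j k)"
  using assms
proof (induction I arbitrary: S rule: finite_induct)
  case empty
  then show ?case by simp
next
  case (insert p I)
  note sym = insert.prems(1) and psd = insert.prems(2)
  note expand = sum_sum_insert_symmetric[OF insert.hyps(1,2), of S, OF sym]
  have Spp: "S p p \<ge> 0"
  proof -
    define c where "c = (\<lambda>i. if i = p then 1 else (0::real))"
    have "c i = 0" if "i \<in> I" for i using that insert.hyps by (auto simp: c_def)
    then show ?thesis using psd[of c] unfolding expand by (simp add: c_def)
  qed
  \<comment> \<open>A vanishing pivot forces its column to vanish: on the vector with entry t at p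
    and 1 at i the form is affine in t with slope \<open>2 * S i p\<close>, which cannot stay
    nonnegative unless the slope is 0.\<close>
  have Sip: "S i p = 0" if "S p p = 0" "i \<in> I" for i
  proof (rule ccontr)
    assume nz: "S i p \<noteq> 0"
    have "0 \<le> S i i + 2 * t * S i p" for t
    proof -
      define c where "c = (\<lambda>j. if j = p then t else if j = i then 1 else (0::real))"
      have ip: "i \<noteq> p" using that insert.hyps by auto
      have cI: "c j = (if j = i then 1 else 0)" if "j \<in> I" for j using that insert.hyps by (auto simp: c_def)
      have single: "(\<Sum>j\<in>I. c j * f j) = f i" for f
      proof -
        have "(\<Sum>j\<in>I. c j * f j) = (\<Sum>j\<in>I. if j = i then f j else 0)"
          using cI by (intro sum.cong) auto
        then show ?thesis using that insert.hyps(1) by simp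
      qed
      have "(\<Sum>j\<in>I. \<Sum>k\<in>I. c j * c k * S j k) = S i i"
        by (simp add: mult.assoc sum_distrib_left[symmetric] single)
      then show ?thesis
        using psd[of c] that single[of "\<lambda>j. S j p"] unfolding expand by (simp add: c_def)
    qed
    from this[of "- (S i i + 1) / (2 * S i p)"] nz show False by (simp add: field_simps)
  qed
  define S' where "S' = (\<lambda>i j. S i j - S i p * S j p / S p p)"
  have "\<exists>a. \<forall>i\<in>I. \<forall>j\<in>I. S' i j = (\<Sum>k\<in>I. a i k * a j k)"
  proof (rule insert.IH)
    show "S' i j = S' j i" for i j by (simp add: S'_def sym[of i j])
    fix c :: "'i \<Rightarrow> real"
    \<comment> \<open>The entry at p minimizes the quadratic form when the other entries are fixed,
      and the minimum is the form of the Schur complement \<open>S'\<close>. For a zero pivot,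
      division by zero gives 0 and the identity below still holds.\<close>
    define c' where "c' = c(p := - (\<Sum>i\<in>I. c i * S i p) / S p p)"
    have c'I: "c' i = c i" if "i \<in> I" for i using that insert.hyps by (auto simp: c'_def)
    let ?s = "\<Sum>i\<in>I. c i * S i p"
    have "0 \<le> (\<Sum>i\<in>I. \<Sum>j\<in>I. c i * c j * S i j) + 2 * c' p * ?s + (c' p)\<^sup>2 * S p p"
      using psd[of c'] c'I unfolding expand by (simp cong: sum.cong)
    also have "\<dots> = (\<Sum>i\<in>I. \<Sum>j\<in>I. c i * c j * S i j) - ?s * ?s / S p p"
      by (cases "S p p = 0") (auto simp: c'_def field_simps power2_eq_square)
    also have "\<dots> = (\<Sum>i\<in>I. \<Sum>j\<in>I. c i * c j * S' i j)"
    proof -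
      have "?s * ?s / S p p = (\<Sum>i\<in>I. \<Sum>j\<in>I. c i * c j * (S i p * S j p / S p p))"
        unfolding sum_product sum_divide_distrib by (intro sum.cong refl) simp
      then show ?thesis by (simp add: S'_def right_diff_distrib sum_subtractf)
    qed
    finally show "0 \<le> (\<Sum>i\<in>I. \<Sum>j\<in>I. c i * c j * S' i j)" .
  qed
  then obtain a where a: "\<And>i j. i \<in> I \<Longrightarrow> j \<in> I \<Longrightarrow> S' i j = (\<Sum>k\<in>I. a i k * a j k)" by auto
  \<comment> \<open>Column p is the normalized pivot column, and row p has no other entry. With a
    zero pivot this column is 0, which agrees with \<open>Sip\<close>.\<close>
  define a' where "a' = (\<lambda>i k. if k = p then S i p / sqrt (S p p) else if i = p then 0 else a i k)"
  have sq: "sqrt (S p p) * sqrt (S p p) = S p p" using Spp by simp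
  have "S i j = (\<Sum>k\<in>insert p I. a' i k * a' j k)" if ij: "i \<in> insert p I" "j \<in> insert p I" for i j
  proof -
    have "(\<Sum>k\<in>insert p I. a' i k * a' j k) =
        S i p * S j p / S p p + (\<Sum>k\<in>I. (if i = p then 0 else a i k) * (if j = p then 0 else a j k))"
      using insert.hyps sq by (auto simp: a'_def intro!: arg_cong2[where f="(+)"] sum.cong)
    also have "\<dots> = S i j"
    proof (cases "i = p \<or> j = p")
      case True
      have *: "S x p * S p p / S p p = S x p" if "x \<in> insert p I" for x
        using Sip[of x] that by (cases "S p p = 0") auto
      have "(\<Sum>k\<in>I. (if i = p then 0 else a i k) * (if j = p then 0 else a j k)) = 0"
        using True by (intro sum.neutral) auto
      moreover have "S i p * S j p / S p p = S i j"
        using True *[OF ij(1)] *[OF ij(2)] sym[of p j] by (auto simp: mult.commute)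
      ultimately show ?thesis by simp
    next
      case False
      then show ?thesis using a[of i j] ij by (simp add: S'_def)
    qed
    finally show ?thesis by simp
  qed
  then show ?case by blast
qed

lemma prob_space_normal_law: "v \<ge> 0 \<Longrightarrow> prob_space (normal_law m v)"
  by (auto simp: normal_law_def prob_space_return intro!: prob_space_normal_density)

lemma real_distribution_normal_law: "v \<ge> 0 \<Longrightarrow> real_distribution (normal_law m v)"
  using prob_space_normal_law[of v m]
  by (auto simp: normal_law_def real_distribution_def real_distribution_axioms_def)

lemma normal_law_eq_distr:
  assumes "v > 0"
  shows "normal_law 0 v = distr std_normal_distribution borel (\<lambda>x. sqrt v * x)"
proof -
  interpret std: prob_space std_normal_distribution by (rule prob_space_normal_density) simp
  have "distributed std_normal_distribution lborel (\<lambda>x. x) std_normal_density"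
    unfolding distributed_def by (auto simp: distr_id2)
  from std.normal_density_affine[OF this, of "sqrt v" 0] assms
  have "distributed std_normal_distribution lborel (\<lambda>x. sqrt v * x) (normal_density 0 (sqrt v))"
    by simp
  then have "distr std_normal_distribution lborel (\<lambda>x. sqrt v * x) = density lborel (normal_density 0 (sqrt v))"
    unfolding distributed_def by simp
  moreover have "distr std_normal_distribution lborel (\<lambda>x. sqrt v * x) = distr std_normal_distribution borel (\<lambda>x. sqrt v * x)"
    by (rule distr_cong) auto
  ultimately show ?thesis using assms by (simp add: normal_law_def)
qed

lemma char_normal_law:
  assumes "v \<ge> 0"
  shows "char (normal_law 0 v) s = complex_of_real (exp (- (v * s\<^sup>2) / 2))"
proof (cases "v = 0")
  case True
  have "char (return borel 0) s = (1::complex)"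
    unfolding char_def by (subst integral_return) auto
  then show ?thesis using True by (simp add: normal_law_def)
next
  case False
  with assms have "v > 0" by simp
  have "char (normal_law 0 v) s = char std_normal_distribution (s * sqrt v)"
    unfolding normal_law_eq_distr[OF \<open>v > 0\<close>] char_def by (subst integral_distr) (auto simp: mult_ac)
  then show ?thesis
    using \<open>v > 0\<close> by (simp add: char_std_normal_distribution power_mult_distrib mult_ac)
qed

lemma normal_law_moments:
  assumes "v \<ge> 0"
  shows "integrable (normal_law 0 v) (\<lambda>x. x)" "(\<integral>x. x \<partial>normal_law 0 v) = 0"
    "integrable (normal_law 0 v) (\<lambda>x. x\<^sup>2)" "(\<integral>x. x\<^sup>2 \<partial>normal_law 0 v) = v"
proof -
  have ret: "integrable (return borel (0::real)) f" if [measurable]: "f \<in> borel_measurable borel" for f :: "real \<Rightarrow> real"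
    by (rule integrableI_bounded) (auto simp: nn_integral_return)
  show "integrable (normal_law 0 v) (\<lambda>x. x)" "(\<integral>x. x \<partial>normal_law 0 v) = 0"
    "integrable (normal_law 0 v) (\<lambda>x. x\<^sup>2)" "(\<integral>x. x\<^sup>2 \<partial>normal_law 0 v) = v"
    using normal_moment_nz_1[of "sqrt v" 0] normal_moment_even[of "sqrt v" 0 1] assms
    by (auto simp: normal_law_def ret integral_return integrable_density integral_density
        has_bochner_integral_iff normal_density_nonneg field_simps power2_eq_square)
qed

lemma borel_measurable_vec_lambda:
  fixes f :: "'n::finite \<Rightarrow> 'a \<Rightarrow> real"
  assumes "\<And>i. f i \<in> borel_measurable M"
  shows "(\<lambda>x. \<chi> i. f i x) \<in> borel_measurable M"
  using assms by (subst borel_measurable_euclidean_space) (auto simp: Basis_vec_def inner_axis)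

text \<open>The law is the image of independent standard normals under a matrix a with
  \<open>S = a a^T\<close>. Every linear functional is then a combination of independent normals,
  and its law is identified by the characteristic function. The cosine formula is the one against
  which the limit is compared.\<close>

lemma gaussian_law_exists:
  fixes S :: "real ^ 'n ^ 'n"
  assumes sym: "\<And>i j. S $ i $ j = S $ j $ i"
    and psd: "\<And>c. 0 \<le> (\<Sum>i\<in>UNIV. \<Sum>j\<in>UNIV. c i * c j * S $ i $ j)"
  obtains N where "gaussian_law 0 S N"
    "\<And>t b. (\<integral>x. cos (t \<bullet> x + b) \<partial>N) = exp (- (t \<bullet> (S *v t)) / 2) * cos b"
proof -
  have "\<exists>a. \<forall>i\<in>UNIV. \<forall>j\<in>UNIV. S $ i $ j = (\<Sum>k\<in>(UNIV::'n set). a i k * a j k)"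
    by (rule psd_factorization[OF finite_class.finite_UNIV sym psd])
  then obtain a where "\<forall>i\<in>UNIV. \<forall>j\<in>UNIV. S $ i $ j = (\<Sum>k\<in>(UNIV::'n set). a i k * a j k)" by (rule exE)
  then have a: "S $ i $ j = (\<Sum>k\<in>UNIV. a i k * a j k)" for i j by blast
  interpret std: prob_space std_normal_distribution by (rule prob_space_normal_density) simp
  interpret P: product_prob_space "\<lambda>_::'n. std_normal_distribution" UNIV ..
  interpret fP: finite_product_prob_space "\<lambda>_::'n. std_normal_distribution" UNIV by standard simp
  define Zm where "Zm = PiM (UNIV :: 'n set) (\<lambda>_. std_normal_distribution)"
  define T :: "('n \<Rightarrow> real) \<Rightarrow> real ^ 'n" where "T = (\<lambda>z. \<chi> i. \<Sum>k\<in>UNIV. a i k * z k)"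
  have [measurable]: "T \<in> borel_measurable Zm"
    unfolding T_def Zm_def by (rule borel_measurable_vec_lambda) measurable
  define N where "N = distr Zm borel T"
  interpret Zm: prob_space Zm unfolding Zm_def by (rule P.prob_space_axioms)
  interpret N: prob_space N unfolding N_def by (rule Zm.prob_space_distr) measurable
  define v where "v = (\<lambda>t. t \<bullet> (S *v t))"
  define c where "c = (\<lambda>t k. \<Sum>i\<in>UNIV. t $ i * a i k)"
  have tT: "t \<bullet> T z = (\<Sum>k\<in>UNIV. c t k * z k)" for t z
    unfolding T_def c_def inner_vec_def
    by (simp add: sum_distrib_left sum_distrib_right mult_ac) (rule sum.swap)
  have v_eq: "v t = (\<Sum>k\<in>UNIV. (c t k)\<^sup>2)" for t
  proof -
    have "v t = (\<Sum>i\<in>UNIV. \<Sum>j\<in>UNIV. \<Sum>k\<in>UNIV. t $ i * a i k * (t $ j * a j k))"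
      unfolding v_def inner_vec_def matrix_vector_mult_def a
      by (simp add: sum_distrib_left sum_distrib_right mult_ac)
    also have "\<dots> = (\<Sum>k\<in>UNIV. \<Sum>i\<in>UNIV. \<Sum>j\<in>UNIV. t $ i * a i k * (t $ j * a j k))"
      by (subst sum.swap, subst (2) sum.swap) (rule refl)
    also have "\<dots> = (\<Sum>k\<in>UNIV. (c t k)\<^sup>2)"
      unfolding c_def power2_eq_square sum_product ..
    finally show ?thesis .
  qed
  have v_nn: "v t \<ge> 0" for t unfolding v_eq by (intro sum_nonneg) auto
  have char: "(\<integral>z. iexp (s * (t \<bullet> T z)) \<partial>Zm) = complex_of_real (exp (- (v t * s\<^sup>2) / 2))" for s t
  proof -
    have "(\<integral>z. iexp (s * (t \<bullet> T z)) \<partial>Zm) = (\<integral>z. (\<Prod>k\<in>UNIV. iexp (s * c t k * z k)) \<partial>Zm)"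
      unfolding tT by (simp add: sum_distrib_left exp_sum[symmetric] mult_ac)
    also have "\<dots> = (\<Prod>k\<in>UNIV. char std_normal_distribution (s * c t k))"
      unfolding Zm_def char_def
      by (subst P.product_integral_prod) (auto intro!: std.integrable_const_bound[where B = 1])
    also have "\<dots> = complex_of_real (\<Prod>k\<in>UNIV. exp (- ((s * c t k)\<^sup>2) / 2))"
      by (simp add: char_std_normal_distribution)
    also have "(\<Prod>k\<in>UNIV. exp (- ((s * c t k)\<^sup>2) / 2)) = exp (- (v t * s\<^sup>2) / 2)"
      unfolding v_eq exp_sum[OF finite, symmetric] sum_distrib_right sum_negf[symmetric] sum_divide_distrib
      by (intro arg_cong[where f=exp] sum.cong refl) (simp add: power_mult_distrib)
    finally show ?thesis .
  qed
  have law: "distr N borel (\<lambda>x. t \<bullet> x) = normal_law 0 (v t)" for t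
  proof (rule Levy_uniqueness)
    show "real_distribution (distr N borel (\<lambda>x. t \<bullet> x))"
      by (intro N.real_distribution_distr) (simp add: N_def)
    show "real_distribution (normal_law 0 (v t))" using v_nn by (rule real_distribution_normal_law)
    show "char (distr N borel (\<lambda>x. t \<bullet> x)) = char (normal_law 0 (v t))"
    proof
      fix s
      have "char (distr N borel (\<lambda>x. t \<bullet> x)) s = (\<integral>z. iexp (s * (t \<bullet> T z)) \<partial>Zm)"
        unfolding char_def N_def by (simp add: integral_distr)
      then show "char (distr N borel (\<lambda>x. t \<bullet> x)) s = char (normal_law 0 (v t)) s"
        using char[of s t] by (simp add: char_normal_law[OF v_nn])
    qed
  qed
  have mt: "(\<lambda>x. t \<bullet> x) \<in> borel_measurable N" for t by (simp add: N_def)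
  have m1: "integrable N (\<lambda>x. t \<bullet> x)" "(\<integral>x. t \<bullet> x \<partial>N) = 0" for t
    using normal_law_moments(1,2)[OF v_nn[of t]] unfolding law[symmetric]
    by (simp_all add: integrable_distr_eq[OF mt] integral_distr[OF mt])
  have m2: "integrable N (\<lambda>x. (t \<bullet> x)\<^sup>2)" "(\<integral>x. (t \<bullet> x)\<^sup>2 \<partial>N) = v t" for t
    using normal_law_moments(3,4)[OF v_nn[of t]] unfolding law[symmetric]
    by (simp_all add: integrable_distr_eq[OF mt] integral_distr[OF mt])
  have cov: "(\<integral>x. x $ i * x $ j \<partial>N) = S $ i $ j" for i j
  proof -
    \<comment> \<open>Polarization: covariances follow from the variances of the functionals
      \<open>axis i 1 + axis j 1\<close> and \<open>axis i 1 - axis j 1\<close>.\<close>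
    let ?p = "axis i 1 + axis j 1 :: real ^ 'n" and ?m = "axis i 1 - axis j 1 :: real ^ 'n"
    have "x $ i * x $ j = (?p \<bullet> x)\<^sup>2 / 4 - (?m \<bullet> x)\<^sup>2 / 4" for x :: "real ^ 'n"
      by (simp add: inner_add_left inner_diff_left inner_axis' power2_eq_square field_simps)
    then have "(\<integral>x. x $ i * x $ j \<partial>N) = v ?p / 4 - v ?m / 4"
      using m2 by simp
    also have "\<dots> = S $ i $ j"
      by (simp add: v_def matrix_vector_right_distrib matrix_vector_mult_diff_distrib inner_add_left inner_diff_left
          inner_axis' matrix_vector_mult_basis column_def sym[of j i] field_simps)
    finally show ?thesis .
  qed
  show ?thesis
  proof
    show "gaussian_law 0 S N"
      unfolding gaussian_law_def
    proof (intro conjI allI)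
      show "prob_space N" by (rule N.prob_space_axioms)
      show "sets N = sets borel" by (simp add: N_def)
      show "\<exists>m v. v \<ge> 0 \<and> distr N borel (\<lambda>x. t \<bullet> x) = normal_law m v" for t
        using law v_nn by blast
      show "(\<integral>x. x $ i \<partial>N) = 0 $ i" for i
        using m1(2)[of "axis i 1"] by (simp add: inner_axis')
      show "(\<integral>x. (x $ i - 0 $ i) * (x $ j - 0 $ j) \<partial>N) = S $ i $ j" for i j
        using cov by simp
    qed
    fix t b
    have int: "integrable Zm (\<lambda>z. iexp (t \<bullet> T z))"
      by (intro Zm.integrable_const_bound[where B = 1]) auto
    have "(\<integral>x. cos (t \<bullet> x + b) \<partial>N) = (\<integral>z. Re (iexp (t \<bullet> T z) * cis b) \<partial>Zm)"
      unfolding N_def by (subst integral_distr) (auto simp: cis_conv_exp cos_add Re_exp Im_exp)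
    also have "\<dots> = Re (\<integral>z. iexp (t \<bullet> T z) * cis b \<partial>Zm)"
      using int by (intro integral_Re) auto
    also have "(\<integral>z. iexp (t \<bullet> T z) * cis b \<partial>Zm) = (\<integral>z. iexp (t \<bullet> T z) \<partial>Zm) * cis b"
      by simp
    also have "\<dots> = complex_of_real (exp (- v t / 2)) * cis b"
      using char[of 1 t] by simp
    finally show "(\<integral>x. cos (t \<bullet> x + b) \<partial>N) = exp (- (t \<bullet> (S *v t)) / 2) * cos b"
      by (simp add: v_def)
  qed
qed

section \<open>Counting lists of distinct entries\<close>

definition dlists :: "nat \<Rightarrow> 'a set \<Rightarrow> 'a list set" where
  "dlists m S = {js. length js = m \<and> distinct js \<and> set js \<subseteq> S}"

lemma finite_dlists: "finite S \<Longrightarrow> finite (dlists m S)"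
  by (rule finite_subset[OF _ finite_lists_length_eq[of S m]]) (auto simp: dlists_def)

lemma finite_lists_in_blocks:
  assumes "\<And>b. finite (E b)"
  shows "finite {js. length js = m \<and> distinct js \<and> (\<forall>j<m. js ! j \<in> E (\<sigma> j))}"
  by (rule finite_subset[OF _ finite_lists_length_eq[of "\<Union>j<m. E (\<sigma> j)" m]])
    (fastforce simp: in_set_conv_nth assms)+

text \<open>Fill the positions from left to right. As the blocks are disjoint, the entries already
  used up in the block of position j are exactly those at earlier positions with the same
  block.\<close>

lemma card_dlists_in_blocks:
  fixes E :: "nat \<Rightarrow> 'a set"
  assumes fin: "\<And>b. finite (E b)" and disj: "\<And>a b. a \<noteq> b \<Longrightarrow> E a \<inter> E b = {}"
  shows "card {js. length js = m \<and> distinct js \<and> (\<forall>j<m. js ! j \<in> E (\<sigma> j))} =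
    (\<Prod>j<m. card (E (\<sigma> j)) - card {i. i < j \<and> \<sigma> i = \<sigma> j})"
proof (induction m)
  case 0
  have "{js::'a list. length js = 0 \<and> distinct js \<and> (\<forall>j<0. js ! j \<in> E (\<sigma> j))} = {[]}" by auto
  then show ?case by simp
next
  case (Suc m)
  let ?L = "\<lambda>m. {js. length js = m \<and> distinct js \<and> (\<forall>j<m. js ! j \<in> E (\<sigma> j))}"
  let ?P = "SIGMA js:?L m. E (\<sigma> m) - set js"
  have "?L (Suc m) = (\<lambda>(js, x). js @ [x]) ` ?P"
  proof (intro equalityI subsetI)
    fix ks assume ks: "ks \<in> ?L (Suc m)"
    then have "ks \<noteq> []" by auto
    then obtain js x where eq: "ks = js @ [x]" by (metis append_butlast_last_id)
    have len: "length js = m" using ks eq by simp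
    have "js ! j \<in> E (\<sigma> j)" if "j < m" for j
    proof -
      have "ks ! j \<in> E (\<sigma> j)" using ks that by auto
      then show ?thesis using eq len that by (simp add: nth_append)
    qed
    moreover have "ks ! m \<in> E (\<sigma> m)" using ks by auto
    ultimately show "ks \<in> (\<lambda>(js, x). js @ [x]) ` ?P"
      using ks eq len by (auto simp: image_iff)
  next
    fix ks assume "ks \<in> (\<lambda>(js, x). js @ [x]) ` ?P"
    then show "ks \<in> ?L (Suc m)" by (auto simp: nth_append less_Suc_eq)
  qed
  moreover have "inj_on (\<lambda>(js, x). js @ [x]) ?P" by (auto simp: inj_on_def)
  ultimately have "card (?L (Suc m)) = card ?P" by (simp add: card_image)
  also have "\<dots> = (\<Sum>js\<in>?L m. card (E (\<sigma> m) - set js))"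
    using fin finite_lists_in_blocks[of E, OF fin] by (intro card_SigmaI) auto
  also have "\<dots> = (\<Sum>js\<in>?L m. card (E (\<sigma> m)) - card {i. i < m \<and> \<sigma> i = \<sigma> m})"
  proof (intro sum.cong refl)
    fix js assume js: "js \<in> ?L m"
    have "E (\<sigma> m) \<inter> set js = (!) js ` {i. i < m \<and> \<sigma> i = \<sigma> m}"
    proof (intro equalityI subsetI)
      fix x assume x: "x \<in> E (\<sigma> m) \<inter> set js"
      then obtain i where i: "i < m" "x = js ! i" using js by (auto simp: in_set_conv_nth)
      then have "x \<in> E (\<sigma> i)" using js by auto
      then have "\<sigma> i = \<sigma> m" using disj[of "\<sigma> i" "\<sigma> m"] x by auto
      then show "x \<in> (!) js ` {i. i < m \<and> \<sigma> i = \<sigma> m}" using i by auto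
    next
      fix x assume "x \<in> (!) js ` {i. i < m \<and> \<sigma> i = \<sigma> m}"
      then obtain i where i: "i < m" "\<sigma> i = \<sigma> m" "x = js ! i" by auto
      then have "x \<in> E (\<sigma> i)" "x \<in> set js" using js by auto
      then show "x \<in> E (\<sigma> m) \<inter> set js" using i by simp
    qed
    moreover have "inj_on ((!) js) {i. i < m \<and> \<sigma> i = \<sigma> m}"
      using js by (auto simp: inj_on_def nth_eq_iff_index_eq)
    ultimately have "card (E (\<sigma> m) \<inter> set js) = card {i. i < m \<and> \<sigma> i = \<sigma> m}"
      by (simp add: card_image)
    then show "card (E (\<sigma> m) - set js) = card (E (\<sigma> m)) - card {i. i < m \<and> \<sigma> i = \<sigma> m}"
      using card_Diff_subset_Int[of "E (\<sigma> m)" "set js"] fin by simp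
  qed
  also have "\<dots> = card (?L m) * (card (E (\<sigma> m)) - card {i. i < m \<and> \<sigma> i = \<sigma> m})" by simp
  finally show ?case using Suc.IH by simp
qed

text \<open>The falling factorial; truncated subtraction makes it 0 for \<open>x < p\<close>, as it
  should be.\<close>

definition falling :: "nat \<Rightarrow> nat \<Rightarrow> nat" where
  "falling p x = (\<Prod>c<p. x - c)"

lemma falling_times_fact: "falling p (k + p) * fact k = fact (k + p)"
proof (induction p arbitrary: k)
  case (Suc p)
  have "falling (Suc p) (k + Suc p) = (k + Suc p) * falling p (k + p)"
    unfolding falling_def by (subst prod.lessThan_Suc_shift) simp
  then have "falling (Suc p) (k + Suc p) * fact k = (k + Suc p) * fact (k + p)"
    using Suc.IH[of k] by (simp only: mult.assoc)
  then show ?case by simp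
qed (simp add: falling_def)

text \<open>Collect the factors by block: the successive positions that belong to block b contribute
  \<open>x b\<close>, \<open>x b - 1\<close>, and so on.\<close>

lemma prod_blocks_falling:
  fixes m n :: nat
  assumes "\<And>j. j < m \<Longrightarrow> \<sigma> j < n"
  shows "(\<Prod>j<m. x (\<sigma> j) - card {i. i < j \<and> \<sigma> i = \<sigma> j}) =
    (\<Prod>b<n. falling (card {j. j < m \<and> \<sigma> j = b}) (x b))"
  using assms
proof (induction m)
  case 0
  then show ?case by (simp add: falling_def)
next
  case (Suc m)
  let ?c = "\<lambda>m b. card {j. j < m \<and> \<sigma> j = b}"
  have same: "?c (Suc m) b = ?c m b" if "b \<noteq> \<sigma> m" for b
    using that by (metis less_Suc_eq)
  have "{j. j < Suc m \<and> \<sigma> j = \<sigma> m} = insert m {j. j < m \<and> \<sigma> j = \<sigma> m}" by auto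
  then have "?c (Suc m) (\<sigma> m) = Suc (?c m (\<sigma> m))" by simp
  then have step: "falling (?c (Suc m) (\<sigma> m)) (x (\<sigma> m)) = falling (?c m (\<sigma> m)) (x (\<sigma> m)) * (x (\<sigma> m) - ?c m (\<sigma> m))"
    by (simp add: falling_def)
  have mem: "\<sigma> m \<in> {..<n}" using Suc.prems by simp
  have "(\<Prod>b<n. falling (?c (Suc m) b) (x b)) =
      falling (?c (Suc m) (\<sigma> m)) (x (\<sigma> m)) * (\<Prod>b\<in>{..<n} - {\<sigma> m}. falling (?c (Suc m) b) (x b))"
    by (rule prod.remove[OF _ mem]) simp
  also have "(\<Prod>b\<in>{..<n} - {\<sigma> m}. falling (?c (Suc m) b) (x b)) = (\<Prod>b\<in>{..<n} - {\<sigma> m}. falling (?c m b) (x b))"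
    using same by (intro prod.cong refl) (metis DiffD2 singletonI)
  also have "falling (?c (Suc m) (\<sigma> m)) (x (\<sigma> m)) * \<dots> =
      (\<Prod>b<n. falling (?c m b) (x b)) * (x (\<sigma> m) - ?c m (\<sigma> m))"
    unfolding step by (subst prod.remove[OF _ mem, of "\<lambda>b. falling (?c m b) (x b)"]) simp_all
  finally show ?case using Suc by simp
qed

lemma poisson_sums: "(\<lambda>n. exp (- a) * a ^ n / fact n) sums (1::real)"
proof -
  have "(\<lambda>n. exp (- a) * (a ^ n /\<^sub>R fact n)) sums (exp (- a) * exp a)"
    by (intro sums_mult exp_converges)
  then show ?thesis by (simp add: exp_minus divide_inverse mult_ac)
qed

text \<open>The p-th factorial moment of a Poisson variable: the terms below p vanish, and in the
  others the falling factorial cancels against the factorial, leaving a shifted Poisson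
  series.\<close>

lemma poisson_falling_sums:
  "(\<lambda>n. real (falling p n) * (exp (- a) * a ^ n / fact n)) sums (a ^ p)"
proof -
  have "falling p n = 0" if "n < p" for n
    unfolding falling_def using that by (auto intro!: bexI[of _ n])
  moreover have "real (falling p (k + p)) * (exp (- a) * a ^ (k + p) / fact (k + p)) = a ^ p * (exp (- a) * a ^ k / fact k)" for k
  proof -
    have "real (falling p (k + p)) * fact k = fact (k + p)"
      using arg_cong[OF falling_times_fact[of p k], of real] by simp
    then have "real (falling p (k + p)) = fact (k + p) / fact k" by (simp add: field_simps)
    then show ?thesis by (simp add: power_add)
  qed
  ultimately show ?thesis
    using sums_mult[OF poisson_sums[of a], of "a ^ p"] by (subst sums_zero_iff_shift[of p, symmetric]) auto
qed

section \<open>Factorial moments and characteristic functional of a Poisson process\<close>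

lemma borel_measurable_nn_integral_countable:
  fixes f :: "'c::countable \<Rightarrow> 'w \<Rightarrow> ennreal"
  assumes "\<And>c. f c \<in> borel_measurable M"
  shows "(\<lambda>w. \<integral>\<^sup>+c. f c w \<partial>count_space UNIV) \<in> borel_measurable M"
proof -
  interpret C: sigma_finite_measure "count_space (UNIV :: 'c set)"
    by (rule sigma_finite_measure_count_space)
  have "(\<lambda>p. f (snd p) (fst p)) \<in> borel_measurable (M \<Otimes>\<^sub>M count_space UNIV)"
    by (rule measurable_compose_countable[where f="\<lambda>c p. f c (fst p)"])
      (auto intro: measurable_compose[OF measurable_fst assms])
  then show ?thesis by (intro C.borel_measurable_nn_integral) (simp add: case_prod_beta')
qed

text \<open>A Poisson process with intensity \<mu>\<kappa>, observed inside a window W that carries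
  all of \<kappa>; thus \<mu> is the mean number of points in W. The sequence Y may have infinitely
  many points outside W, so the assumptions on counts concern subsets of W only.\<close>

locale poisson_on = M: prob_space M + K: prob_space \<kappa>
  for M :: "'w measure" and \<kappa> :: "'b measure" +
  fixes W :: "'b set" and \<mu> :: real and Y :: "nat \<Rightarrow> 'w \<Rightarrow> 'b"
  assumes mu_nonneg: "\<mu> \<ge> 0"
    and W_sets[measurable]: "W \<in> sets \<kappa>"
    and W_full: "emeasure \<kappa> W = 1"
    and Y_meas[measurable]: "\<And>i. Y i \<in> measurable M \<kappa>"
    and count_law: "\<And>A n. A \<in> sets \<kappa> \<Longrightarrow> A \<subseteq> W \<Longrightarrow>
      measure M {w \<in> space M. point_count Y A w = of_nat n} = exp (- (\<mu> * measure \<kappa> A)) * (\<mu> * measure \<kappa> A) ^ n / fact n"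
    and count_indep: "\<And>n A. A ` {..<n::nat} \<subseteq> sets \<kappa> \<Longrightarrow> disjoint_family_on A {..<n} \<Longrightarrow> (\<And>j. j < n \<Longrightarrow> A j \<subseteq> W) \<Longrightarrow>
      M.indep_vars (\<lambda>_. borel) (\<lambda>j. point_count Y (A j)) {..<n}"
begin

definition idx :: "'b set \<Rightarrow> 'w \<Rightarrow> nat set" where
  "idx A w = {i. Y i w \<in> A}"

lemma point_count_idx: "point_count Y A w = (if finite (idx A w) then of_nat (card (idx A w)) else \<infinity>)"
  unfolding point_count_def idx_def by (auto simp: emeasure_count_space)

lemma measurable_point_count[measurable]:
  assumes [measurable]: "A \<in> sets \<kappa>"
  shows "point_count Y A \<in> borel_measurable M"
proof -
  have "point_count Y A w = (\<Sum>i. indicator A (Y i w))" for w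
  proof -
    have "point_count Y A w = (\<integral>\<^sup>+i. indicator {i. Y i w \<in> A} i \<partial>count_space UNIV)"
      unfolding point_count_def by simp
    also have "\<dots> = (\<Sum>i. indicator {i. Y i w \<in> A} i)" by (rule nn_integral_count_space_nat)
    finally show ?thesis by (simp add: indicator_def)
  qed
  moreover have "(\<lambda>w. \<Sum>i. indicator A (Y i w) :: ennreal) \<in> borel_measurable M" by measurable
  ultimately show ?thesis by (subst measurable_cong) auto
qed

text \<open>The Poisson weights sum to 1, so no mass is left for an infinite count.\<close>

lemma AE_finite_idx:
  assumes A[measurable]: "A \<in> sets \<kappa>" and "A \<subseteq> W"
  shows "AE w in M. finite (idx A w)"
proof -
  let ?C = "\<lambda>n::nat. {w \<in> space M. point_count Y A w = of_nat n}"
  have "(\<lambda>n. measure M (?C n)) sums measure M (\<Union>n. ?C n)"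
    by (intro M.finite_measure_UNION) (auto simp: disjoint_family_on_def)
  moreover have "(\<lambda>n. measure M (?C n)) sums 1"
    unfolding count_law[OF assms] by (rule poisson_sums)
  ultimately have "measure M (\<Union>n. ?C n) = 1" by (rule sums_unique2)
  then have "AE w in M. w \<in> (\<Union>n. ?C n)"
    by (intro M.AE_prob_1) simp
  then show ?thesis
    by eventually_elim (auto simp: point_count_idx split: if_splits)
qed

lemma nn_integral_falling_count:
  assumes A[measurable]: "A \<in> sets \<kappa>" and "A \<subseteq> W"
  shows "(\<integral>\<^sup>+w. of_nat (falling p (card (idx A w))) \<partial>M) = ennreal ((\<mu> * measure \<kappa> A) ^ p)"
proof -
  let ?a = "\<mu> * measure \<kappa> A"
  let ?C = "\<lambda>n::nat. {w \<in> space M. point_count Y A w = of_nat n}"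
  have "AE w in M. of_nat (falling p (card (idx A w))) = (\<Sum>n. of_nat (falling p n) * indicator (?C n) w :: ennreal)"
    using AE_finite_idx[OF assms] AE_space
  proof eventually_elim
    case (elim w)
    then have "(\<lambda>n. of_nat (falling p n) * indicator (?C n) w :: ennreal) =
        (\<lambda>n. if n = card (idx A w) then of_nat (falling p n) else 0)"
      by (auto simp: point_count_idx fun_eq_iff)
    then show ?case using sums_unique[OF sums_single[of "card (idx A w)" "\<lambda>n. of_nat (falling p n) :: ennreal"]] by simp
  qed
  then have "(\<integral>\<^sup>+w. of_nat (falling p (card (idx A w))) \<partial>M) =
      (\<integral>\<^sup>+w. (\<Sum>n. of_nat (falling p n) * indicator (?C n) w) \<partial>M)"
    by (rule nn_integral_cong_AE)
  also have "\<dots> = (\<Sum>n. of_nat (falling p n) * emeasure M (?C n))"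
    by (subst nn_integral_suminf) (auto simp: nn_integral_cmult_indicator)
  also have "\<dots> = (\<Sum>n. ennreal (real (falling p n) * (exp (- ?a) * ?a ^ n / fact n)))"
    unfolding M.emeasure_eq_measure count_law[OF assms]
    by (simp add: ennreal_of_nat_eq_real_of_nat flip: ennreal_mult')
  also have "\<dots> = ennreal (?a ^ p)"
    using mu_nonneg by (intro suminf_ennreal_eq poisson_falling_sums) auto
  finally show ?thesis .
qed

text \<open>For disjoint sets the number of lists is a product of falling factorials of the counts;
  the counts are independent and Poisson, so the expectation is a product of factorial
  moments.\<close>

lemma nn_integral_blocks:
  fixes m n :: nat
  assumes B: "\<And>b. b < n \<Longrightarrow> B b \<in> sets \<kappa>" "\<And>b. b < n \<Longrightarrow> B b \<subseteq> W" "disjoint_family_on B {..<n}"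
    and \<sigma>: "\<And>j. j < m \<Longrightarrow> \<sigma> j < n"
  shows "(\<integral>\<^sup>+w. of_nat (card {js. length js = m \<and> distinct js \<and> (\<forall>j<m. Y (js ! j) w \<in> B (\<sigma> j))}) \<partial>M) =
    (\<Prod>j<m. ennreal (\<mu> * measure \<kappa> (B (\<sigma> j))))"
proof -
  let ?c = "\<lambda>b. card {j. j < m \<and> \<sigma> j = b}"
  have "AE w in M. \<forall>b\<in>{..<n}. finite (idx (B b) w)"
    using AE_finite_idx B by (subst AE_ball_countable) auto
  then have "AE w in M. of_nat (card {js. length js = m \<and> distinct js \<and> (\<forall>j<m. Y (js ! j) w \<in> B (\<sigma> j))}) =
      (\<Prod>b<n. of_nat (falling (?c b) (card (idx (B b) w))) :: ennreal)"
  proof eventually_elim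
    case (elim w)
    let ?E = "\<lambda>b. if b < n then idx (B b) w else {}"
    have "{js. length js = m \<and> distinct js \<and> (\<forall>j<m. Y (js ! j) w \<in> B (\<sigma> j))} =
        {js. length js = m \<and> distinct js \<and> (\<forall>j<m. js ! j \<in> ?E (\<sigma> j))}"
      using \<sigma> by (auto simp: idx_def)
    moreover have "card {js. length js = m \<and> distinct js \<and> (\<forall>j<m. js ! j \<in> ?E (\<sigma> j))} =
        (\<Prod>j<m. card (?E (\<sigma> j)) - card {i. i < j \<and> \<sigma> i = \<sigma> j})"
      by (rule card_dlists_in_blocks)
        (use elim B(3) in \<open>auto simp: idx_def disjoint_family_on_def\<close>)
    moreover have "\<dots> = (\<Prod>b<n. falling (?c b) (card (?E b)))"
      by (rule prod_blocks_falling[OF \<sigma>])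
    moreover have "\<dots> = (\<Prod>b<n. falling (?c b) (card (idx (B b) w)))" by (intro prod.cong) auto
    ultimately show ?case by (simp flip: of_nat_prod)
  qed
  then have "(\<integral>\<^sup>+w. of_nat (card {js. length js = m \<and> distinct js \<and> (\<forall>j<m. Y (js ! j) w \<in> B (\<sigma> j))}) \<partial>M) =
      (\<integral>\<^sup>+w. (\<Prod>b<n. of_nat (falling (?c b) (card (idx (B b) w)))) \<partial>M)"
    by (rule nn_integral_cong_AE)
  \<comment> \<open>Independence is available for \<open>point_count\<close>, so the cardinality is
    written as a measurable function of it; for an infinite set both expressions are 0.\<close>
  also have "\<dots> = (\<integral>\<^sup>+w. (\<Prod>b<n. of_nat (falling (?c b) (nat \<lfloor>enn2real (point_count Y (B b) w)\<rfloor>))) \<partial>M)"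
    by (intro nn_integral_cong prod.cong refl) (auto simp: point_count_idx)
  also have "\<dots> = (\<Prod>b<n. \<integral>\<^sup>+w. of_nat (falling (?c b) (nat \<lfloor>enn2real (point_count Y (B b) w)\<rfloor>)) \<partial>M)"
    by (intro M.indep_vars_nn_integral M.indep_vars_compose2[where M'="\<lambda>_. borel" and X="\<lambda>b. point_count Y (B b)"
          and Y="\<lambda>b x. of_nat (falling (?c b) (nat \<lfloor>enn2real x\<rfloor>))"] count_indep)
      (use B in \<open>auto simp: subset_eq\<close>)
  also have "\<dots> = (\<Prod>b<n. \<integral>\<^sup>+w. of_nat (falling (?c b) (card (idx (B b) w))) \<partial>M)"
    by (intro nn_integral_cong prod.cong refl) (auto simp: point_count_idx)
  also have "\<dots> = (\<Prod>b<n. ennreal (\<mu> * measure \<kappa> (B b)) ^ ?c b)"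
    using B mu_nonneg by (intro prod.cong refl) (auto simp: nn_integral_falling_count ennreal_power)
  also have "\<dots> = (\<Prod>b<n. \<Prod>j\<in>{j \<in> {..<m}. \<sigma> j = b}. ennreal (\<mu> * measure \<kappa> (B (\<sigma> j))))"
    by simp
  also have "\<dots> = (\<Prod>j<m. ennreal (\<mu> * measure \<kappa> (B (\<sigma> j))))"
    by (rule prod.group) (use \<sigma> in auto)
  finally show ?thesis .
qed


lemma finite_dlists_idx:
  assumes "finite (idx W w)" "\<And>j. j < m \<Longrightarrow> A j \<subseteq> W"
  shows "finite {js. length js = m \<and> distinct js \<and> (\<forall>j<m. Y (js ! j) w \<in> A j)}"
  by (rule finite_subset[OF _ finite_dlists[OF assms(1), of m]])
    (use assms(2) in \<open>fastforce simp: dlists_def idx_def in_set_conv_nth\<close>)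

lemma borel_measurable_card_lists:
  assumes "\<And>j. j < m \<Longrightarrow> A j \<in> sets \<kappa>"
  shows "(\<lambda>w. of_nat (card {js. length js = m \<and> distinct js \<and> (\<forall>j<m. Y (js ! j) w \<in> A j)}) :: ennreal) \<in> borel_measurable M"
proof -
  let ?L = "\<lambda>w. {js. length js = m \<and> distinct js \<and> (\<forall>j<m. Y (js ! j) w \<in> A j)}"
  define A' where "A' = (\<lambda>j. if j < m then A j else {})"
  have [measurable]: "A' j \<in> sets \<kappa>" for j using assms by (auto simp: A'_def)
  have "(\<lambda>w. indicator (?L w) js :: ennreal) \<in> borel_measurable M" for js
  proof -
    have "(\<lambda>w. if length js = m \<and> distinct js \<and> (\<forall>j\<in>{..<m}. Y (js ! j) w \<in> A' j) then 1 else 0 :: ennreal) \<in> borel_measurable M"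
      by measurable
    also have "(\<lambda>w. if length js = m \<and> distinct js \<and> (\<forall>j\<in>{..<m}. Y (js ! j) w \<in> A' j) then 1 else 0 :: ennreal) =
        (\<lambda>w. indicator (?L w) js)"
    proof
      fix w
      have "js \<in> ?L w \<longleftrightarrow> length js = m \<and> distinct js \<and> (\<forall>j\<in>{..<m}. Y (js ! j) w \<in> A' j)"
        by (auto simp: A'_def)
      then show "(if length js = m \<and> distinct js \<and> (\<forall>j\<in>{..<m}. Y (js ! j) w \<in> A' j) then 1 else 0 :: ennreal) =
          indicator (?L w) js" by (simp only: indicator_def of_bool_def)
    qed
    finally show ?thesis .
  qed
  then have "(\<lambda>w. \<integral>\<^sup>+js. indicator (?L w) js \<partial>count_space UNIV) \<in> borel_measurable M"
    by (rule borel_measurable_nn_integral_countable)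
  then have [measurable]: "(\<lambda>w. emeasure (count_space UNIV) (?L w)) \<in> borel_measurable M"
    by (simp only: nn_integral_indicator sets_count_space Pow_UNIV UNIV_I)
  have **: "(\<lambda>w. of_nat (nat \<lfloor>enn2real (emeasure (count_space UNIV) (?L w))\<rfloor>) :: ennreal) \<in> borel_measurable M"
    by measurable
  have *: "nat \<lfloor>enn2real (emeasure (count_space UNIV) S)\<rfloor> = card S" for S :: "nat list set"
    by (cases "finite S") (auto simp: emeasure_count_space)
  show ?thesis using ** unfolding * .
qed

text \<open>The sets \<open>A j\<close> may overlap. Cutting the window into the atoms generated by
  them splits the lists according to the atom of each position; \<open>nn_integral_blocks\<close>
  handles each pattern, and distributivity reassembles the product.\<close>

lemma nn_integral_rectangle:
  fixes m :: nat
  assumes A: "\<And>j. j < m \<Longrightarrow> A j \<in> sets \<kappa>" "\<And>j. j < m \<Longrightarrow> A j \<subseteq> W"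
  shows "(\<integral>\<^sup>+w. of_nat (card {js. length js = m \<and> distinct js \<and> (\<forall>j<m. Y (js ! j) w \<in> A j)}) \<partial>M) =
    (\<Prod>j<m. ennreal (\<mu> * measure \<kappa> (A j)))"
proof -
  define N where "N = card (Pow {..<m})"
  obtain e where e: "bij_betw e {0..<N} (Pow {..<m})"
    using ex_bij_betw_nat_finite[of "Pow {..<m}"] unfolding N_def by auto
  \<comment> \<open>\<open>B b\<close> is the atom of the window points that lie in exactly the sets
    \<open>A j\<close> with \<open>j \<in> e b\<close>, where e enumerates all sets of
    positions.\<close>
  define B where "B = (\<lambda>b. {x \<in> W. \<forall>j<m. x \<in> A j \<longleftrightarrow> j \<in> e b})"
  have B_sets: "B b \<in> sets \<kappa>" for b
  proof -
    define A' where "A' = (\<lambda>j. if j < m then A j else {})"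
    have [measurable]: "A' j \<in> sets \<kappa>" for j using A(1) by (auto simp: A'_def)
    have "B b = {x \<in> space \<kappa>. x \<in> W \<and> (\<forall>j\<in>{..<m}. x \<in> A' j \<longleftrightarrow> j \<in> e b)}"
      using sets.sets_into_space[OF W_sets] by (auto simp: B_def A'_def)
    also have "\<dots> \<in> sets \<kappa>" by measurable
    finally show ?thesis .
  qed
  have B_W: "B b \<subseteq> W" for b by (auto simp: B_def)
  have e_inj: "b = b'" if "b < N" "b' < N" "e b = e b'" for b b'
    using e that by (auto simp: bij_betw_def inj_on_def)
  have B_inj: "b = b'" if "b < N" "b' < N" "x \<in> B b" "x \<in> B b'" for b b' x
  proof (rule e_inj[OF that(1,2)])
    have "e b \<subseteq> {..<m}" "e b' \<subseteq> {..<m}"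
      using bij_betwE[OF e] that(1,2) by auto
    then show "e b = e b'" using that(3,4) by (auto simp: B_def)
  qed
  have B_disj: "disjoint_family_on B {..<N}"
    unfolding disjoint_family_on_def using B_inj by blast
  have cover: "\<exists>b<N. x \<in> B b \<and> j \<in> e b" if "j < m" "x \<in> A j" for j x
  proof -
    have "{i. i < m \<and> x \<in> A i} \<in> Pow {..<m}" by auto
    then obtain b where "b < N" "e b = {i. i < m \<and> x \<in> A i}"
      using e unfolding bij_betw_def by (metis (no_types, lifting) atLeastLessThan_iff imageE)
    then show ?thesis using that A(2) by (auto simp: B_def intro!: exI[of _ b])
  qed
  \<comment> \<open>The patterns: each position j chooses an atom inside \<open>A j\<close>. Every
    admissible list follows exactly one pattern.\<close>
  define Sg where "Sg = PiE {..<m} (\<lambda>j. {b. b < N \<and> j \<in> e b})"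
  have Sg_fin: "finite Sg" unfolding Sg_def by (intro finite_PiE) auto
  have Sg_lt: "\<sigma> j < N" if "\<sigma> \<in> Sg" "j < m" for \<sigma> j using that by (auto simp: Sg_def PiE_def Pi_def)
  let ?L = "\<lambda>w A. {js. length js = m \<and> distinct js \<and> (\<forall>j<m. Y (js ! j) w \<in> A j)}"
  have "AE w in M. of_nat (card (?L w A)) = (\<Sum>\<sigma>\<in>Sg. of_nat (card (?L w (\<lambda>j. B (\<sigma> j)))) :: ennreal)"
    using AE_finite_idx[OF W_sets subset_refl]
  proof eventually_elim
    case (elim w)
    have "?L w A = (\<Union>\<sigma>\<in>Sg. ?L w (\<lambda>j. B (\<sigma> j)))"
    proof (intro equalityI subsetI)
      fix js assume js: "js \<in> ?L w A"
      define \<sigma> where "\<sigma> = (\<lambda>j\<in>{..<m}. SOME b. b < N \<and> Y (js ! j) w \<in> B b \<and> j \<in> e b)"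
      have \<sigma>: "\<sigma> j < N \<and> Y (js ! j) w \<in> B (\<sigma> j) \<and> j \<in> e (\<sigma> j)" if "j < m" for j
      proof -
        have "\<exists>b. b < N \<and> Y (js ! j) w \<in> B b \<and> j \<in> e b" using cover[OF that] js that by auto
        from someI_ex[OF this] show ?thesis using that by (simp add: \<sigma>_def)
      qed
      have "\<sigma> \<in> Sg" using \<sigma> unfolding Sg_def by (auto simp: \<sigma>_def)
      then show "js \<in> (\<Union>\<sigma>\<in>Sg. ?L w (\<lambda>j. B (\<sigma> j)))" using \<sigma> js by auto
    next
      fix js assume "js \<in> (\<Union>\<sigma>\<in>Sg. ?L w (\<lambda>j. B (\<sigma> j)))"
      then obtain \<sigma> where \<sigma>: "\<sigma> \<in> Sg" "js \<in> ?L w (\<lambda>j. B (\<sigma> j))" by auto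
      have "Y (js ! j) w \<in> A j" if "j < m" for j
      proof -
        have "j \<in> e (\<sigma> j)" using \<sigma>(1) that by (auto simp: Sg_def PiE_def Pi_def)
        then show ?thesis using \<sigma>(2) that by (auto simp: B_def)
      qed
      then show "js \<in> ?L w A" using \<sigma> by auto
    qed
    moreover have "card (\<Union>\<sigma>\<in>Sg. ?L w (\<lambda>j. B (\<sigma> j))) = (\<Sum>\<sigma>\<in>Sg. card (?L w (\<lambda>j. B (\<sigma> j))))"
    proof (rule card_UN_disjoint[OF Sg_fin])
      show "\<forall>\<sigma>\<in>Sg. finite (?L w (\<lambda>j. B (\<sigma> j)))"
        using finite_dlists_idx[OF elim] B_W by simp
      have "\<sigma> = \<sigma>'" if "\<sigma> \<in> Sg" "\<sigma>' \<in> Sg" "js \<in> ?L w (\<lambda>j. B (\<sigma> j))" "js \<in> ?L w (\<lambda>j. B (\<sigma>' j))" for \<sigma> \<sigma>' js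
      proof (rule PiE_ext[of \<sigma> "{..<m}" _ \<sigma>'])
        show "\<sigma> \<in> Pi\<^sub>E {..<m} (\<lambda>j. {b. b < N \<and> j \<in> e b})" "\<sigma>' \<in> Pi\<^sub>E {..<m} (\<lambda>j. {b. b < N \<and> j \<in> e b})"
          using that by (auto simp: Sg_def)
        show "\<sigma> j = \<sigma>' j" if "j \<in> {..<m}" for j
          using that \<open>js \<in> ?L w (\<lambda>j. B (\<sigma> j))\<close> \<open>js \<in> ?L w (\<lambda>j. B (\<sigma>' j))\<close> \<open>\<sigma> \<in> Sg\<close> \<open>\<sigma>' \<in> Sg\<close> Sg_lt
          by (intro B_inj[of "\<sigma> j" "\<sigma>' j" "Y (js ! j) w"]) auto
      qed
      then show "\<forall>\<sigma>\<in>Sg. \<forall>\<sigma>'\<in>Sg. \<sigma> \<noteq> \<sigma>' \<longrightarrow> ?L w (\<lambda>j. B (\<sigma> j)) \<inter> ?L w (\<lambda>j. B (\<sigma>' j)) = {}"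
        by blast
    qed
    ultimately show ?case by simp
  qed
  then have "(\<integral>\<^sup>+w. of_nat (card (?L w A)) \<partial>M) = (\<integral>\<^sup>+w. (\<Sum>\<sigma>\<in>Sg. of_nat (card (?L w (\<lambda>j. B (\<sigma> j))))) \<partial>M)"
    by (rule nn_integral_cong_AE)
  also have "\<dots> = (\<Sum>\<sigma>\<in>Sg. \<integral>\<^sup>+w. of_nat (card (?L w (\<lambda>j. B (\<sigma> j)))) \<partial>M)"
    using B_sets by (intro nn_integral_sum borel_measurable_card_lists) auto
  also have "\<dots> = (\<Sum>\<sigma>\<in>Sg. \<Prod>j<m. ennreal (\<mu> * measure \<kappa> (B (\<sigma> j))))"
    using B_sets B_W B_disj Sg_lt by (intro sum.cong refl nn_integral_blocks[of N]) auto
  also have "\<dots> = (\<Prod>j<m. \<Sum>b\<in>{b. b < N \<and> j \<in> e b}. ennreal (\<mu> * measure \<kappa> (B b)))"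
    unfolding Sg_def by (rule prod_sum_PiE[symmetric]) auto
  also have "\<dots> = (\<Prod>j<m. ennreal (\<mu> * measure \<kappa> (A j)))"
  proof (intro prod.cong refl)
    fix j assume j: "j \<in> {..<m}"
    have "A j = (\<Union>b\<in>{b. b < N \<and> j \<in> e b}. B b)"
      using cover[of j] j by (auto simp: B_def)
    moreover have "measure \<kappa> (\<Union>b\<in>{b. b < N \<and> j \<in> e b}. B b) = (\<Sum>b\<in>{b. b < N \<and> j \<in> e b}. measure \<kappa> (B b))"
      using B_sets B_disj by (intro K.finite_measure_finite_Union) (auto simp: disjoint_family_on_def)
    ultimately show "(\<Sum>b\<in>{b. b < N \<and> j \<in> e b}. ennreal (\<mu> * measure \<kappa> (B b))) = ennreal (\<mu> * measure \<kappa> (A j))"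
      using mu_nonneg by (simp add: sum_distrib_left sum_ennreal)
  qed
  finally show ?thesis .
qed


lemma measurable_idx_subset[measurable]:
  "Measurable.pred M (\<lambda>w. js \<in> dlists m (idx W w))"
proof -
  have "(\<lambda>w. js \<in> dlists m (idx W w)) = (\<lambda>w. length js = m \<and> distinct js \<and> (\<forall>i\<in>set js. Y i w \<in> W))"
    by (auto simp: dlists_def idx_def fun_eq_iff)
  then show ?thesis by simp
qed

lemma measurable_points:
  "(\<lambda>w. \<lambda>j\<in>{..<m}. Y (js ! j) w) \<in> measurable M (PiM {..<m} (\<lambda>_. \<kappa>))"
  by measurable

text \<open>Lists carry the counting measure, so that sums over lists are integrals and Fubini
  applies. The weight keeps the lists of m distinct indices with all points in the window.\<close>

abbreviation weight :: "nat \<Rightarrow> nat list \<times> 'w \<Rightarrow> real" where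
  "weight m \<equiv> \<lambda>(js, w). indicator (dlists m (idx W w)) js"

abbreviation points :: "nat \<Rightarrow> nat list \<times> 'w \<Rightarrow> nat \<Rightarrow> 'b" where
  "points m \<equiv> \<lambda>(js, w). \<lambda>j\<in>{..<m}. Y (js ! j) w"

lemma measurable_weight[measurable]: "weight m \<in> borel_measurable (count_space UNIV \<Otimes>\<^sub>M M)"
proof (rule measurable_pair_measure_countable1)
  fix js
  have "(\<lambda>w. indicator (dlists m (idx W w)) js :: real) = (\<lambda>w. if js \<in> dlists m (idx W w) then 1 else 0)"
    by (auto simp: indicator_def)
  then show "(\<lambda>w. weight m (js, w)) \<in> borel_measurable M" by simp
qed auto

lemma measurable_points_pair[measurable]:
  "points m \<in> measurable (count_space UNIV \<Otimes>\<^sub>M M) (PiM {..<m} (\<lambda>_. \<kappa>))"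
  by (rule measurable_pair_measure_countable1) (auto intro: measurable_points)

text \<open>The m-th factorial moment measure of a Poisson process is the m-fold product of its
  intensity measure. Both sides are finite and agree on rectangles by
  \<open>nn_integral_rectangle\<close>, because \<kappa> lives on W.\<close>

theorem factorial_moment_measure:
  "distr (density (count_space UNIV \<Otimes>\<^sub>M M) (weight m)) (PiM {..<m} (\<lambda>_. \<kappa>)) (points m) =
    density (PiM {..<m} (\<lambda>_. \<kappa>)) (\<lambda>_. ennreal (\<mu> ^ m))" (is "?\<nu> = ?\<pi>")
proof (rule measure_eqI_PiM_finite[where I="{..<m}" and M="\<lambda>_. \<kappa>" and A="\<lambda>_. PiE {..<m} (\<lambda>_. space \<kappa>)"])
  interpret P: product_sigma_finite "\<lambda>_. \<kappa>" by standard
  interpret fP: prob_space "PiM {..<m} (\<lambda>_. \<kappa>)" by (intro prob_space_PiM K.prob_space_axioms)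
  interpret C: sigma_finite_measure "count_space (UNIV :: nat list set)"
    by (rule sigma_finite_measure_count_space)
  interpret Q: pair_sigma_finite "count_space (UNIV :: nat list set)" M ..
  show eq: "emeasure ?\<nu> (Pi\<^sub>E {..<m} A) = emeasure ?\<pi> (Pi\<^sub>E {..<m} A)" if A: "\<And>i. i \<in> {..<m} \<Longrightarrow> A i \<in> sets \<kappa>" for A
  proof -
    have R[measurable]: "Pi\<^sub>E {..<m} A \<in> sets (PiM {..<m} (\<lambda>_. \<kappa>))"
      using A by (intro sets_PiM_I_finite) auto
    let ?L = "\<lambda>w. {js. length js = m \<and> distinct js \<and> (\<forall>j<m. Y (js ! j) w \<in> A j \<inter> W)}"
    have "emeasure ?\<nu> (Pi\<^sub>E {..<m} A) =
        (\<integral>\<^sup>+q. ennreal (weight m q) * indicator (points m -` Pi\<^sub>E {..<m} A \<inter> space (count_space UNIV \<Otimes>\<^sub>M M)) q \<partial>(count_space UNIV \<Otimes>\<^sub>M M))"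
      by (subst emeasure_distr) (auto simp: emeasure_density)
    also have "\<dots> = (\<integral>\<^sup>+q. ennreal (weight m q) * indicator (Pi\<^sub>E {..<m} A) (points m q) \<partial>(count_space UNIV \<Otimes>\<^sub>M M))"
      by (intro nn_integral_cong) (auto simp: indicator_def)
    also have "\<dots> = (\<integral>\<^sup>+w. \<integral>\<^sup>+js. ennreal (weight m (js, w)) * indicator (Pi\<^sub>E {..<m} A) (points m (js, w)) \<partial>count_space UNIV \<partial>M)"
      by (rule Q.nn_integral_snd[symmetric]) measurable
    also have "\<dots> = (\<integral>\<^sup>+w. \<integral>\<^sup>+js. indicator (?L w) js \<partial>count_space UNIV \<partial>M)"
    proof (intro nn_integral_cong)
      fix w and js :: "nat list"
      have "(js \<in> dlists m (idx W w) \<and> points m (js, w) \<in> Pi\<^sub>E {..<m} A) \<longleftrightarrow> js \<in> ?L w"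
        by (auto simp: dlists_def idx_def set_conv_nth PiE_def Pi_def)
      then show "ennreal (weight m (js, w)) * indicator (Pi\<^sub>E {..<m} A) (points m (js, w)) = indicator (?L w) js"
        by (auto simp: indicator_def)
    qed
    also have "\<dots> = (\<integral>\<^sup>+w. of_nat (card (?L w)) \<partial>M)"
    proof (rule nn_integral_cong_AE)
      show "AE w in M. (\<integral>\<^sup>+js. indicator (?L w) js \<partial>count_space UNIV) = of_nat (card (?L w))"
        using AE_finite_idx[OF W_sets subset_refl]
      proof eventually_elim
        case (elim w)
        have "finite (?L w)" by (rule finite_dlists_idx[OF elim]) auto
        then show ?case by (simp add: emeasure_count_space)
      qed
    qed
    also have "\<dots> = (\<Prod>j<m. ennreal (\<mu> * measure \<kappa> (A j \<inter> W)))"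
      using A by (intro nn_integral_rectangle) auto
    also have "\<dots> = (\<Prod>j<m. ennreal \<mu> * emeasure \<kappa> (A j))"
    proof (intro prod.cong refl)
      fix j assume "j \<in> {..<m}"
      then have [measurable]: "A j \<in> sets \<kappa>" using A by auto
      have "AE x in \<kappa>. x \<in> W" using W_full by (intro K.AE_prob_1) (simp add: measure_def)
      then have "emeasure \<kappa> (A j \<inter> W) = emeasure \<kappa> (A j)" by (intro emeasure_eq_AE) auto
      then show "ennreal (\<mu> * measure \<kappa> (A j \<inter> W)) = ennreal \<mu> * emeasure \<kappa> (A j)"
        using mu_nonneg by (simp add: ennreal_mult K.emeasure_eq_measure)
    qed
    also have "\<dots> = emeasure ?\<pi> (Pi\<^sub>E {..<m} A)"
    proof -
      have "emeasure (PiM {..<m} (\<lambda>_. \<kappa>)) (Pi\<^sub>E {..<m} A) = (\<Prod>j<m. emeasure \<kappa> (A j))"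
        by (rule P.emeasure_PiM) (use A in auto)
      then show ?thesis
        using mu_nonneg by (subst emeasure_density_const[OF R]) (simp add: prod.distrib ennreal_power)
    qed
    finally show ?thesis .
  qed
  show "emeasure ?\<nu> (Pi\<^sub>E {..<m} (\<lambda>_. space \<kappa>)) \<noteq> \<infinity>"
    by (subst eq) (auto simp: emeasure_density_const P.emeasure_PiM sets_PiM_I_finite K.emeasure_space_1 ennreal_mult_eq_top_iff)
  show "range (\<lambda>_. Pi\<^sub>E {..<m} (\<lambda>_. space \<kappa>)) \<subseteq> prod_algebra {..<m} (\<lambda>_. \<kappa>)"
    by (auto intro!: prod_algebraI_finite)
qed (auto simp: space_PiM)

lemma measurable_finite_idx[measurable]: "Measurable.pred M (\<lambda>w. finite (idx W w))"
proof -
  have "Measurable.pred M (\<lambda>w. point_count Y W w \<noteq> \<infinity>)" by measurable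
  moreover have "(\<lambda>w. point_count Y W w \<noteq> \<infinity>) = (\<lambda>w. finite (idx W w))"
    by (auto simp: point_count_idx fun_eq_iff)
  ultimately show ?thesis by (simp only:)
qed

text \<open>A U-statistic over ordered lists, hence without the factor \<open>1 / fact m\<close>;
  the value 0 is taken on the null event of infinitely many points in the window.\<close>

definition usum :: "nat \<Rightarrow> ('b list \<Rightarrow> 'c) \<Rightarrow> 'w \<Rightarrow> 'c::real_normed_vector" where
  "usum m h w = (if finite (idx W w) then \<Sum>js\<in>dlists m (idx W w). h (map (\<lambda>i. Y i w) js) else 0)"

text \<open>The multivariate Campbell formula: integrate h against the factorial moment measure and
  use Fubini to bring the sum over lists inside the expectation. Boundedness of h and finiteness of
  the measure provide integrability.\<close>

theorem campbell:
  fixes h :: "'b list \<Rightarrow> 'c::{banach, second_countable_topology}"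
  assumes h[measurable]: "(\<lambda>z. h (map z [0..<m])) \<in> borel_measurable (PiM {..<m} (\<lambda>_. \<kappa>))"
    and C: "\<And>xs. length xs = m \<Longrightarrow> norm (h xs) \<le> C"
  shows usum_measurable: "usum m h \<in> borel_measurable M"
    and usum_integrable: "integrable M (usum m h)"
    and usum_integral: "(\<integral>w. usum m h w \<partial>M) = \<mu> ^ m *\<^sub>R (\<integral>z. h (map z [0..<m]) \<partial>PiM {..<m} (\<lambda>_. \<kappa>))"
proof -
  interpret P: product_sigma_finite "\<lambda>_. \<kappa>" by standard
  interpret fP: prob_space "PiM {..<m} (\<lambda>_. \<kappa>)" by (intro prob_space_PiM K.prob_space_axioms)
  interpret C: sigma_finite_measure "count_space (UNIV :: nat list set)"
    by (rule sigma_finite_measure_count_space)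
  interpret Q: pair_sigma_finite "count_space (UNIV :: nat list set)" M ..
  let ?Q = "count_space (UNIV :: nat list set) \<Otimes>\<^sub>M M" and ?P = "PiM {..<m} (\<lambda>_. \<kappa>)"
  define F where "F = (\<lambda>z. h (map z [0..<m]))"
  have F[measurable]: "F \<in> borel_measurable ?P" using h by (simp add: F_def)
  define f where "f = (\<lambda>js w. weight m (js, w) *\<^sub>R F (points m (js, w)))"
  have f[measurable]: "case_prod f \<in> borel_measurable ?Q"
  proof -
    have "(\<lambda>q. weight m q *\<^sub>R F (points m q)) \<in> borel_measurable ?Q" by measurable
    then show ?thesis by (simp add: f_def case_prod_beta')
  qed
  have "integrable ?P F"
    using C by (intro fP.integrable_const_bound[where B = C]) (auto simp: F_def)
  then have "integrable (density ?P (\<lambda>_. ennreal (\<mu> ^ m))) F"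
    using mu_nonneg by (subst integrable_density) auto
  then have "integrable (density ?Q (weight m)) (\<lambda>q. F (points m q))"
    unfolding factorial_moment_measure[symmetric] by (subst (asm) integrable_distr_eq) auto
  then have int: "integrable ?Q (case_prod f)"
    by (subst (asm) integrable_density) (auto simp: f_def case_prod_beta')
  have "(\<integral>q. case_prod f q \<partial>?Q) = (\<integral>q. F (points m q) \<partial>density ?Q (weight m))"
    by (subst integral_density) (auto simp: f_def case_prod_beta' intro!: Bochner_Integration.integral_cong)
  also have "\<dots> = (\<integral>z. F z \<partial>distr (density ?Q (weight m)) ?P (points m))"
    by (subst integral_distr) auto
  also have "\<dots> = \<mu> ^ m *\<^sub>R (\<integral>z. F z \<partial>?P)"
    unfolding factorial_moment_measure using mu_nonneg by (subst integral_density) auto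
  finally have val: "(\<integral>q. case_prod f q \<partial>?Q) = \<mu> ^ m *\<^sub>R (\<integral>z. F z \<partial>?P)" .
  \<comment> \<open>For a fixed outcome with finitely many window points, the integral over the
    counting measure on lists is the finite sum in \<open>usum\<close>.\<close>
  have inner: "(\<integral>js. f js w \<partial>count_space UNIV) = usum m h w" if fin: "finite (idx W w)" for w
  proof -
    have "f js w = (if js \<in> dlists m (idx W w) then h (map (\<lambda>i. Y i w) js) else 0)" for js
    proof (cases "js \<in> dlists m (idx W w)")
      case True
      then have len: "length js = m" by (simp add: dlists_def)
      have "map (\<lambda>j\<in>{..<m}. Y (js ! j) w) [0..<m] = map (\<lambda>i. Y i w) js"
        using len by (intro nth_equalityI) auto
      with True show ?thesis by (simp add: f_def F_def)
    qed (simp add: f_def)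
    then have "(\<integral>js. f js w \<partial>count_space UNIV) = (\<Sum>js\<in>dlists m (idx W w). h (map (\<lambda>i. Y i w) js))"
      using finite_dlists[OF fin, of m]
      by (subst lebesgue_integral_count_space_finite_support)
        (auto intro!: sum.mono_neutral_cong_left finite_subset[OF _ finite_dlists[OF fin, of m]])
    then show ?thesis using fin by (simp add: usum_def)
  qed
  have fs: "(\<lambda>(w, js). f js w) \<in> borel_measurable (M \<Otimes>\<^sub>M count_space UNIV)"
    using measurable_pair_swap[OF f] by (simp add: case_prod_beta')
  have [measurable]: "(\<lambda>w. \<integral>js. f js w \<partial>count_space UNIV) \<in> borel_measurable M"
    by (rule C.borel_measurable_lebesgue_integral[OF fs])
  have "usum m h = (\<lambda>w. if finite (idx W w) then \<integral>js. f js w \<partial>count_space UNIV else 0)"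
    using inner by (auto simp: usum_def fun_eq_iff)
  moreover have "(\<lambda>w. if finite (idx W w) then \<integral>js. f js w \<partial>count_space UNIV else 0) \<in> borel_measurable M"
    by measurable
  ultimately show meas[measurable]: "usum m h \<in> borel_measurable M" by simp
  have ae: "AE w in M. (\<integral>js. f js w \<partial>count_space UNIV) = usum m h w"
    using AE_finite_idx[OF W_sets subset_refl] by eventually_elim (rule inner)
  have "integrable M (\<lambda>w. \<integral>js. f js w \<partial>count_space UNIV)"
    using Q.integrable_snd[OF int] by simp
  then show "integrable M (usum m h)"
    by (rule integrable_cong_AE_imp) (use ae in \<open>auto simp: eq_commute\<close>)
  have "(\<integral>w. usum m h w \<partial>M) = (\<integral>w. (\<integral>js. f js w \<partial>count_space UNIV) \<partial>M)"
    using ae by (intro integral_cong_AE) auto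
  also have "\<dots> = (\<integral>q. case_prod f q \<partial>?Q)" by (rule Q.integral_snd[OF int])
  finally show "(\<integral>w. usum m h w \<partial>M) = \<mu> ^ m *\<^sub>R (\<integral>z. h (map z [0..<m]) \<partial>?P)"
    using val by (simp add: F_def)
qed


lemma usum_one: "finite (idx W w) \<Longrightarrow> usum 1 h w = (\<Sum>i\<in>idx W w. h [Y i w])"
proof -
  have "dlists 1 S = (\<lambda>i. [i]) ` S" for S :: "nat set"
    by (auto simp: dlists_def length_Suc_conv)
  moreover assume "finite (idx W w)"
  ultimately show ?thesis
    by (simp add: usum_def sum.reindex inj_on_def)
qed

text \<open>Expanding the product over subsets of the points gives the U-statistics of the kernels
  u(x_1) ... u(x_m), divided by m!. Their expectations are the m-th powers of \<mu> times the
  integral of u, and the exponential series appears.\<close>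

lemma expectation_prod:
  fixes u :: "'b \<Rightarrow> complex"
  assumes u[measurable]: "u \<in> borel_measurable \<kappa>" and C: "\<And>x. norm (u x) \<le> C"
  shows "(\<integral>w. (\<Prod>i\<in>idx W w. 1 + u (Y i w)) \<partial>M) = exp (\<mu> * (\<integral>x. u x \<partial>\<kappa>))"
proof -
  interpret P: product_sigma_finite "\<lambda>_. \<kappa>" by standard
  define h where "h = (\<lambda>xs. prod_list (map u xs))"
  have C0: "C \<ge> 0" using C[of undefined] norm_ge_zero order_trans by blast
  have h_eq: "h (map z [0..<m]) = (\<Prod>i<m. u (z i))" for z m
    using prod.distinct_set_conv_list[of "[0..<m]" "\<lambda>i. u (z i)"]
    by (simp add: h_def comp_def atLeast0LessThan)
  have h_meas: "(\<lambda>z. h (map z [0..<m])) \<in> borel_measurable (PiM {..<m} (\<lambda>_. \<kappa>))" for m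
    unfolding h_eq by measurable
  have h_bound: "norm (h xs) \<le> C ^ length xs" for xs
    by (induction xs) (auto simp: h_def norm_mult C C0 intro!: mult_mono)
  then have h_bound': "norm (h xs) \<le> C ^ m" if "length xs = m" for xs m
    using that by blast
  have int_u: "integrable \<kappa> u" by (rule K.integrable_const_bound[where B = C]) (auto simp: C)
  have val: "(\<integral>w. usum m h w \<partial>M) = (\<mu> * (\<integral>x. u x \<partial>\<kappa>)) ^ m" for m
  proof -
    have "(\<integral>w. usum m h w \<partial>M) = \<mu> ^ m *\<^sub>R (\<integral>z. h (map z [0..<m]) \<partial>PiM {..<m} (\<lambda>_. \<kappa>))"
      by (rule usum_integral[OF h_meas, of _ "C ^ m"]) (rule h_bound')
    also have "(\<integral>z. h (map z [0..<m]) \<partial>PiM {..<m} (\<lambda>_. \<kappa>)) = (\<integral>x. u x \<partial>\<kappa>) ^ m"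
      unfolding h_eq by (subst P.product_integral_prod) (auto simp: int_u)
    finally show ?thesis by (simp add: power_mult_distrib scaleR_conv_of_real)
  qed
  have norm_le: "norm (usum m h w) \<le> usum m (\<lambda>_. C ^ m) w" for m w
  proof -
    have "norm (h (map (\<lambda>i. Y i w) js)) \<le> C ^ m" if "js \<in> dlists m (idx W w)" for js
      using h_bound'[of "map (\<lambda>i. Y i w) js" m] that by (simp add: dlists_def)
    then have "norm (\<Sum>js\<in>dlists m (idx W w). h (map (\<lambda>i. Y i w) js)) \<le> (\<Sum>js\<in>dlists m (idx W w). C ^ m)"
      by (rule sum_norm_le)
    then show ?thesis by (simp only: usum_def norm_zero order_refl split: if_split) blast
  qed
  have const_int: "integrable M (usum m (\<lambda>_. C ^ m))" "(\<integral>w. usum m (\<lambda>_. C ^ m) w \<partial>M) = \<mu> ^ m * C ^ m" for m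
  proof -
    interpret pP: prob_space "PiM {..<m} (\<lambda>_. \<kappa>)" by (intro prob_space_PiM K.prob_space_axioms)
    show "integrable M (usum m (\<lambda>_. C ^ m))"
      by (rule usum_integrable[where C = "C ^ m"]) (auto simp: C0)
    show "(\<integral>w. usum m (\<lambda>_. C ^ m) w \<partial>M) = \<mu> ^ m * C ^ m"
      using C0 by (subst usum_integral[where C = "C ^ m"]) (auto simp: pP.prob_space)
  qed
  let ?f = "\<lambda>m w. usum m h w /\<^sub>R fact m"
  have eq0: "?f m w = 0" if "card (idx W w) < m" "finite (idx W w)" for m w
  proof -
    have "js \<notin> dlists m (idx W w)" for js
      using that card_mono[of "idx W w" "set js"] by (auto simp: dlists_def distinct_card)
    then have "dlists m (idx W w) = {}" by auto
    then show ?thesis using that by (simp add: usum_def)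
  qed
  have expand: "(\<Prod>i\<in>idx W w. 1 + u (Y i w)) = (\<Sum>m. ?f m w)" if fin: "finite (idx W w)" for w
  proof -
    let ?S = "idx W w" and ?v = "\<lambda>i. u (Y i w)"
    have f_eq: "?f m w = (\<Sum>T | T \<subseteq> ?S \<and> card T = m. \<Prod>i\<in>T. ?v i)" for m
    proof -
      \<comment> \<open>Each m-element set of indices is listed by exactly m! lists.\<close>
      have D: "dlists m ?S = (\<Union>T\<in>{T. T \<subseteq> ?S \<and> card T = m}. permutations_of_set T)"
        using fin by (auto simp: dlists_def permutations_of_set_def distinct_card finite_subset)
      have "usum m h w = (\<Sum>js\<in>dlists m ?S. prod_list (map ?v js))"
        using fin by (simp add: usum_def h_def comp_def)
      also have "\<dots> = (\<Sum>T | T \<subseteq> ?S \<and> card T = m. \<Sum>js\<in>permutations_of_set T. prod_list (map ?v js))"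
        unfolding D using fin
        by (intro sum.UNION_disjoint) (auto dest: permutations_of_setD)
      also have "\<dots> = (\<Sum>T | T \<subseteq> ?S \<and> card T = m. fact m * (\<Prod>i\<in>T. ?v i))"
      proof (intro sum.cong refl)
        fix T assume T: "T \<in> {T. T \<subseteq> ?S \<and> card T = m}"
        have "(\<Sum>js\<in>permutations_of_set T. prod_list (map ?v js)) = (\<Sum>js\<in>permutations_of_set T. \<Prod>i\<in>T. ?v i)"
          by (intro sum.cong refl) (auto simp: permutations_of_set_def prod.distinct_set_conv_list)
        also have "\<dots> = fact m * (\<Prod>i\<in>T. ?v i)"
          using T fin by (auto simp: finite_subset)
        finally show "(\<Sum>js\<in>permutations_of_set T. prod_list (map ?v js)) = fact m * (\<Prod>i\<in>T. ?v i)" .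
      qed
      finally have "usum m h w = fact m * (\<Sum>T | T \<subseteq> ?S \<and> card T = m. \<Prod>i\<in>T. ?v i)"
        by (simp add: sum_distrib_left)
      then show ?thesis by (simp add: scaleR_conv_of_real)
    qed
    have "(\<Sum>m. ?f m w) = (\<Sum>m\<le>card ?S. ?f m w)"
      using eq0 fin by (intro suminf_finite) (auto simp: not_le)
    also have "\<dots> = (\<Sum>m\<le>card ?S. \<Sum>T\<in>{T \<in> Pow ?S. card T = m}. \<Prod>i\<in>T. ?v i)"
      unfolding f_eq by (intro sum.cong) auto
    also have "\<dots> = (\<Sum>T\<in>Pow ?S. \<Prod>i\<in>T. ?v i)"
      using fin by (intro sum.group) (auto intro: card_mono)
    also have "\<dots> = (\<Prod>i\<in>?S. ?v i + 1)"
      by (subst prod_add[OF fin]) simp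
    finally show ?thesis by (simp add: add.commute)
  qed
  have meas_f: "integrable M (?f m)" for m
    by (intro integrable_scaleR_right usum_integrable[OF h_meas, where C = "C ^ m"] h_bound')
  have norm_int: "(\<integral>w. norm (?f m w) \<partial>M) \<le> (\<mu> * C) ^ m /\<^sub>R fact m" for m
  proof -
    have "(\<integral>w. norm (?f m w) \<partial>M) \<le> (\<integral>w. usum m (\<lambda>_. C ^ m) w /\<^sub>R fact m \<partial>M)"
    proof (rule integral_mono)
      show "integrable M (\<lambda>w. norm (?f m w))" using meas_f by (rule integrable_norm)
      show "integrable M (\<lambda>w. usum m (\<lambda>_. C ^ m) w /\<^sub>R fact m)" using const_int(1) by (rule integrable_scaleR_right)
      show "norm (?f m w) \<le> usum m (\<lambda>_. C ^ m) w /\<^sub>R fact m" for w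
        using norm_le[of m w] by (simp add: norm_mult divide_simps)
    qed
    also have "\<dots> = (\<mu> * C) ^ m /\<^sub>R fact m"
      using const_int by (simp add: power_mult_distrib)
    finally show ?thesis .
  qed
  have "(\<integral>w. (\<Prod>i\<in>idx W w. 1 + u (Y i w)) \<partial>M) = (\<integral>w. (\<Sum>m. ?f m w) \<partial>M)"
  proof (rule integral_cong_AE)
    have [measurable]: "?f m \<in> borel_measurable M" for m by (rule borel_measurable_integrable[OF meas_f])
    show "(\<lambda>w. \<Sum>m. ?f m w) \<in> borel_measurable M" by measurable
    then have "(\<lambda>w. if finite (idx W w) then \<Sum>m. ?f m w else 1) \<in> borel_measurable M" by measurable
    moreover have "(\<lambda>w. if finite (idx W w) then \<Sum>m. ?f m w else 1) = (\<lambda>w. \<Prod>i\<in>idx W w. 1 + u (Y i w))"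
      using expand by auto
    ultimately show "(\<lambda>w. \<Prod>i\<in>idx W w. 1 + u (Y i w)) \<in> borel_measurable M" by simp
    show "AE w in M. (\<Prod>i\<in>idx W w. 1 + u (Y i w)) = (\<Sum>m. ?f m w)"
      using AE_finite_idx[OF W_sets subset_refl] by eventually_elim (rule expand)
  qed
  also have "\<dots> = (\<Sum>m. \<integral>w. ?f m w \<partial>M)"
  \<comment> \<open>The interchange is legitimate: for almost every outcome only finitely many terms
    are nonzero, and the expected norms are dominated by the exponential series of \<mu> C.\<close>
  proof (rule integral_suminf[OF meas_f])
    show "AE w in M. summable (\<lambda>m. norm (?f m w))"
      using AE_finite_idx[OF W_sets subset_refl]
    proof eventually_elim
      case (elim w)
      show ?case
        by (rule summable_finite[of "{..card (idx W w)}"]) (use eq0 elim in \<open>auto simp: not_le\<close>)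
    qed
    show "summable (\<lambda>m. \<integral>w. norm (?f m w) \<partial>M)"
    proof (rule summable_comparison_test'[where N = 0])
      show "summable (\<lambda>m. (\<mu> * C) ^ m /\<^sub>R fact m)" by (rule summable_exp_generic)
      fix m :: nat
      have "0 \<le> (\<integral>w. norm (?f m w) \<partial>M)" by (intro Bochner_Integration.integral_nonneg norm_ge_zero)
      then show "norm (\<integral>w. norm (?f m w) \<partial>M) \<le> (\<mu> * C) ^ m /\<^sub>R fact m"
        using norm_int[of m] by (simp only: real_norm_def abs_of_nonneg)
    qed
  qed
  also have "\<dots> = (\<Sum>m. (\<mu> * (\<integral>x. u x \<partial>\<kappa>)) ^ m /\<^sub>R fact m)"
    by (simp add: val)
  also have "\<dots> = exp (\<mu> * (\<integral>x. u x \<partial>\<kappa>))" by (simp add: exp_def)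
  finally show ?thesis .
qed

text \<open>The exponential of a sum is the product of 1 + u with u = exp(i q) - 1, and this u is
  bounded by 2, so q itself may be unbounded.\<close>

theorem characteristic_functional:
  assumes q[measurable]: "q \<in> borel_measurable \<kappa>"
  shows "(\<integral>w. iexp (usum 1 (\<lambda>xs. q (hd xs)) w) \<partial>M) = exp (\<mu> * (\<integral>x. iexp (q x) - 1 \<partial>\<kappa>))"
proof -
  have "norm (iexp (q x) - 1) \<le> 2" for x
    using norm_triangle_ineq4[of "iexp (q x)" 1] by simp
  then have "(\<integral>w. (\<Prod>i\<in>idx W w. 1 + (iexp (q (Y i w)) - 1)) \<partial>M) = exp (\<mu> * (\<integral>x. iexp (q x) - 1 \<partial>\<kappa>))"
    by (intro expectation_prod) auto
  moreover have "(\<Prod>i\<in>idx W w. 1 + (iexp (q (Y i w)) - 1)) = iexp (usum 1 (\<lambda>xs. q (hd xs)) w)" for w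
  proof (cases "finite (idx W w)")
    case True
    then show ?thesis by (simp add: usum_one[OF True, simplified] exp_sum sum_distrib_left)
  qed (simp add: usum_def)
  ultimately show ?thesis by simp
qed

end

section \<open>Products of sums over distinct lists\<close>

text \<open>Restores an entry that was deleted at position q. A list J that shares only its q-th
  entry with I is encoded by that entry together with the rest of J.\<close>

definition insert_at :: "nat \<Rightarrow> 'a \<Rightarrow> 'a list \<Rightarrow> 'a list" where
  "insert_at q x K = take q K @ x # drop q K"

lemma length_insert_at[simp]: "length (insert_at q x K) = Suc (length K)"
  by (simp add: insert_at_def)

lemma mset_insert_at[simp]: "mset (insert_at q x K) = add_mset x (mset K)"
  unfolding insert_at_def by (metis append_take_drop_id mset.simps(2) mset_append union_mset_add_mset_right)

lemma set_insert_at[simp]: "set (insert_at q x K) = insert x (set K)"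
  by (metis mset_insert_at set_mset_add_mset_insert set_mset_mset)

lemma distinct_insert_at[simp]: "distinct (insert_at q x K) \<longleftrightarrow> x \<notin> set K \<and> distinct K"
  by (metis distinct.simps(2) mset.simps(2) mset_eq_imp_distinct_iff mset_insert_at)

lemma map_insert_at: "map f (insert_at q x K) = insert_at q (f x) (map f K)"
  by (simp add: insert_at_def take_map drop_map)

lemma nth_insert_at: "q \<le> length K \<Longrightarrow> insert_at q x K ! q = x"
  by (simp add: insert_at_def nth_append)

lemma insert_at_remove: "q < length J \<Longrightarrow> insert_at q (J ! q) (take q J @ drop (Suc q) J) = J"
  by (simp add: insert_at_def id_take_nth_drop[symmetric])

lemma remove_insert_at: "q \<le> length K \<Longrightarrow> take q (insert_at q x K) @ drop (Suc q) (insert_at q x K) = K"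
  by (simp add: insert_at_def)

text \<open>Pairs (I, J) are sorted by the size of their overlap. Disjoint pairs are lists of length
  m + n (the sum D). Pairs sharing exactly the p-th entry of I and the q-th of J are lists of length
  m + n - 1 with J rebuilt by \<open>insert_at\<close> (the sum E). In all other pairs at least two
  entries of J are dictated by I, which leaves at most m^2 n^2 N^(m + n - 2) of them, N being the
  number of points.\<close>

lemma dlists_product_split:
  fixes a b :: "'a list \<Rightarrow> real"
  assumes S: "finite S" and "m \<ge> 1" "n \<ge> 1"
    and a: "\<And>I. I \<in> dlists m S \<Longrightarrow> 0 \<le> a I \<and> a I \<le> A"
    and AB0: "A \<ge> 0" "B \<ge> 0"
    and b: "\<And>J. J \<in> dlists n S \<Longrightarrow> 0 \<le> b J \<and> b J \<le> B"
  defines "D \<equiv> \<Sum>L\<in>dlists (m + n) S. a (take m L) * b (drop m L)"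
    and "E \<equiv> \<Sum>p<m. \<Sum>q<n. \<Sum>L\<in>dlists (m + n - 1) S. a (take m L) * b (insert_at q (L ! p) (drop m L))"
    and "T \<equiv> (\<Sum>I\<in>dlists m S. a I) * (\<Sum>J\<in>dlists n S. b J)"
  shows "D + E \<le> T" "T \<le> D + E + A * B * (m\<^sup>2 * n\<^sup>2) * card S ^ (m + n - 2)"
proof -
  let ?P = "dlists m S \<times> dlists n S"
  let ?f = "\<lambda>(I, J). a I * b J"
  define P0 where "P0 = {(I, J) \<in> ?P. set I \<inter> set J = {}}"
  define P1 where "P1 = (\<lambda>(p, q). {(I, J) \<in> ?P. I ! p = J ! q \<and> set I \<inter> set J = {I ! p}})"
  define Q where "Q = {..<m} \<times> {..<n}"
  \<comment> \<open>The pairs with at least two common entries.\<close>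
  define R where "R = ?P - P0 - (\<Union>pq\<in>Q. P1 pq)"
  have fin: "finite ?P" using S by (simp add: finite_dlists)
  have finQ: "finite Q" by (simp add: Q_def)
  have P1_fin: "finite (P1 pq)" for pq
    by (rule finite_subset[OF _ fin]) (auto simp: P1_def split: prod.splits)
  have f_nn: "0 \<le> ?f IJ" if "IJ \<in> ?P" for IJ using a b that by auto
  have T_eq: "T = sum ?f ?P"
    unfolding T_def sum_product sum.cartesian_product by simp
  have D_eq: "sum ?f P0 = D"
  proof -
    have bij: "bij_betw (\<lambda>L. (take m L, drop m L)) (dlists (m + n) S) P0"
    proof (rule bij_betw_byWitness[where f' = "\<lambda>(I, J). I @ J"])
      show "\<forall>L\<in>dlists (m + n) S. (\<lambda>(I, J). I @ J) (take m L, drop m L) = L" by simp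
      show "\<forall>IJ\<in>P0. (take m ((\<lambda>(I, J). I @ J) IJ), drop m ((\<lambda>(I, J). I @ J) IJ)) = IJ"
        by (auto simp: P0_def dlists_def)
      show "(\<lambda>L. (take m L, drop m L)) ` dlists (m + n) S \<subseteq> P0"
        by (auto simp: P0_def dlists_def dest: in_set_takeD in_set_dropD)
          (metis IntI append_take_drop_id distinct_append empty_iff)
      show "(\<lambda>(I, J). I @ J) ` P0 \<subseteq> dlists (m + n) S"
        by (auto simp: P0_def dlists_def)
    qed
    show ?thesis unfolding D_def using sum.reindex_bij_betw[OF bij, of ?f] by simp
  qed
  have P1_eq: "sum ?f (P1 (p, q)) = (\<Sum>L\<in>dlists (m + n - 1) S. a (take m L) * b (insert_at q (L ! p) (drop m L)))"
    if "p < m" "q < n" for p q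
  proof -
    have bij: "bij_betw (\<lambda>L. (take m L, insert_at q (L ! p) (drop m L))) (dlists (m + n - 1) S) (P1 (p, q))"
    proof (rule bij_betw_byWitness[where f' = "\<lambda>(I, J). I @ take q J @ drop (Suc q) J"])
      show "\<forall>L\<in>dlists (m + n - 1) S. (\<lambda>(I, J). I @ take q J @ drop (Suc q) J) (take m L, insert_at q (L ! p) (drop m L)) = L"
        using that by (auto simp: dlists_def remove_insert_at simp del: append_assoc)
      show "\<forall>IJ\<in>P1 (p, q). (\<lambda>L. (take m L, insert_at q (L ! p) (drop m L))) ((\<lambda>(I, J). I @ take q J @ drop (Suc q) J) IJ) = IJ"
        using that by (auto simp: P1_def dlists_def nth_append insert_at_remove)
      show "(\<lambda>L. (take m L, insert_at q (L ! p) (drop m L))) ` dlists (m + n - 1) S \<subseteq> P1 (p, q)"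
      proof (rule image_subsetI)
        fix L assume L: "L \<in> dlists (m + n - 1) S"
        define I K where "I = take m L" and "K = drop m L"
        have LIK: "L = I @ K" by (simp add: I_def K_def)
        have len: "length I = m" "length K = n - 1" using L that \<open>n \<ge> 1\<close> by (auto simp: I_def K_def dlists_def)
        have Lp: "L ! p = I ! p" using that len by (simp add: LIK nth_append)
        have mem: "I ! p \<in> set I" using that len by simp
        have "distinct I" "distinct K" "set I \<inter> set K = {}" "set I \<subseteq> S" "set K \<subseteq> S"
          using L unfolding LIK dlists_def by auto
        moreover from this mem have "I ! p \<notin> set K" by blast
        ultimately have "(I, insert_at q (I ! p) K) \<in> P1 (p, q)"
          using len mem that \<open>n \<ge> 1\<close> by (auto simp: P1_def dlists_def nth_insert_at)
        then show "(take m L, insert_at q (L ! p) (drop m L)) \<in> P1 (p, q)"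
          by (simp only: Lp flip: I_def K_def)
      qed
      show "(\<lambda>(I, J). I @ take q J @ drop (Suc q) J) ` P1 (p, q) \<subseteq> dlists (m + n - 1) S"
      proof (rule image_subsetI, clarify)
        fix I J assume IJ: "(I, J) \<in> P1 (p, q)"
        define K where "K = take q J @ drop (Suc q) J"
        have q: "q < length J" and len: "length I = m" "length J = n" and eq: "J ! q = I ! p"
          and I: "distinct I" "set I \<subseteq> S" and J: "distinct J" "set J \<subseteq> S" and int: "set I \<inter> set J = {I ! p}"
          using IJ that by (auto simp: P1_def dlists_def)
        have J_eq: "insert_at q (I ! p) K = J" using insert_at_remove[OF q] by (simp only: K_def eq)
        have K: "I ! p \<notin> set K" "distinct K" "insert (I ! p) (set K) = set J"
          using J(1) by (simp_all flip: J_eq)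
        have lenK: "length K = n - 1" using arg_cong[OF J_eq, of length] len by simp
        have KJ: "set K \<subseteq> set J" using K(3) by (metis subset_insertI)
        have "set I \<inter> set K \<subseteq> {I ! p}" using KJ int by (metis Int_mono order_refl)
        then have "set I \<inter> set K = {}" using K(1) by blast
        moreover have "set K \<subseteq> S" using KJ J(2) by (rule subset_trans)
        ultimately have "I @ K \<in> dlists (m + n - 1) S"
          using I K(2) len lenK \<open>n \<ge> 1\<close> by (simp add: dlists_def)
        then show "I @ take q J @ drop (Suc q) J \<in> dlists (m + n - 1) S" by (simp only: K_def)
      qed
    qed
    show ?thesis using sum.reindex_bij_betw[OF bij, of ?f] by simp
  qed
  have E_eq: "sum ?f (\<Union>pq\<in>Q. P1 pq) = E"
  proof -
    have "P1 pq \<inter> P1 pq' = {}" if "pq \<in> Q" "pq' \<in> Q" "pq \<noteq> pq'" for pq pq'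
    proof -
      have "p = p' \<and> q = q'" if "(I, J) \<in> P1 (p, q)" "(I, J) \<in> P1 (p', q')" "p < m" "q < n" "p' < m" "q' < n" for I J p q p' q'
      proof -
        have eqs: "I ! p = I ! p'" "J ! q = J ! q'" using that by (auto simp: P1_def)
        have "distinct I" "distinct J" "length I = m" "length J = n" using that by (auto simp: P1_def dlists_def)
        then show ?thesis using eqs that(3-6) by (simp add: nth_eq_iff_index_eq)
      qed
      then show ?thesis using that by (fastforce simp: Q_def)
    qed
    then have "sum ?f (\<Union>pq\<in>Q. P1 pq) = (\<Sum>pq\<in>Q. sum ?f (P1 pq))"
      using finQ P1_fin by (intro sum.UNION_disjoint) auto
    also have "\<dots> = (\<Sum>(p, q)\<in>Q. \<Sum>L\<in>dlists (m + n - 1) S. a (take m L) * b (insert_at q (L ! p) (drop m L)))"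
      by (intro sum.cong refl) (auto simp: Q_def P1_eq)
    also have "\<dots> = E" unfolding E_def Q_def by (rule sum.cartesian_product[symmetric])
    finally show ?thesis .
  qed
  have disj: "P0 \<inter> (\<Union>pq\<in>Q. P1 pq) = {}" by (auto simp: P0_def P1_def)
  have sub: "P0 \<subseteq> ?P" "(\<Union>pq\<in>Q. P1 pq) \<subseteq> ?P" by (auto simp: P0_def P1_def)
  have split: "T = D + E + sum ?f R"
  proof -
    have "?P = (P0 \<union> (\<Union>pq\<in>Q. P1 pq)) \<union> R" using sub unfolding R_def by blast
    then have "T = sum ?f ((P0 \<union> (\<Union>pq\<in>Q. P1 pq)) \<union> R)" unfolding T_eq by simp
    also have "\<dots> = sum ?f (P0 \<union> (\<Union>pq\<in>Q. P1 pq)) + sum ?f R"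
      using fin sub finite_subset[OF sub(1) fin] finite_subset[OF sub(2) fin]
      by (intro sum.union_disjoint) (auto simp: R_def)
    also have "sum ?f (P0 \<union> (\<Union>pq\<in>Q. P1 pq)) = D + E"
      using disj finite_subset[OF sub(1) fin] finite_subset[OF sub(2) fin]
      by (subst sum.union_disjoint) (auto simp: D_eq E_eq)
    finally show ?thesis .
  qed
  have "R \<subseteq> ?P" by (auto simp: R_def)
  then show "D + E \<le> T"
    unfolding split using sum_nonneg[of R ?f] f_nn by auto
  have card_R: "card R \<le> m\<^sup>2 * n\<^sup>2 * card S ^ (m + n - 2)"
  proof -
    \<comment> \<open>Positions p, p' in I and q, q' in J of two different common entries. Since J
      repeats no entry, q and q' differ, and this is what saves two factors below.\<close>
    define G where "G = {(p, p', q, q'). p < m \<and> p' < m \<and> q < n \<and> q' < n \<and> q \<noteq> q'}"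
    define H where "H = (\<lambda>(p, p', q, q'). {(I, J) \<in> ?P. J ! q = I ! p \<and> J ! q' = I ! p'})"
    have G_sub: "G \<subseteq> {..<m} \<times> {..<m} \<times> {..<n} \<times> {..<n}" by (auto simp: G_def)
    have G_fin: "finite G" by (rule finite_subset[OF G_sub]) auto
    have "card G \<le> card ({..<m} \<times> {..<m} \<times> {..<n} \<times> {..<n})"
      by (intro card_mono G_sub) auto
    then have card_G: "card G \<le> m\<^sup>2 * n\<^sup>2" by (simp add: power2_eq_square mult_ac)
    have H_fin: "finite (H g)" for g
      by (rule finite_subset[OF _ fin]) (auto simp: H_def split: prod.splits)
    have "R \<subseteq> (\<Union>g\<in>G. H g)"
    proof
      fix IJ assume "IJ \<in> R"
      then obtain I J where IJ: "IJ = (I, J)" "(I, J) \<in> ?P" "(I, J) \<notin> P0" "\<And>pq. pq \<in> Q \<Longrightarrow> (I, J) \<notin> P1 pq"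
        by (auto simp: R_def)
      then obtain x where x: "x \<in> set I" "x \<in> set J" by (auto simp: P0_def)
      have len: "length I = m" "length J = n" using IJ by (auto simp: dlists_def)
      obtain p q where pq: "p < m" "q < n" "I ! p = x" "J ! q = x"
        using x len by (auto simp: in_set_conv_nth)
      have "set I \<inter> set J \<noteq> {x}"
        using IJ(2) IJ(4)[of "(p, q)"] pq by (auto simp: P1_def Q_def)
      then obtain y where y: "y \<in> set I" "y \<in> set J" "y \<noteq> x" using x by auto
      obtain p' q' where pq': "p' < m" "q' < n" "I ! p' = y" "J ! q' = y"
        using y len by (auto simp: in_set_conv_nth)
      have "q \<noteq> q'" using pq pq' y by auto
      then have "(p, p', q, q') \<in> G" "(I, J) \<in> H (p, p', q, q')"
        using IJ(2) pq pq' by (auto simp: G_def H_def)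
      then show "IJ \<in> (\<Union>g\<in>G. H g)" using IJ(1) by auto
    qed
    then have "card R \<le> card (\<Union>g\<in>G. H g)" using G_fin H_fin by (intro card_mono) auto
    also have "\<dots> \<le> (\<Sum>g\<in>G. card (H g))" using G_fin by (rule card_UN_le)
    also have "\<dots> \<le> (\<Sum>g\<in>G. card S ^ (m + n - 2))"
    proof (intro sum_mono)
      fix g assume "g \<in> G"
      then obtain p p' q q' where g: "g = (p, p', q, q')" "p < m" "p' < m" "q < n" "q' < n" "q \<noteq> q'"
        by (auto simp: G_def)
      \<comment> \<open>Once I is known, J is determined by its entries away from q and q';
        forgetting those two is injective on \<open>H g\<close>.\<close>
      let ?X = "{xs. set xs \<subseteq> S \<and> length xs = m} \<times> (PiE ({..<n} - {q, q'}) (\<lambda>_. S))"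
      let ?c = "\<lambda>(I, J). (I, \<lambda>i\<in>{..<n} - {q, q'}. J ! i)"
      have "inj_on ?c (H g)"
      proof (rule inj_onI)
        fix X X' assume X: "X \<in> H g" "X' \<in> H g" "?c X = ?c X'"
        obtain I J I' J' where XI: "X = (I, J)" "X' = (I', J')" by (cases X, cases X')
        have I: "I' = I" and eq: "(\<lambda>i\<in>{..<n} - {q, q'}. J ! i) = (\<lambda>i\<in>{..<n} - {q, q'}. J' ! i)"
          using X(3) by (auto simp: XI)
        have len: "length J = n" "length J' = n"
          and J: "J ! q = I ! p" "J ! q' = I ! p'" "J' ! q = I ! p" "J' ! q' = I ! p'"
          using X(1,2) by (auto simp: H_def g XI I dlists_def)
        have "J ! i = J' ! i" if "i < n" for i
          using that J fun_cong[OF eq, of i] by (cases "i = q"; cases "i = q'") auto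
        then have "J = J'" using len by (intro nth_equalityI) auto
        then show "X = X'" by (simp add: XI I)
      qed
      moreover have "?c ` H g \<subseteq> ?X"
      proof (rule image_subsetI)
        fix X assume "X \<in> H g"
        then obtain I J where X: "X = (I, J)" "I \<in> dlists m S" "J \<in> dlists n S" by (auto simp: H_def g(1))
        have "J ! i \<in> S" if "i < n" for i using X(3) that nth_mem[of i J] by (auto simp: dlists_def)
        then have "(\<lambda>i\<in>{..<n} - {q, q'}. J ! i) \<in> PiE ({..<n} - {q, q'}) (\<lambda>_. S)" by simp
        then show "?c X \<in> ?X" using X(2) by (simp add: X(1) dlists_def)
      qed
      moreover have "finite ?X" using S by (intro finite_cartesian_product finite_lists_length_eq finite_PiE) auto
      ultimately have "card (H g) \<le> card ?X" by (rule card_inj_on_le)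
      also have "\<dots> = card S ^ m * card S ^ (n - 2)"
        using S g by (simp add: card_cartesian_product card_lists_length_eq card_PiE card_Diff_subset numeral_2_eq_2)
      also have "\<dots> = card S ^ (m + n - 2)"
        using g by (simp flip: power_add)
      finally show "card (H g) \<le> card S ^ (m + n - 2)" .
    qed
    also have "\<dots> = card G * card S ^ (m + n - 2)" by simp
    also have "\<dots> \<le> m\<^sup>2 * n\<^sup>2 * card S ^ (m + n - 2)" using card_G by (rule mult_le_mono1)
    finally show ?thesis .
  qed
  have "sum ?f R \<le> A * B * (m\<^sup>2 * n\<^sup>2) * card S ^ (m + n - 2)"
  proof -
    have "sum ?f R \<le> (\<Sum>IJ\<in>R. A * B)"
      using a b \<open>R \<subseteq> ?P\<close> by (intro sum_mono) (auto intro!: mult_mono AB0)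
    also have "\<dots> = card R * (A * B)" by simp
    also have "\<dots> \<le> (m\<^sup>2 * n\<^sup>2 * card S ^ (m + n - 2)) * (A * B)"
      using AB0 of_nat_mono[OF card_R, where 'a=real] by (intro mult_right_mono) auto
    finally show ?thesis by (simp add: mult_ac)
  qed
  then show "T \<le> D + E + A * B * (m\<^sup>2 * n\<^sup>2) * card S ^ (m + n - 2)" unfolding split by simp
qed

section \<open>Kernels, their means and their projections\<close>

definition theta :: "'b measure \<Rightarrow> nat \<Rightarrow> ('b list \<Rightarrow> real) \<Rightarrow> real" where
  "theta \<kappa> m h = (\<integral>z. h (map z [0..<m]) \<partial>PiM {..<m} (\<lambda>_. \<kappa>))"

text \<open>The first Hoeffding projection: the mean of the kernel given one of its
  arguments.\<close>

definition proj :: "'b measure \<Rightarrow> nat \<Rightarrow> ('b list \<Rightarrow> real) \<Rightarrow> 'b \<Rightarrow> real" where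
  "proj \<kappa> m h x = (\<integral>z. h (x # map z [0..<m - 1]) \<partial>PiM {..<m - 1} (\<lambda>_. \<kappa>))"

text \<open>Symmetry is invariance under equality of multisets. Bounds and symmetry are demanded for
  lists of every length, measurability only for length m.\<close>

definition kernel :: "'b measure \<Rightarrow> nat \<Rightarrow> real \<Rightarrow> ('b list \<Rightarrow> real) \<Rightarrow> bool" where
  "kernel \<kappa> m C h \<longleftrightarrow> m \<ge> 1 \<and> (\<lambda>z. h (map z [0..<m])) \<in> borel_measurable (PiM {..<m} (\<lambda>_. \<kappa>)) \<and>
    (\<forall>xs. 0 \<le> h xs \<and> h xs \<le> C) \<and> (\<forall>xs ys. mset xs = mset ys \<longrightarrow> h xs = h ys)"

lemma kernelD:
  assumes "kernel \<kappa> m C h"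
  shows "m \<ge> 1" "(\<lambda>z. h (map z [0..<m])) \<in> borel_measurable (PiM {..<m} (\<lambda>_. \<kappa>))"
    "0 \<le> h xs" "h xs \<le> C" "\<bar>h xs\<bar> \<le> C" "mset xs = mset ys \<Longrightarrow> h xs = h ys" "0 \<le> C"
proof -
  have all: "m \<ge> 1" "(\<lambda>z. h (map z [0..<m])) \<in> borel_measurable (PiM {..<m} (\<lambda>_. \<kappa>))"
    "\<And>xs. 0 \<le> h xs \<and> h xs \<le> C" "\<And>xs ys. mset xs = mset ys \<Longrightarrow> h xs = h ys"
    using assms unfolding kernel_def by blast+
  show "m \<ge> 1" "(\<lambda>z. h (map z [0..<m])) \<in> borel_measurable (PiM {..<m} (\<lambda>_. \<kappa>))" by fact+
  show "0 \<le> h xs" "h xs \<le> C" "\<bar>h xs\<bar> \<le> C" "0 \<le> C" using all(3)[of xs] by auto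
  show "mset xs = mset ys \<Longrightarrow> h xs = h ys" by (rule all(4))
qed

lemma measurable_on_list:
  assumes F: "(\<lambda>z. F (map z [0..<m])) \<in> borel_measurable (PiM {..<m} (\<lambda>_. \<kappa>))"
    and f: "\<And>i. i < m \<Longrightarrow> (\<lambda>w. f w i) \<in> measurable N \<kappa>"
  shows "(\<lambda>w. F (map (f w) [0..<m])) \<in> borel_measurable N"
proof -
  have "(\<lambda>w. \<lambda>i\<in>{..<m}. f w i) \<in> measurable N (PiM {..<m} (\<lambda>_. \<kappa>))"
    using f by (intro measurable_restrict) auto
  from measurable_compose[OF this F]
  have "(\<lambda>w. F (map (\<lambda>i\<in>{..<m}. f w i) [0..<m])) \<in> borel_measurable N" .
  moreover have "map (\<lambda>i\<in>{..<m}. f w i) [0..<m] = map (f w) [0..<m]" for w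
    by (rule nth_equalityI) auto
  ultimately show ?thesis by (simp only:)
qed

lemma measurable_map_list:
  assumes F: "(\<lambda>z. F (map z [0..<length as])) \<in> borel_measurable (PiM {..<length as} (\<lambda>_. \<kappa>))"
    and "set as \<subseteq> J"
  shows "(\<lambda>z. F (map z as)) \<in> borel_measurable (PiM J (\<lambda>_. \<kappa>))"
proof -
  have "(\<lambda>z. F (map (\<lambda>i. z (as ! i)) [0..<length as])) \<in> borel_measurable (PiM J (\<lambda>_. \<kappa>))"
    by (rule measurable_on_list[OF F]) (use assms(2) in \<open>auto intro!: measurable_component_singleton\<close>)
  moreover have "(\<lambda>z. F (map (\<lambda>i. z (as ! i)) [0..<length as])) = (\<lambda>z. F (map z as))"
    by (intro ext arg_cong[where f=F] nth_equalityI) auto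
  ultimately show ?thesis by (simp only:)
qed

context prob_space
begin

text \<open>The coordinates are independent and identically distributed, so only the number of
  distinct indices matters and they may be renamed 0, 1, and so on.\<close>

lemma integral_PiM_list:
  fixes F :: "'a list \<Rightarrow> real"
  assumes F: "(\<lambda>z. F (map z [0..<length as])) \<in> borel_measurable (PiM {..<length as} (\<lambda>_. M))"
    and as: "distinct as" "set as \<subseteq> J"
  shows "(\<integral>z. F (map z as) \<partial>PiM J (\<lambda>_. M)) = (\<integral>z. F (map z [0..<length as]) \<partial>PiM {..<length as} (\<lambda>_. M))"
proof -
  let ?t = "\<lambda>z. \<lambda>n\<in>{..<length as}. z (as ! n)"
  have "distr (PiM J (\<lambda>_. M)) (PiM {..<length as} (\<lambda>_. M)) ?t = PiM {..<length as} (\<lambda>_. M)"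
    using as by (intro distr_PiM_reindex prob_space_axioms) (auto simp: inj_on_def nth_eq_iff_index_eq)
  then have "(\<integral>z. F (map z [0..<length as]) \<partial>PiM {..<length as} (\<lambda>_. M)) =
      (\<integral>z. F (map z [0..<length as]) \<partial>distr (PiM J (\<lambda>_. M)) (PiM {..<length as} (\<lambda>_. M)) ?t)" by simp
  also have "\<dots> = (\<integral>z. F (map (?t z) [0..<length as]) \<partial>PiM J (\<lambda>_. M))"
    using as F by (intro integral_distr measurable_restrict) (auto intro!: measurable_component_singleton)
  also have "\<dots> = (\<integral>z. F (map z as) \<partial>PiM J (\<lambda>_. M))"
    by (intro Bochner_Integration.integral_cong refl arg_cong[where f=F] nth_equalityI) auto
  finally show ?thesis by (simp only:)
qed

text \<open>After renaming, the two index lists occupy complementary blocks of coordinates, and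
  Fubini separates the factors.\<close>

lemma integral_PiM_append:
  fixes F G :: "'a list \<Rightarrow> real"
  assumes F: "(\<lambda>z. F (map z [0..<length as])) \<in> borel_measurable (PiM {..<length as} (\<lambda>_. M))"
    and G: "(\<lambda>z. G (map z [0..<length bs])) \<in> borel_measurable (PiM {..<length bs} (\<lambda>_. M))"
    and as: "distinct (as @ bs)" "set as \<union> set bs \<subseteq> J"
    and FB: "\<And>xs. length xs = length as \<Longrightarrow> \<bar>F xs\<bar> \<le> B" and GB: "\<And>xs. length xs = length bs \<Longrightarrow> \<bar>G xs\<bar> \<le> B'"
  shows "(\<integral>z. F (map z as) * G (map z bs) \<partial>PiM J (\<lambda>_. M)) =
    (\<integral>z. F (map z [0..<length as]) \<partial>PiM {..<length as} (\<lambda>_. M)) * (\<integral>z. G (map z [0..<length bs]) \<partial>PiM {..<length bs} (\<lambda>_. M))"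
proof -
  interpret P: product_sigma_finite "\<lambda>_. M" by standard
  define m n where "m = length as" and "n = length bs"
  let ?A = "{..<m}" and ?B = "{m..<m + n}"
  have AB: "?A \<union> ?B = {..<m + n}" "?A \<inter> ?B = {}" by auto
  interpret pA: prob_space "PiM ?A (\<lambda>_. M)" by (intro prob_space_PiM prob_space_axioms)
  interpret pB: prob_space "PiM ?B (\<lambda>_. M)" by (intro prob_space_PiM prob_space_axioms)
  interpret pAB: prob_space "PiM {..<m + n} (\<lambda>_. M)" by (intro prob_space_PiM prob_space_axioms)
  have F': "(\<lambda>z. F (map z xs)) \<in> borel_measurable (PiM K (\<lambda>_. M))" if "length xs = m" "set xs \<subseteq> K" for xs K
    using measurable_map_list[of F xs] F that by (simp add: m_def)
  have G': "(\<lambda>z. G (map z xs)) \<in> borel_measurable (PiM K (\<lambda>_. M))" if "length xs = n" "set xs \<subseteq> K" for xs K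
    using measurable_map_list[of G xs] G that by (simp add: n_def)
  define H where "H = (\<lambda>zs. F (take m zs) * G (drop m zs))"
  have H_eq: "H (map z [0..<m + n]) = F (map z [0..<m]) * G (map z [m..<m + n])" for z
    by (simp add: H_def take_map drop_map)
  have H_meas: "(\<lambda>z. H (map z [0..<m + n])) \<in> borel_measurable (PiM {..<m + n} (\<lambda>_. M))"
    unfolding H_eq by (intro borel_measurable_times F' G') auto
  have H_int: "integrable (PiM {..<m + n} (\<lambda>_. M)) (\<lambda>z. H (map z [0..<m + n]))"
  proof (rule pAB.integrable_const_bound[where B = "\<bar>B\<bar> * \<bar>B'\<bar>"])
    show "AE z in PiM {..<m + n} (\<lambda>_. M). norm (H (map z [0..<m + n])) \<le> \<bar>B\<bar> * \<bar>B'\<bar>"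
      unfolding H_eq
    proof (intro AE_I2)
      fix z :: "nat \<Rightarrow> 'a"
      have "\<bar>F (map z [0..<m])\<bar> \<le> \<bar>B\<bar>" "\<bar>G (map z [m..<m + n])\<bar> \<le> \<bar>B'\<bar>"
        using FB[of "map z [0..<m]"] GB[of "map z [m..<m + n]"] by (auto simp: m_def n_def)
      then show "norm (F (map z [0..<m]) * G (map z [m..<m + n])) \<le> \<bar>B\<bar> * \<bar>B'\<bar>"
        by (simp add: abs_mult mult_mono)
    qed
  qed (rule H_meas)
  have "(\<integral>z. F (map z as) * G (map z bs) \<partial>PiM J (\<lambda>_. M)) = (\<integral>z. H (map z (as @ bs)) \<partial>PiM J (\<lambda>_. M))"
    by (simp add: H_def m_def)
  also have "\<dots> = (\<integral>z. H (map z [0..<m + n]) \<partial>PiM {..<m + n} (\<lambda>_. M))"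
    using integral_PiM_list[of H "as @ bs" J] H_meas as by (simp add: m_def n_def)
  also have "\<dots> = (\<integral>x. \<integral>y. H (map (merge ?A ?B (x, y)) [0..<m + n]) \<partial>PiM ?B (\<lambda>_. M) \<partial>PiM ?A (\<lambda>_. M))"
    unfolding AB(1)[symmetric] using H_int by (intro P.product_integral_fold) (auto simp: AB)
  also have "\<dots> = (\<integral>x. \<integral>y. F (map x [0..<m]) * G (map y [m..<m + n]) \<partial>PiM ?B (\<lambda>_. M) \<partial>PiM ?A (\<lambda>_. M))"
    unfolding H_eq
    by (intro Bochner_Integration.integral_cong refl arg_cong2[where f="(*)"] arg_cong[where f=F] arg_cong[where f=G] map_cong)
      (auto simp: merge_def)
  also have "\<dots> = (\<integral>x. F (map x [0..<m]) \<partial>PiM ?A (\<lambda>_. M)) * (\<integral>y. G (map y [m..<m + n]) \<partial>PiM ?B (\<lambda>_. M))"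
    by simp
  also have "(\<integral>y. G (map y [m..<m + n]) \<partial>PiM ?B (\<lambda>_. M)) = (\<integral>z. G (map z [0..<n]) \<partial>PiM {..<n} (\<lambda>_. M))"
    using integral_PiM_list[of G "[m..<m + n]" ?B] G by (simp add: n_def)
  finally show ?thesis by (simp add: m_def n_def)
qed

lemma measurable_Cons_kernel:
  assumes h: "kernel M m C h"
  shows "(\<lambda>(x, z). h (x # map z [0..<m - 1])) \<in> borel_measurable (M \<Otimes>\<^sub>M PiM {..<m - 1} (\<lambda>_. M))"
proof -
  have "(\<lambda>w. h (map (\<lambda>i. if i = 0 then fst w else snd w (i - 1)) [0..<m])) \<in> borel_measurable (M \<Otimes>\<^sub>M PiM {..<m - 1} (\<lambda>_. M))"
  proof (rule measurable_on_list[OF kernelD(2)[OF h]])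
    fix i assume "i < m"
    show "(\<lambda>w. if i = 0 then fst w else snd w (i - 1)) \<in> measurable (M \<Otimes>\<^sub>M PiM {..<m - 1} (\<lambda>_. M)) M"
      using \<open>i < m\<close> by (cases "i = 0") (auto intro!: measurable_compose[OF measurable_snd measurable_component_singleton])
  qed
  moreover have "map (\<lambda>i. if i = 0 then fst w else snd w (i - 1)) [0..<m] = fst w # map (snd w) [0..<m - 1]" for w :: "'a \<times> (nat \<Rightarrow> 'a)"
    using kernelD(1)[OF h] by (intro nth_equalityI) (auto simp: nth_Cons')
  ultimately show ?thesis by (simp add: case_prod_beta')
qed

lemma measurable_Cons_kernel1:
  assumes h: "kernel M m C h" and x: "x \<in> space M"
  shows "(\<lambda>z. h (x # map z [0..<m - 1])) \<in> borel_measurable (PiM {..<m - 1} (\<lambda>_. M))"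
  using measurable_Pair2[OF measurable_Cons_kernel[OF h] x] by simp

lemma proj_measurable:
  assumes h: "kernel M m C h"
  shows "proj M m h \<in> borel_measurable M"
proof -
  interpret p: prob_space "PiM {..<m - 1} (\<lambda>_. M)" by (intro prob_space_PiM prob_space_axioms)
  show ?thesis
    unfolding proj_def[abs_def] by (rule p.borel_measurable_lebesgue_integral[OF measurable_Cons_kernel[OF h]])
qed

lemma proj_bounds:
  assumes h: "kernel M m C h"
  shows "0 \<le> proj M m h x" "proj M m h x \<le> C"
proof -
  interpret p: prob_space "PiM {..<m - 1} (\<lambda>_. M)" by (intro prob_space_PiM prob_space_axioms)
  show "0 \<le> proj M m h x"
    unfolding proj_def by (intro Bochner_Integration.integral_nonneg kernelD(3)[OF h])
  show "proj M m h x \<le> C"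
  proof (cases "integrable (PiM {..<m - 1} (\<lambda>_. M)) (\<lambda>z. h (x # map z [0..<m - 1]))")
    case True
    then show ?thesis unfolding proj_def by (rule p.integral_le_const) (auto simp: kernelD[OF h])
  next
    case False
    then show ?thesis unfolding proj_def by (simp add: not_integrable_integral_eq kernelD(7)[OF h])
  qed
qed

text \<open>Given the shared coordinate c, the other arguments of h and h' are independent, so the
  conditional expectation is the product of the two projections at that coordinate. Symmetry of the
  kernels allows the shared argument to be moved to the front.\<close>

theorem integral_overlap:
  fixes as bs :: "nat list"
  assumes h: "kernel M m C h" and h': "kernel M n C' h'"
    and as: "distinct as" "length as = m" and bs: "distinct bs" "length bs = n"
    and c: "set as \<inter> set bs = {c}" and J: "set as \<union> set bs \<subseteq> J"
  shows "(\<integral>z. h (map z as) * h' (map z bs) \<partial>PiM J (\<lambda>_. M)) = (\<integral>x. proj M m h x * proj M n h' x \<partial>M)"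
proof -
  interpret P: product_sigma_finite "\<lambda>_. M" by standard
  have mn: "m \<ge> 1" "n \<ge> 1" using kernelD(1) h h' by auto
  obtain a1 a2 where as_eq: "as = a1 @ c # a2" using c by (metis Int_iff insertI1 split_list)
  obtain b1 b2 where bs_eq: "bs = b1 @ c # b2" using c by (metis Int_iff insertI1 split_list)
  define as' bs' where "as' = a1 @ a2" and "bs' = b1 @ b2"
  have ms: "mset as = mset (c # as')" "mset bs = mset (c # bs')"
    by (simp_all add: as_eq bs_eq as'_def bs'_def)
  have len: "length as' = m - 1" "length bs' = n - 1"
    using as bs by (auto simp: as_eq bs_eq as'_def bs'_def)
  have dist: "distinct (c # as' @ bs')"
    using as bs c by (auto simp: as_eq bs_eq as'_def bs'_def)
  let ?N = "m + n - 1"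
  let ?A = "[1..<m]" and ?B = "[m..<?N]"
  have lens: "length (c # as' @ bs') = ?N" using len mn by simp
  \<comment> \<open>In the renamed coordinates, 0 is the shared one, 1 to m - 1 belong to h alone,
    and the remaining n - 1 to h' alone.\<close>
  define F where "F = (\<lambda>zs. h (hd zs # take (m - 1) (tl zs)) * h' (hd zs # drop (m - 1) (tl zs)))"
  have F_eq: "F (map z [0..<?N]) = h (z 0 # map z ?A) * h' (z 0 # map z ?B)" for z :: "nat \<Rightarrow> 'a"
  proof -
    have "[0..<?N] = 0 # ?A @ ?B"
      using mn by (intro nth_equalityI) (auto simp: nth_Cons' nth_append)
    then show ?thesis by (simp add: F_def)
  qed
  have sub: "set (0 # ?A) \<subseteq> {..<?N}" "set (0 # ?B) \<subseteq> {..<?N}" using mn by auto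
  have lAB: "length (0 # ?A) = m" "length (0 # ?B) = n" using mn by auto
  have mA: "(\<lambda>z. h (z 0 # map z ?A)) \<in> borel_measurable (PiM {..<?N} (\<lambda>_. M))"
    using measurable_map_list[of h "0 # ?A" M, unfolded lAB, OF kernelD(2)[OF h] sub(1)] by simp
  have mB: "(\<lambda>z. h' (z 0 # map z ?B)) \<in> borel_measurable (PiM {..<?N} (\<lambda>_. M))"
    using measurable_map_list[of h' "0 # ?B" M, unfolded lAB, OF kernelD(2)[OF h'] sub(2)] by simp
  have F_meas: "(\<lambda>z. F (map z [0..<?N])) \<in> borel_measurable (PiM {..<?N} (\<lambda>_. M))"
    unfolding F_eq by (intro borel_measurable_times mA mB)
  interpret pN: prob_space "PiM {..<?N} (\<lambda>_. M)" by (intro prob_space_PiM prob_space_axioms)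
  have F_int: "integrable (PiM {..<?N} (\<lambda>_. M)) (\<lambda>z. F (map z [0..<?N]))"
  proof (rule pN.integrable_const_bound[where B = "C * C'"])
    show "AE z in PiM {..<?N} (\<lambda>_. M). norm (F (map z [0..<?N])) \<le> C * C'"
      unfolding F_eq by (intro AE_I2) (auto simp: abs_mult kernelD[OF h] kernelD[OF h'] intro!: mult_mono)
  qed (rule F_meas)
  have "(\<integral>z. h (map z as) * h' (map z bs) \<partial>PiM J (\<lambda>_. M)) = (\<integral>z. F (map z (c # as' @ bs')) \<partial>PiM J (\<lambda>_. M))"
  proof (intro Bochner_Integration.integral_cong refl)
    fix z :: "nat \<Rightarrow> 'a"
    have "h (map z as) = h (z c # map z as')" "h' (map z bs) = h' (z c # map z bs')"
      using ms by (auto intro!: kernelD(6)[OF h] kernelD(6)[OF h'] simp: mset_map)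
    then show "h (map z as) * h' (map z bs) = F (map z (c # as' @ bs'))"
      by (simp add: F_def len)
  qed
  also have "\<dots> = (\<integral>z. F (map z [0..<?N]) \<partial>PiM {..<?N} (\<lambda>_. M))"
    using integral_PiM_list[of F "c # as' @ bs'" J] F_meas dist J ms[THEN mset_eq_setD]
    unfolding lens by auto
  also have "\<dots> = (\<integral>x. \<integral>y. F (map (merge {0} {1..<?N} (x, y)) [0..<?N]) \<partial>PiM {1..<?N} (\<lambda>_. M) \<partial>PiM {0::nat} (\<lambda>_. M))"
  proof -
    have "{0} \<union> {1..<?N} = {..<?N}" using mn by auto
    then show ?thesis using P.product_integral_fold[of "{0}" "{1..<?N}" "\<lambda>z. F (map z [0..<?N])"] F_int by simp
  qed
  also have "\<dots> = (\<integral>x. proj M m h (x 0) * proj M n h' (x 0) \<partial>PiM {0::nat} (\<lambda>_. M))"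
  proof (intro Bochner_Integration.integral_cong refl)
    fix x :: "nat \<Rightarrow> 'a" assume "x \<in> space (PiM {0::nat} (\<lambda>_. M))"
    then have x0: "x 0 \<in> space M" by (auto simp: space_PiM PiE_def Pi_def)
    have le: "m \<le> m + n - Suc 0" using mn by linarith
    have "(\<integral>y. F (map (merge {0} {1..<?N} (x, y)) [0..<?N]) \<partial>PiM {1..<?N} (\<lambda>_. M)) =
        (\<integral>y. h (x 0 # map y ?A) * h' (x 0 # map y ?B) \<partial>PiM {1..<?N} (\<lambda>_. M))"
      unfolding F_eq
      by (intro Bochner_Integration.integral_cong refl arg_cong2[where f="(*)"] arg_cong[where f=h] arg_cong[where f=h'] arg_cong2[where f="(#)"] map_cong)
        (use mn in \<open>auto simp: merge_def\<close>)
    also have "\<dots> = proj M m h (x 0) * proj M n h' (x 0)"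
      using integral_PiM_append[of "\<lambda>zs. h (x 0 # zs)" ?A "\<lambda>zs. h' (x 0 # zs)" ?B "{1..<?N}" C C']
        measurable_Cons_kernel1[OF h x0] measurable_Cons_kernel1[OF h' x0] mn le kernelD(5)[OF h] kernelD(5)[OF h']
      by (auto simp: proj_def)
    finally show "(\<integral>y. F (map (merge {0} {1..<?N} (x, y)) [0..<?N]) \<partial>PiM {1..<?N} (\<lambda>_. M)) = proj M m h (x 0) * proj M n h' (x 0)" .
  qed
  also have "\<dots> = (\<integral>x. proj M m h x * proj M n h' x \<partial>M)"
    by (rule P.product_integral_singleton) (intro borel_measurable_times proj_measurable[OF h] proj_measurable[OF h'])
  finally show ?thesis .
qed

theorem integral_disjoint:
  fixes as bs :: "nat list"
  assumes h: "kernel M m C h" and h': "kernel M n C' h'"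
    and as: "distinct (as @ bs)" "length as = m" "length bs = n" and J: "set as \<union> set bs \<subseteq> J"
  shows "(\<integral>z. h (map z as) * h' (map z bs) \<partial>PiM J (\<lambda>_. M)) = theta M m h * theta M n h'"
  using integral_PiM_append[of h as h' bs J C C'] kernelD(2,5)[OF h] kernelD(2,5)[OF h'] as J
  by (auto simp: theta_def)

end

text \<open>Turns a function of one point into a kernel. Setting it to 0 on lists of other lengths
  makes it symmetric there, where \<open>hd\<close> would depend on the order.\<close>

lemma kernel_order_one:
  assumes "g \<in> borel_measurable \<kappa>" "\<And>x. 0 \<le> g x" "\<And>x. g x \<le> C" "0 \<le> C"
  shows "kernel \<kappa> 1 C (\<lambda>xs. if length xs = 1 then g (hd xs) else 0)"
proof -
  have meas: "(\<lambda>z. g (z 0)) \<in> borel_measurable (PiM {..<1::nat} (\<lambda>_. \<kappa>))"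
    by (rule measurable_compose[OF _ assms(1)]) (simp add: measurable_component_singleton)
  have sym: "(if length xs = 1 then g (hd xs) else 0) = (if length ys = 1 then g (hd ys) else 0)"
    if "mset xs = mset ys" for xs ys
  proof (cases "length xs = 1")
    case True
    then obtain x where "xs = [x]" by (auto simp: length_Suc_conv)
    then show ?thesis using that by simp
  next
    case False
    then show ?thesis using mset_eq_length[OF that] by simp
  qed
  show ?thesis
    unfolding kernel_def
  proof (intro conjI allI impI)
    show "(\<lambda>z. if length (map z [0..<1]) = 1 then g (hd (map z [0..<1])) else 0) \<in> borel_measurable (PiM {..<1} (\<lambda>_. \<kappa>))"
      using meas by simp
    show "(if length xs = 1 then g (hd xs) else 0) = (if length ys = 1 then g (hd ys) else 0)"
      if "mset xs = mset ys" for xs ys using that by (rule sym)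
  qed (simp_all add: assms(2-4))
qed

lemma kernel_const_one: "kernel \<kappa> 1 1 (\<lambda>_. 1)"
  by (simp add: kernel_def)

context prob_space
begin

lemma proj_order_one: "proj M 1 (\<lambda>xs. if length xs = 1 then g (hd xs) else 0) x = g x"
proof -
  interpret p: prob_space "PiM {..<0::nat} (\<lambda>_. M)" by (intro prob_space_PiM prob_space_axioms)
  show ?thesis unfolding proj_def using p.prob_space by simp
qed

text \<open>An instance of \<open>integral_overlap\<close> with the constant kernel of order one,
  whose projection is 1.\<close>

lemma theta_eq_integral_proj:
  assumes h: "kernel M m C h"
  shows "theta M m h = (\<integral>x. proj M m h x \<partial>M)"
proof -
  interpret p: prob_space "PiM {..<0::nat} (\<lambda>_. M)" by (intro prob_space_PiM prob_space_axioms)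
  have "proj M 1 (\<lambda>_. 1) = (\<lambda>_. 1)" unfolding proj_def[abs_def] using p.prob_space by simp
  then show ?thesis
    using integral_overlap[OF h kernel_const_one, of "[0..<m]" "[0]" 0 "{..<m}"] kernelD(1)[OF h]
    by (auto simp: theta_def atLeast0LessThan)
qed

end

section \<open>Second moments and linearization of Poisson U-statistics\<close>

text \<open>The constant in \<open>card_moment\<close>: for \<mu> \<ge> 1 the k-th moment of the
  number of window points is at most this constant times \<mu>^k, the additive term of
  \<open>power_le_falling\<close> being absorbed by \<mu>^k \<ge> 1.\<close>

definition card_const :: "nat \<Rightarrow> real" where
  "card_const k = (2 * real k) ^ k + 2 ^ k"

text \<open>Ordinary powers are compared with falling factorials, whose expectations are explicit.
  If N > 2 k, every factor of the falling factorial exceeds N / 2; otherwise N^k is bounded by a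
  constant.\<close>

lemma power_le_falling:
  assumes "finite S"
  shows "real (card S) ^ k \<le> (2 * real k) ^ k + 2 ^ k * real (card (dlists k S))"
proof (cases "card S \<le> 2 * k")
  case True
  then have "real (card S) ^ k \<le> (2 * real k) ^ k" by (intro power_mono) linarith+
  then show ?thesis by (simp add: add_increasing2)
next
  case False
  let ?N = "card S"
  have "card (dlists k S) = \<Prod>{?N - k + 1..?N}"
    using card_lists_distinct_length_eq[OF assms, of k] False by (simp add: dlists_def)
  then have "real (card (dlists k S)) = (\<Prod>i\<in>{?N - k + 1..?N}. real i)" by simp
  moreover have "(\<Prod>i\<in>{?N - k + 1..?N}. real ?N / 2) \<le> (\<Prod>i\<in>{?N - k + 1..?N}. real i)"
    using False by (intro prod_mono) auto
  moreover have "card {?N - k + 1..?N} = k" using False by simp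
  ultimately have "(real ?N / 2) ^ k \<le> real (card (dlists k S))" by simp
  then have "real ?N ^ k \<le> 2 ^ k * real (card (dlists k S))"
    by (simp add: power_divide field_simps)
  then show ?thesis by (simp add: add_increasing)
qed

text \<open>The cancellation behind \<open>usum_linear_approximation\<close>, with x = \<mu>^(m - 1)
  and a = m: all terms in \<theta>^2 and in \<gamma> drop out, and only the error terms of order x^2
  survive.\<close>

lemma linear_approximation_identity:
  fixes x \<mu> \<theta> \<gamma> a C c d :: real
  shows "(x * x * \<mu> * \<mu> * \<theta>\<^sup>2 + a\<^sup>2 * (x * x * \<mu>) * \<gamma> + C\<^sup>2 * a ^ 4 * c * (x * x)) +
      (a * x)\<^sup>2 * (\<mu>\<^sup>2 * \<theta>\<^sup>2 + \<mu> * \<gamma> + C\<^sup>2 * d) - 2 * (a * x) * (x * \<mu> * \<mu> * \<theta>\<^sup>2 + a * (x * \<mu>) * \<gamma>) +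
      2 * ((a - 1) * (x * \<mu>) * \<theta>) * (x * \<mu> * \<theta>) - 2 * (a * x) * ((a - 1) * (x * \<mu>) * \<theta>) * (\<mu> * \<theta>) +
      ((a - 1) * (x * \<mu>) * \<theta>)\<^sup>2 = C\<^sup>2 * (a ^ 4 * c + a\<^sup>2 * d) * (x * x)"
  by (simp add: power2_eq_square algebra_simps)

context poisson_on
begin

lemma usum_kernel:
  assumes h: "kernel \<kappa> m C h"
  shows "usum m h \<in> borel_measurable M" "integrable M (usum m h)"
    "(\<integral>w. usum m h w \<partial>M) = \<mu> ^ m * theta \<kappa> m h"
  using campbell[OF kernelD(2)[OF h], of C] kernelD(5)[OF h] by (simp_all add: theta_def)

lemma usum_const: "usum k (\<lambda>_. 1::real) w = (if finite (idx W w) then real (card (dlists k (idx W w))) else 0)"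
  by (simp add: usum_def)

lemma card_moment:
  assumes "\<mu> \<ge> 1"
  shows "integrable M (\<lambda>w. real (card (idx W w)) ^ k)" "(\<integral>w. real (card (idx W w)) ^ k \<partial>M) \<le> card_const k * \<mu> ^ k"
proof -
  interpret p: prob_space "PiM {..<k} (\<lambda>_. \<kappa>)" by (intro prob_space_PiM K.prob_space_axioms)
  have c: "usum k (\<lambda>_. 1::real) \<in> borel_measurable M" "integrable M (usum k (\<lambda>_. 1::real))"
    "(\<integral>w. usum k (\<lambda>_. 1::real) w \<partial>M) = \<mu> ^ k"
    using campbell[of "\<lambda>_. 1::real" k 1] p.prob_space by simp_all
  have "real (card (idx W w)) = usum 1 (\<lambda>_. 1::real) w" for w
    using usum_one[of w "\<lambda>_. 1::real"] by (cases "finite (idx W w)") (auto simp: usum_def)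
  moreover have "usum 1 (\<lambda>_. 1::real) \<in> borel_measurable M"
    using campbell(1)[of "\<lambda>_. 1::real" 1 1] by simp
  ultimately have [measurable]: "(\<lambda>w. real (card (idx W w))) \<in> borel_measurable M"
    by (simp cong: measurable_cong)
  let ?b = "\<lambda>w. (2 * real k) ^ k + 2 ^ k * usum k (\<lambda>_. 1::real) w"
  have b_int: "integrable M ?b" using c by auto
  have le: "real (card (idx W w)) ^ k \<le> ?b w" for w
  proof (cases "finite (idx W w)")
    case True
    then show ?thesis using power_le_falling[OF True, of k] by (simp add: usum_const)
  next
    case False
    then show ?thesis by (auto simp: usum_const power_0_left)
  qed
  show int: "integrable M (\<lambda>w. real (card (idx W w)) ^ k)"
  proof (rule Bochner_Integration.integrable_bound[OF b_int])
    show "AE w in M. norm (real (card (idx W w)) ^ k) \<le> norm (?b w)"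
    proof (intro AE_I2)
      fix w show "norm (real (card (idx W w)) ^ k) \<le> norm (?b w)"
        using le[of w] order_trans[OF le[of w] abs_ge_self] by simp
    qed
  qed measurable
  have "(\<integral>w. real (card (idx W w)) ^ k \<partial>M) \<le> (\<integral>w. ?b w \<partial>M)"
    using int b_int le by (intro integral_mono) auto
  also have "\<dots> = (2 * real k) ^ k + 2 ^ k * \<mu> ^ k"
    using c by (simp add: M.prob_space)
  also have "\<dots> \<le> (2 * real k) ^ k * \<mu> ^ k + 2 ^ k * \<mu> ^ k"
    using mult_left_mono[OF one_le_power[OF assms, of k], of "(2 * real k) ^ k"] by simp
  finally show "(\<integral>w. real (card (idx W w)) ^ k \<partial>M) \<le> card_const k * \<mu> ^ k"
    by (simp add: card_const_def algebra_simps)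
qed

text \<open>The expectation of \<open>dlists_product_split\<close>: the disjoint pairs give the
  product of the means by \<open>integral_disjoint\<close>, each of the m n ways to share one point
  gives the same integral by \<open>integral_overlap\<close>, and the rest is a moment of the number
  of points. Nonnegativity of the kernels yields the lower bound.\<close>

theorem usum_product:
  assumes h: "kernel \<kappa> m C h" and h': "kernel \<kappa> n C' h'" and mu: "\<mu> \<ge> 1"
  defines "main \<equiv> \<mu> ^ (m + n) * theta \<kappa> m h * theta \<kappa> n h' +
      real m * real n * \<mu> ^ (m + n - 1) * (\<integral>x. proj \<kappa> m h x * proj \<kappa> n h' x \<partial>\<kappa>)"
  shows "integrable M (\<lambda>w. usum m h w * usum n h' w)"
    "main \<le> (\<integral>w. usum m h w * usum n h' w \<partial>M)"
    "(\<integral>w. usum m h w * usum n h' w \<partial>M) \<le> main + C * C' * ((real m)\<^sup>2 * (real n)\<^sup>2) * card_const (m + n - 2) * \<mu> ^ (m + n - 2)"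
proof -
  note [measurable] = usum_kernel(1)[OF h] usum_kernel(1)[OF h']
  have mn: "m \<ge> 1" "n \<ge> 1" using kernelD(1) h h' by auto
  have CC: "0 \<le> C" "0 \<le> C'" using kernelD(7) h h' by auto
  define HD where "HD = (\<lambda>L. h (take m L) * h' (drop m L))"
  define HO where "HO = (\<lambda>p q L. h (take m L) * h' (insert_at q (L ! p) (drop m L)))"
  have HD_eq: "HD (map z [0..<m + n]) = h (map z [0..<m]) * h' (map z [m..<m + n])" for z
    by (simp add: HD_def take_map drop_map)
  have HO_eq: "HO p q (map z [0..<m + n - 1]) = h (map z [0..<m]) * h' (map z (insert_at q p [m..<m + n - 1]))"
    if "p < m" for z p q
    using mn that by (simp add: HO_def take_map drop_map map_insert_at)
  have bound: "\<bar>h xs * h' ys\<bar> \<le> C * C'" for xs ys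
    unfolding abs_mult by (rule mult_mono[OF kernelD(5)[OF h] kernelD(5)[OF h'] CC(1) abs_ge_zero])
  have h_meas: "(\<lambda>z. h (map z xs)) \<in> borel_measurable (PiM J (\<lambda>_. \<kappa>))" if "length xs = m" "set xs \<subseteq> J" for xs J
    using measurable_map_list[of h xs \<kappa> J] kernelD(2)[OF h] that by simp
  have h'_meas: "(\<lambda>z. h' (map z xs)) \<in> borel_measurable (PiM J (\<lambda>_. \<kappa>))" if "length xs = n" "set xs \<subseteq> J" for xs J
    using measurable_map_list[of h' xs \<kappa> J] kernelD(2)[OF h'] that by simp
  have HD: "integrable M (usum (m + n) HD)"
    "(\<integral>w. usum (m + n) HD w \<partial>M) = \<mu> ^ (m + n) * theta \<kappa> m h * theta \<kappa> n h'"
  proof -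
    have meas: "(\<lambda>z. HD (map z [0..<m + n])) \<in> borel_measurable (PiM {..<m + n} (\<lambda>_. \<kappa>))"
      unfolding HD_eq by (intro borel_measurable_times h_meas h'_meas) auto
    have b: "norm (HD xs) \<le> C * C'" for xs unfolding HD_def using bound by simp
    show "integrable M (usum (m + n) HD)"
      by (rule usum_integrable[OF meas b])
    have "(\<integral>w. usum (m + n) HD w \<partial>M) = \<mu> ^ (m + n) *\<^sub>R (\<integral>z. HD (map z [0..<m + n]) \<partial>PiM {..<m + n} (\<lambda>_. \<kappa>))"
      by (rule usum_integral[OF meas b])
    also have "(\<integral>z. HD (map z [0..<m + n]) \<partial>PiM {..<m + n} (\<lambda>_. \<kappa>)) = theta \<kappa> m h * theta \<kappa> n h'"
      unfolding HD_eq by (rule K.integral_disjoint[OF h h']) auto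
    finally show "(\<integral>w. usum (m + n) HD w \<partial>M) = \<mu> ^ (m + n) * theta \<kappa> m h * theta \<kappa> n h'" by simp
  qed
  have HO: "integrable M (usum (m + n - 1) (HO p q))"
    "(\<integral>w. usum (m + n - 1) (HO p q) w \<partial>M) = \<mu> ^ (m + n - 1) * (\<integral>x. proj \<kappa> m h x * proj \<kappa> n h' x \<partial>\<kappa>)"
    if "p < m" "q < n" for p q
  proof -
    have len: "length (insert_at q p [m..<m + n - 1]) = n" using mn by simp
    have meas: "(\<lambda>z. HO p q (map z [0..<m + n - 1])) \<in> borel_measurable (PiM {..<m + n - 1} (\<lambda>_. \<kappa>))"
      unfolding HO_eq[OF that(1)] using that mn len
      by (intro borel_measurable_times h_meas h'_meas) auto
    have b: "norm (HO p q xs) \<le> C * C'" for xs unfolding HO_def using bound by simp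
    show "integrable M (usum (m + n - 1) (HO p q))"
      by (rule usum_integrable[OF meas b])
    have "(\<integral>w. usum (m + n - 1) (HO p q) w \<partial>M) = \<mu> ^ (m + n - 1) *\<^sub>R (\<integral>z. HO p q (map z [0..<m + n - 1]) \<partial>PiM {..<m + n - 1} (\<lambda>_. \<kappa>))"
      by (rule usum_integral[OF meas b])
    also have "(\<integral>z. HO p q (map z [0..<m + n - 1]) \<partial>PiM {..<m + n - 1} (\<lambda>_. \<kappa>)) = (\<integral>x. proj \<kappa> m h x * proj \<kappa> n h' x \<partial>\<kappa>)"
      unfolding HO_eq[OF that(1)] using that mn len
      by (intro K.integral_overlap[OF h h', where c = p]) auto
    finally show "(\<integral>w. usum (m + n - 1) (HO p q) w \<partial>M) = \<mu> ^ (m + n - 1) * (\<integral>x. proj \<kappa> m h x * proj \<kappa> n h' x \<partial>\<kappa>)" by simp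
  qed
  \<comment> \<open>Pointwise, the product lies between \<open>low\<close> and
    \<open>low + err\<close>, and the expectation of \<open>low\<close> is exactly
    \<open>main\<close>.\<close>
  define low where "low = (\<lambda>w. usum (m + n) HD w + (\<Sum>p<m. \<Sum>q<n. usum (m + n - 1) (HO p q) w))"
  define err where "err = (\<lambda>w. C * C' * ((real m)\<^sup>2 * (real n)\<^sup>2) * real (card (idx W w)) ^ (m + n - 2))"
  have low_int: "integrable M low" unfolding low_def by (intro Bochner_Integration.integrable_add Bochner_Integration.integrable_sum HD HO) auto
  have err_int: "integrable M err" unfolding err_def by (intro integrable_mult_right card_moment mu)
  have low_val: "(\<integral>w. low w \<partial>M) = main"
  proof -
    have "integrable M (\<lambda>w. \<Sum>p<m. \<Sum>q<n. usum (m + n - 1) (HO p q) w)"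
      by (intro Bochner_Integration.integrable_sum HO) auto
    then have "(\<integral>w. low w \<partial>M) = (\<integral>w. usum (m + n) HD w \<partial>M) +
        (\<integral>w. (\<Sum>p<m. \<Sum>q<n. usum (m + n - 1) (HO p q) w) \<partial>M)"
      unfolding low_def by (rule Bochner_Integration.integral_add[OF HD(1)])
    also have "(\<integral>w. (\<Sum>p<m. \<Sum>q<n. usum (m + n - 1) (HO p q) w) \<partial>M) = (\<Sum>p<m. \<integral>w. (\<Sum>q<n. usum (m + n - 1) (HO p q) w) \<partial>M)"
      by (intro Bochner_Integration.integral_sum Bochner_Integration.integrable_sum HO) auto
    also have "\<dots> = (\<Sum>p<m. \<Sum>q<n. \<integral>w. usum (m + n - 1) (HO p q) w \<partial>M)"
      by (intro sum.cong refl Bochner_Integration.integral_sum HO) auto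
    also have "\<dots> =
        (\<Sum>p<m. \<Sum>q<n. \<mu> ^ (m + n - 1) * (\<integral>x. proj \<kappa> m h x * proj \<kappa> n h' x \<partial>\<kappa>))"
      by (intro sum.cong refl HO(2)) auto
    finally show ?thesis by (simp add: HD main_def)
  qed
  have err_val: "(\<integral>w. err w \<partial>M) \<le> C * C' * ((real m)\<^sup>2 * (real n)\<^sup>2) * (card_const (m + n - 2) * \<mu> ^ (m + n - 2))"
    unfolding err_def using CC card_moment[OF mu, of "m + n - 2"] by (simp add: mult_left_mono)
  have pt: "low w \<le> usum m h w * usum n h' w \<and> usum m h w * usum n h' w \<le> low w + err w" for w
  proof (cases "finite (idx W w)")
    case True
    have map_nth': "map (\<lambda>i. Y i w) L ! p = Y (L ! p) w" if "L \<in> dlists (m + n - 1) (idx W w)" "p < m" for L p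
      using that mn by (simp add: dlists_def)
    have E: "(\<Sum>p<m. \<Sum>q<n. usum (m + n - 1) (HO p q) w) = (\<Sum>p<m. \<Sum>q<n. \<Sum>L\<in>dlists (m + n - 1) (idx W w).
        h (map (\<lambda>i. Y i w) (take m L)) * h' (map (\<lambda>i. Y i w) (insert_at q (L ! p) (drop m L))))"
      using True by (intro sum.cong refl) (simp add: usum_def HO_def take_map drop_map map_insert_at map_nth' cong: sum.cong)
    have D: "usum (m + n) HD w = (\<Sum>L\<in>dlists (m + n) (idx W w).
        h (map (\<lambda>i. Y i w) (take m L)) * h' (map (\<lambda>i. Y i w) (drop m L)))"
      using True by (simp add: usum_def HD_def take_map drop_map)
    have T: "usum m h w * usum n h' w =
        (\<Sum>I\<in>dlists m (idx W w). h (map (\<lambda>i. Y i w) I)) * (\<Sum>J\<in>dlists n (idx W w). h' (map (\<lambda>i. Y i w) J))"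
      using True by (simp add: usum_def)
    show ?thesis
      unfolding low_def err_def E D T
      using dlists_product_split[OF True mn, of "\<lambda>I. h (map (\<lambda>i. Y i w) I)" C C' "\<lambda>J. h' (map (\<lambda>i. Y i w) J)"]
        kernelD(3,4)[OF h] kernelD(3,4)[OF h'] CC by (auto simp: of_nat_power)
  next
    case False
    then show ?thesis using CC by (auto simp: low_def err_def usum_def)
  qed
  show int: "integrable M (\<lambda>w. usum m h w * usum n h' w)"
  proof (rule Bochner_Integration.integrable_bound[where f="\<lambda>w. \<bar>low w\<bar> + \<bar>err w\<bar>"])
    show "integrable M (\<lambda>w. \<bar>low w\<bar> + \<bar>err w\<bar>)" using low_int err_int by auto
    show "AE w in M. norm (usum m h w * usum n h' w) \<le> norm (\<bar>low w\<bar> + \<bar>err w\<bar>)"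
    proof (intro AE_I2)
      fix w show "norm (usum m h w * usum n h' w) \<le> norm (\<bar>low w\<bar> + \<bar>err w\<bar>)"
        using pt[of w] unfolding real_norm_def by linarith
    qed
  qed measurable
  show "main \<le> (\<integral>w. usum m h w * usum n h' w \<partial>M)"
    unfolding low_val[symmetric] using low_int int pt by (intro integral_mono) auto
  have "(\<integral>w. usum m h w * usum n h' w \<partial>M) \<le> (\<integral>w. low w + err w \<partial>M)"
    using low_int err_int int pt by (intro integral_mono) auto
  then show "(\<integral>w. usum m h w * usum n h' w \<partial>M) \<le> main + C * C' * ((real m)\<^sup>2 * (real n)\<^sup>2) * card_const (m + n - 2) * \<mu> ^ (m + n - 2)"
    using low_int err_int low_val err_val by (simp add: mult.assoc)
qed

text \<open>Expanding the square requires E A^2, E A B and E B^2. By \<open>usum_product\<close>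
  their terms of the two leading orders are explicit and cancel: A and its linear part have the same
  covariance m \<mu>^m \<gamma> with B, up to scaling. What remains has order \<mu>^(2 m -
  2).\<close>

theorem usum_linear_approximation:
  assumes h: "kernel \<kappa> m C h" and mu: "\<mu> \<ge> 1"
  defines "A \<equiv> usum m h" and "B \<equiv> usum 1 (\<lambda>xs. if length xs = 1 then proj \<kappa> m h (hd xs) else 0)"
    and "\<theta> \<equiv> theta \<kappa> m h"
  shows "integrable M B" "integrable M (\<lambda>w. (A w - \<mu> ^ m * \<theta> - real m * \<mu> ^ (m - 1) * (B w - \<mu> * \<theta>))\<^sup>2)"
    "(\<integral>w. (A w - \<mu> ^ m * \<theta> - real m * \<mu> ^ (m - 1) * (B w - \<mu> * \<theta>))\<^sup>2 \<partial>M) \<le>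
      C\<^sup>2 * (real m ^ 4 * card_const (2 * m - 2) + (real m)\<^sup>2 * card_const 0) * \<mu> ^ (2 * m - 2)"
    "integrable M (\<lambda>w. (B w - \<mu> * \<theta>)\<^sup>2)"
    "(\<integral>w. (B w - \<mu> * \<theta>)\<^sup>2 \<partial>M) \<le> C\<^sup>2 * (\<mu> + card_const 0)"
proof -
  let ?g1 = "\<lambda>xs. if length xs = 1 then proj \<kappa> m h (hd xs) else 0"
  have C0: "0 \<le> C" by (rule kernelD(7)[OF h])
  have m1: "m \<ge> 1" by (rule kernelD(1)[OF h])
  have g: "kernel \<kappa> 1 C ?g1"
    by (intro kernel_order_one K.proj_measurable[OF h] K.proj_bounds[OF h] C0)
  define \<gamma> where "\<gamma> = (\<integral>x. proj \<kappa> m h x * proj \<kappa> m h x \<partial>\<kappa>)"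
  have th: "theta \<kappa> 1 ?g1 = \<theta>"
    unfolding \<theta>_def K.theta_eq_integral_proj[OF h] K.theta_eq_integral_proj[OF g] K.proj_order_one ..
  have A: "integrable M A" "(\<integral>w. A w \<partial>M) = \<mu> ^ m * \<theta>"
    unfolding A_def \<theta>_def by (rule usum_kernel[OF h])+
  show B_int: "integrable M B"
    unfolding B_def by (rule usum_kernel[OF g])
  have B: "(\<integral>w. B w \<partial>M) = \<mu> * \<theta>"
    using usum_kernel(3)[OF g] unfolding th B_def by simp
  have AA: "integrable M (\<lambda>w. A w * A w)"
    "(\<integral>w. A w * A w \<partial>M) \<le> \<mu> ^ (2 * m) * \<theta>\<^sup>2 + (real m)\<^sup>2 * \<mu> ^ (2 * m - 1) * \<gamma> + C\<^sup>2 * real m ^ 4 * card_const (2 * m - 2) * \<mu> ^ (2 * m - 2)"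
    using usum_product[OF h h mu] unfolding A_def \<theta>_def \<gamma>_def
    by (simp_all add: power2_eq_square mult_2 mult_ac eval_nat_numeral)
  \<comment> \<open>A lower bound suffices, since A B enters the expanded square with a negative
    coefficient; the two squares need upper bounds.\<close>
  have AB: "integrable M (\<lambda>w. A w * B w)" "\<mu> ^ (m + 1) * \<theta>\<^sup>2 + real m * \<mu> ^ m * \<gamma> \<le> (\<integral>w. A w * B w \<partial>M)"
    using usum_product(1,2)[OF h g mu] unfolding A_def B_def th \<gamma>_def K.proj_order_one
    by (simp_all add: power2_eq_square \<theta>_def mult_ac)
  have BB: "integrable M (\<lambda>w. B w * B w)" "(\<integral>w. B w * B w \<partial>M) \<le> \<mu>\<^sup>2 * \<theta>\<^sup>2 + \<mu> * \<gamma> + C\<^sup>2 * card_const 0"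
    using usum_product(1,3)[OF g g mu] unfolding B_def th \<gamma>_def K.proj_order_one
    by (simp_all add: power2_eq_square mult_ac)
  have \<gamma>_le: "\<gamma> \<le> C\<^sup>2"
  proof -
    have pm[measurable]: "proj \<kappa> m h \<in> borel_measurable \<kappa>" by (rule K.proj_measurable[OF h])
    have b: "proj \<kappa> m h x * proj \<kappa> m h x \<le> C\<^sup>2" "\<bar>proj \<kappa> m h x * proj \<kappa> m h x\<bar> \<le> C\<^sup>2" for x
      using K.proj_bounds[OF h, of x] C0 by (auto simp: power2_eq_square abs_mult intro!: mult_mono)
    then show ?thesis
      unfolding \<gamma>_def by (intro K.integral_le_const K.integrable_const_bound[where B = "C\<^sup>2"]) auto
  qed
  obtain p where p: "m = Suc p" using m1 by (metis Suc_le_D One_nat_def)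
  have expand: "(A w - \<mu> ^ m * \<theta> - real m * \<mu> ^ (m - 1) * (B w - \<mu> * \<theta>))\<^sup>2 =
      A w * A w + (real m * \<mu> ^ (m - 1))\<^sup>2 * (B w * B w) - 2 * (real m * \<mu> ^ (m - 1)) * (A w * B w) +
      2 * ((real m - 1) * \<mu> ^ m * \<theta>) * A w - 2 * (real m * \<mu> ^ (m - 1)) * ((real m - 1) * \<mu> ^ m * \<theta>) * B w +
      ((real m - 1) * \<mu> ^ m * \<theta>)\<^sup>2" for w
    unfolding p by (simp add: power2_eq_square algebra_simps)
  show "integrable M (\<lambda>w. (A w - \<mu> ^ m * \<theta> - real m * \<mu> ^ (m - 1) * (B w - \<mu> * \<theta>))\<^sup>2)"
    unfolding expand using A(1) B_int AA(1) AB(1) BB(1) by auto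
  have "(\<integral>w. (A w - \<mu> ^ m * \<theta> - real m * \<mu> ^ (m - 1) * (B w - \<mu> * \<theta>))\<^sup>2 \<partial>M) =
      (\<integral>w. A w * A w \<partial>M) + (real m * \<mu> ^ (m - 1))\<^sup>2 * (\<integral>w. B w * B w \<partial>M) - 2 * (real m * \<mu> ^ (m - 1)) * (\<integral>w. A w * B w \<partial>M) +
      2 * ((real m - 1) * \<mu> ^ m * \<theta>) * (\<mu> ^ m * \<theta>) - 2 * (real m * \<mu> ^ (m - 1)) * ((real m - 1) * \<mu> ^ m * \<theta>) * (\<mu> * \<theta>) +
      ((real m - 1) * \<mu> ^ m * \<theta>)\<^sup>2"
    unfolding expand using A B_int B AA(1) AB(1) BB(1) by (simp add: M.prob_space)
  also have "\<dots> \<le> (\<mu> ^ (2 * m) * \<theta>\<^sup>2 + (real m)\<^sup>2 * \<mu> ^ (2 * m - 1) * \<gamma> + C\<^sup>2 * real m ^ 4 * card_const (2 * m - 2) * \<mu> ^ (2 * m - 2)) +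
      (real m * \<mu> ^ (m - 1))\<^sup>2 * (\<mu>\<^sup>2 * \<theta>\<^sup>2 + \<mu> * \<gamma> + C\<^sup>2 * card_const 0) - 2 * (real m * \<mu> ^ (m - 1)) * (\<mu> ^ (m + 1) * \<theta>\<^sup>2 + real m * \<mu> ^ m * \<gamma>) +
      2 * ((real m - 1) * \<mu> ^ m * \<theta>) * (\<mu> ^ m * \<theta>) - 2 * (real m * \<mu> ^ (m - 1)) * ((real m - 1) * \<mu> ^ m * \<theta>) * (\<mu> * \<theta>) +
      ((real m - 1) * \<mu> ^ m * \<theta>)\<^sup>2"
    using AA(2) AB(2) BB(2) mu_nonneg
    by (intro add_mono diff_mono mult_left_mono order_refl) auto
  also have "\<dots> = C\<^sup>2 * (real m ^ 4 * card_const (2 * m - 2) + (real m)\<^sup>2 * card_const 0) * \<mu> ^ (2 * m - 2)"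
  proof -
    define x where "x = \<mu> ^ p"
    have pw: "\<mu> ^ (2 * m) = x * x * \<mu> * \<mu>" "\<mu> ^ (2 * m - 1) = x * x * \<mu>" "\<mu> ^ (2 * m - 2) = x * x"
      "\<mu> ^ m = x * \<mu>" "\<mu> ^ (m - 1) = x" "\<mu> ^ (m + 1) = x * \<mu> * \<mu>"
      by (simp_all add: x_def p mult_2 power_add)
    show ?thesis
      unfolding pw by (rule linear_approximation_identity)
  qed
  finally show "(\<integral>w. (A w - \<mu> ^ m * \<theta> - real m * \<mu> ^ (m - 1) * (B w - \<mu> * \<theta>))\<^sup>2 \<partial>M) \<le>
      C\<^sup>2 * (real m ^ 4 * card_const (2 * m - 2) + (real m)\<^sup>2 * card_const 0) * \<mu> ^ (2 * m - 2)" .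
  have expand2: "(B w - \<mu> * \<theta>)\<^sup>2 = B w * B w - 2 * (\<mu> * \<theta>) * B w + (\<mu> * \<theta>)\<^sup>2" for w
    by (simp add: power2_eq_square algebra_simps)
  show "integrable M (\<lambda>w. (B w - \<mu> * \<theta>)\<^sup>2)"
    unfolding expand2 using B_int BB(1) by auto
  have "(\<integral>w. (B w - \<mu> * \<theta>)\<^sup>2 \<partial>M) = (\<integral>w. B w * B w \<partial>M) - (\<mu> * \<theta>)\<^sup>2"
    unfolding expand2 using B_int B BB(1) by (simp add: M.prob_space power2_eq_square)
  also have "\<dots> \<le> \<mu> * \<gamma> + C\<^sup>2 * card_const 0"
    using BB(2) by (simp add: power_mult_distrib)
  also have "\<dots> \<le> \<mu> * C\<^sup>2 + C\<^sup>2 * card_const 0"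
    using \<gamma>_le mu_nonneg by (simp add: mult_left_mono)
  finally show "(\<integral>w. (B w - \<mu> * \<theta>)\<^sup>2 \<partial>M) \<le> C\<^sup>2 * (\<mu> + card_const 0)"
    by (simp add: algebra_simps)
qed

end

text \<open>A weighted inequality of arithmetic and geometric means. With
  \<open>s = sqrt \<mu>\<close> it turns an L2 error of order 1 / \<mu> in the square into an L1
  error of order 1 / sqrt \<mu>.\<close>

lemma abs_le_of_square: "\<bar>x\<bar> \<le> (x\<^sup>2 * s + 1 / s) / 2" if "s > 0" for x s :: real
proof -
  have "0 \<le> (\<bar>x\<bar> * s - 1)\<^sup>2" by simp
  then have "2 * \<bar>x\<bar> * s \<le> x\<^sup>2 * s\<^sup>2 + 1" by (simp add: power2_eq_square algebra_simps)
  then show ?thesis using that by (simp add: field_simps power2_eq_square)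
qed

definition remainder_const :: "nat \<Rightarrow> real \<Rightarrow> real" where
  "remainder_const m C = C\<^sup>2 * (real m ^ 4 * card_const (2 * m - 2) + (real m)\<^sup>2 * card_const 0)"

lemma card_const_nonneg: "0 \<le> card_const k"
  by (simp add: card_const_def)

lemma remainder_const_nonneg: "0 \<le> remainder_const m C"
  by (simp add: remainder_const_def card_const_nonneg)

context poisson_on
begin

definition linear_part :: "nat \<Rightarrow> ('b list \<Rightarrow> real) \<Rightarrow> 'w \<Rightarrow> real" where
  "linear_part m h w = (usum 1 (\<lambda>xs. if length xs = 1 then proj \<kappa> m h (hd xs) else 0) w - \<mu> * theta \<kappa> m h) / sqrt \<mu>"

text \<open>The divisor \<open>real m * \<mu> ^ (m - 1)\<close> is the coefficient of the linear
  part and \<open>sqrt \<mu>\<close> its order of fluctuation, so that \<open>linear_part\<close> is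
  the direct approximation of \<open>normalized\<close>.\<close>

definition normalized :: "nat \<Rightarrow> ('b list \<Rightarrow> real) \<Rightarrow> 'w \<Rightarrow> real" where
  "normalized m h w = (usum m h w - \<mu> ^ m * theta \<kappa> m h) / (real m * \<mu> ^ (m - 1) * sqrt \<mu>)"

lemma normalized_measurable:
  assumes h: "kernel \<kappa> m C h"
  shows "normalized m h \<in> borel_measurable M" "linear_part m h \<in> borel_measurable M"
proof -
  have g: "kernel \<kappa> 1 C (\<lambda>xs. if length xs = 1 then proj \<kappa> m h (hd xs) else 0)"
    by (intro kernel_order_one K.proj_measurable[OF h] K.proj_bounds[OF h] kernelD(7)[OF h])
  note [measurable] = usum_kernel(1)[OF h] usum_kernel(1)[OF g]
  show "normalized m h \<in> borel_measurable M" "linear_part m h \<in> borel_measurable M"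
    unfolding normalized_def[abs_def] linear_part_def[abs_def] by measurable
qed

text \<open>\<open>usum_linear_approximation\<close> divided by m^2 \<mu>^(2 m - 1). The first
  absolute moment serves the comparison of cosines; the uniform bound on the second moment serves
  tightness.\<close>

lemma normalized_approximation:
  assumes h: "kernel \<kappa> m C h" and mu: "\<mu> \<ge> 1"
  shows "integrable M (\<lambda>w. (normalized m h w - linear_part m h w)\<^sup>2)"
    "(\<integral>w. (normalized m h w - linear_part m h w)\<^sup>2 \<partial>M) \<le> remainder_const m C / \<mu>"
    "integrable M (\<lambda>w. \<bar>normalized m h w - linear_part m h w\<bar>)"
    "(\<integral>w. \<bar>normalized m h w - linear_part m h w\<bar> \<partial>M) \<le> (remainder_const m C + 1) / (2 * sqrt \<mu>)"
    "integrable M (\<lambda>w. (normalized m h w)\<^sup>2)"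
    "(\<integral>w. (normalized m h w)\<^sup>2 \<partial>M) \<le> 2 * (C\<^sup>2 * (1 + card_const 0) + remainder_const m C)"
proof -
  note [measurable] = normalized_measurable[OF h]
  note lin = usum_linear_approximation[OF h mu]
  define D where "D = (\<lambda>w. usum m h w - \<mu> ^ m * theta \<kappa> m h - real m * \<mu> ^ (m - 1) *
    (usum 1 (\<lambda>xs. if length xs = 1 then proj \<kappa> m h (hd xs) else 0) w - \<mu> * theta \<kappa> m h))"
  define a where "a = real m * \<mu> ^ (m - 1)"
  have m1: "m \<ge> 1" by (rule kernelD(1)[OF h])
  have a0: "a > 0" using m1 mu by (simp add: a_def)
  have s0: "sqrt \<mu> > 0" "\<mu> > 0" using mu by auto
  have a2: "a\<^sup>2 = (real m)\<^sup>2 * \<mu> ^ (2 * m - 2)"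
  proof -
    have "2 * m - 2 = (m - 1) * 2" by simp
    then have "\<mu> ^ (2 * m - 2) = (\<mu> ^ (m - 1))\<^sup>2" by (simp only: power_mult)
    then show ?thesis by (simp only: a_def power_mult_distrib)
  qed
  have gen: "u / (a * s) - v / s = (u - a * v) / (a * s)" if "s > 0" for u v s :: real
    using a0 that by (simp add: diff_divide_distrib)
  have diff: "normalized m h w - linear_part m h w = D w / (a * sqrt \<mu>)" for w
    unfolding normalized_def linear_part_def D_def a_def[symmetric] by (rule gen[OF s0(1)])
  have sq: "(normalized m h w - linear_part m h w)\<^sup>2 = (D w)\<^sup>2 / (a\<^sup>2 * \<mu>)" for w
    unfolding diff using s0 by (simp add: power_divide power_mult_distrib)
  show i1: "integrable M (\<lambda>w. (normalized m h w - linear_part m h w)\<^sup>2)"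
    unfolding sq D_def by (intro integrable_divide lin(2))
  have "(\<integral>w. (normalized m h w - linear_part m h w)\<^sup>2 \<partial>M) = (\<integral>w. (D w)\<^sup>2 \<partial>M) / (a\<^sup>2 * \<mu>)"
    unfolding sq by simp
  also have "\<dots> \<le> (remainder_const m C * \<mu> ^ (2 * m - 2)) / (a\<^sup>2 * \<mu>)"
    using lin(3) a0 s0 unfolding D_def remainder_const_def by (intro divide_right_mono) auto
  also have "\<dots> = remainder_const m C / ((real m)\<^sup>2 * \<mu>)"
    unfolding a2 using s0 by simp
  also have "\<dots> \<le> remainder_const m C / \<mu>"
  proof (rule divide_left_mono)
    have "1 * \<mu> \<le> (real m)\<^sup>2 * \<mu>" using m1 s0 by (intro mult_right_mono) auto
    then show "\<mu> \<le> (real m)\<^sup>2 * \<mu>" by simp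
  qed (use remainder_const_nonneg m1 s0 in auto)
  finally show e1: "(\<integral>w. (normalized m h w - linear_part m h w)\<^sup>2 \<partial>M) \<le> remainder_const m C / \<mu>" .
  let ?b = "\<lambda>w. ((normalized m h w - linear_part m h w)\<^sup>2 * sqrt \<mu> + 1 / sqrt \<mu>) / 2"
  have b_int: "integrable M ?b" using i1 by auto
  have le: "\<bar>normalized m h w - linear_part m h w\<bar> \<le> ?b w" for w
    by (rule abs_le_of_square[OF s0(1)])
  show i2: "integrable M (\<lambda>w. \<bar>normalized m h w - linear_part m h w\<bar>)"
  proof (rule Bochner_Integration.integrable_bound[OF b_int])
    show "AE w in M. norm \<bar>normalized m h w - linear_part m h w\<bar> \<le> norm (?b w)"
      using order_trans[OF le abs_ge_self] by (intro AE_I2) (simp only: real_norm_def abs_abs)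
  qed measurable
  have "(\<integral>w. \<bar>normalized m h w - linear_part m h w\<bar> \<partial>M) \<le> (\<integral>w. ?b w \<partial>M)"
    using i2 b_int le by (intro integral_mono) auto
  also have "\<dots> = ((\<integral>w. (normalized m h w - linear_part m h w)\<^sup>2 \<partial>M) * sqrt \<mu> + 1 / sqrt \<mu>) / 2"
    using i1 by (simp add: M.prob_space)
  also have "\<dots> \<le> (remainder_const m C / \<mu> * sqrt \<mu> + 1 / sqrt \<mu>) / 2"
    using e1 s0 by (intro divide_right_mono add_right_mono mult_right_mono) auto
  also have "remainder_const m C / \<mu> * sqrt \<mu> = remainder_const m C / sqrt \<mu>"
    using s0 real_sqrt_mult_self[of \<mu>] by (simp add: field_simps)
  also have "(remainder_const m C / sqrt \<mu> + 1 / sqrt \<mu>) / 2 = (remainder_const m C + 1) / (2 * sqrt \<mu>)"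
    by (simp add: add_divide_distrib)
  finally show "(\<integral>w. \<bar>normalized m h w - linear_part m h w\<bar> \<partial>M) \<le> (remainder_const m C + 1) / (2 * sqrt \<mu>)" .
  have lsq: "(linear_part m h w)\<^sup>2 = (usum 1 (\<lambda>xs. if length xs = 1 then proj \<kappa> m h (hd xs) else 0) w - \<mu> * theta \<kappa> m h)\<^sup>2 / \<mu>" for w
    unfolding linear_part_def using s0 by (simp add: power_divide)
  have i3: "integrable M (\<lambda>w. (linear_part m h w)\<^sup>2)"
    unfolding lsq by (intro integrable_divide lin(4))
  have e3: "(\<integral>w. (linear_part m h w)\<^sup>2 \<partial>M) \<le> C\<^sup>2 * (1 + card_const 0)"
  proof -
    have "(\<integral>w. (linear_part m h w)\<^sup>2 \<partial>M) \<le> C\<^sup>2 * (\<mu> + card_const 0) / \<mu>"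
      unfolding lsq using lin(5) s0 by (simp add: divide_right_mono)
    also have "\<dots> = C\<^sup>2 * (1 + card_const 0 / \<mu>)" using s0 by (simp add: field_simps)
    also have "\<dots> \<le> C\<^sup>2 * (1 + card_const 0)"
    proof -
      have "card_const 0 / \<mu> \<le> card_const 0 / 1"
        using mu card_const_nonneg by (intro divide_left_mono) auto
      then show ?thesis by (intro mult_left_mono) auto
    qed
    finally show ?thesis .
  qed
  let ?c = "\<lambda>w. 2 * ((linear_part m h w)\<^sup>2 + (normalized m h w - linear_part m h w)\<^sup>2)"
  have c_int: "integrable M ?c" using i1 i3 by auto
  have lec: "(normalized m h w)\<^sup>2 \<le> ?c w" for w
  proof -
    have "0 \<le> (linear_part m h w - (normalized m h w - linear_part m h w))\<^sup>2" by simp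
    then show ?thesis by (simp add: power2_eq_square algebra_simps)
  qed
  show i4: "integrable M (\<lambda>w. (normalized m h w)\<^sup>2)"
  proof (rule Bochner_Integration.integrable_bound[OF c_int])
    show "AE w in M. norm ((normalized m h w)\<^sup>2) \<le> norm (?c w)"
      using order_trans[OF lec abs_ge_self] by (intro AE_I2) (simp only: real_norm_def abs_power2)
  qed measurable
  have "(\<integral>w. (normalized m h w)\<^sup>2 \<partial>M) \<le> (\<integral>w. ?c w \<partial>M)"
    using i4 c_int lec by (intro integral_mono) auto
  also have "\<dots> = 2 * ((\<integral>w. (linear_part m h w)\<^sup>2 \<partial>M) + (\<integral>w. (normalized m h w - linear_part m h w)\<^sup>2 \<partial>M))"
    using i1 i3 by simp
  also have "\<dots> \<le> 2 * (C\<^sup>2 * (1 + card_const 0) + remainder_const m C / \<mu>)"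
    using e1 e3 by simp
  also have "\<dots> \<le> 2 * (C\<^sup>2 * (1 + card_const 0) + remainder_const m C)"
  proof -
    have "remainder_const m C / \<mu> \<le> remainder_const m C / 1"
      using mu remainder_const_nonneg by (intro divide_left_mono) auto
    then show ?thesis by simp
  qed
  finally show "(\<integral>w. (normalized m h w)\<^sup>2 \<partial>M) \<le> 2 * (C\<^sup>2 * (1 + card_const 0) + remainder_const m C)" .
qed

text \<open>The combination is one sum over the points, of \<open>q x / sqrt \<mu>\<close>, minus
  the constant sqrt \<mu> times the integral of q. That constant is exactly the compensator, which
  puts the linear term into the exponent given by \<open>characteristic_functional\<close>.\<close>

lemma char_linear_part:
  fixes m :: "'i::finite \<Rightarrow> nat" and t :: "'i \<Rightarrow> real"
  assumes h: "\<And>k. kernel \<kappa> (m k) C (h k)" and mu: "\<mu> > 0"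
  defines "q \<equiv> \<lambda>x. \<Sum>k\<in>UNIV. t k * proj \<kappa> (m k) (h k) x"
  shows "(\<integral>w. iexp (\<Sum>k\<in>UNIV. t k * linear_part (m k) (h k) w) \<partial>M) =
    exp (\<mu> * (\<integral>x. iexp (q x / sqrt \<mu>) - 1 - \<i> * (q x / sqrt \<mu>) \<partial>\<kappa>))"
proof -
  have [measurable]: "proj \<kappa> (m k) (h k) \<in> borel_measurable \<kappa>" for k by (rule K.proj_measurable[OF h])
  have qm[measurable]: "q \<in> borel_measurable \<kappa>" unfolding q_def by measurable
  have ip: "integrable \<kappa> (proj \<kappa> (m k) (h k))" for k
    using K.proj_bounds[OF h[of k]] by (intro K.integrable_const_bound[where B = C]) (auto simp: abs_of_nonneg)
  have iq: "integrable \<kappa> q" unfolding q_def by (intro Bochner_Integration.integrable_sum integrable_mult_right ip)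
  have th: "(\<integral>x. q x \<partial>\<kappa>) = (\<Sum>k\<in>UNIV. t k * theta \<kappa> (m k) (h k))"
    unfolding q_def K.theta_eq_integral_proj[OF h] using ip by (simp add: Bochner_Integration.integral_sum)
  have s0: "sqrt \<mu> > 0" "sqrt \<mu> * sqrt \<mu> = \<mu>" using mu by auto
  let ?Q = "\<integral>x. q x \<partial>\<kappa>"
  have eq: "(\<Sum>k\<in>UNIV. t k * linear_part (m k) (h k) w) = usum 1 (\<lambda>xs. q (hd xs) / sqrt \<mu>) w - sqrt \<mu> * ?Q"
    if fin: "finite (idx W w)" for w
  proof -
    have "(\<Sum>k\<in>UNIV. t k * linear_part (m k) (h k) w) =
        (\<Sum>k\<in>UNIV. t k * (\<Sum>i\<in>idx W w. proj \<kappa> (m k) (h k) (Y i w))) / sqrt \<mu> - \<mu> / sqrt \<mu> * ?Q"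
      unfolding linear_part_def usum_one[OF fin] th
      by (simp add: sum_distrib_left sum_divide_distrib diff_divide_distrib right_diff_distrib sum_subtractf mult_ac)
    also have "(\<Sum>k\<in>UNIV. t k * (\<Sum>i\<in>idx W w. proj \<kappa> (m k) (h k) (Y i w))) = (\<Sum>i\<in>idx W w. q (Y i w))"
      unfolding q_def sum_distrib_left by (rule sum.swap)
    also have "\<mu> / sqrt \<mu> = sqrt \<mu>" using s0 by (simp add: field_simps)
    finally show ?thesis unfolding usum_one[OF fin] by (simp add: sum_divide_distrib)
  qed
  have lm[measurable]: "linear_part (m k) (h k) \<in> borel_measurable M" for k
    by (rule normalized_measurable(2)[OF h])
  have um[measurable]: "usum 1 (\<lambda>xs. q (hd xs) / sqrt \<mu>) \<in> borel_measurable M"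
  proof -
    let ?u = "\<lambda>w. (\<Sum>k\<in>UNIV. t k * linear_part (m k) (h k) w) + sqrt \<mu> * ?Q"
    have "usum 1 (\<lambda>xs. q (hd xs) / sqrt \<mu>) = (\<lambda>w. if finite (idx W w) then ?u w else 0)"
      using eq by (auto simp: fun_eq_iff usum_def)
    then show ?thesis by simp
  qed
  have "(\<integral>w. iexp (\<Sum>k\<in>UNIV. t k * linear_part (m k) (h k) w) \<partial>M) =
      (\<integral>w. iexp (usum 1 (\<lambda>xs. q (hd xs) / sqrt \<mu>) w) * exp (- (\<i> * (sqrt \<mu> * ?Q))) \<partial>M)"
  proof (rule integral_cong_AE)
    show "AE w in M. iexp (\<Sum>k\<in>UNIV. t k * linear_part (m k) (h k) w) =
        iexp (usum 1 (\<lambda>xs. q (hd xs) / sqrt \<mu>) w) * exp (- (\<i> * (sqrt \<mu> * ?Q)))"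
      using AE_finite_idx[OF W_sets subset_refl]
    proof eventually_elim
      case (elim w)
      show ?case unfolding eq[OF elim] by (simp add: exp_add[symmetric] algebra_simps)
    qed
  qed measurable
  also have "\<dots> = exp (\<mu> * (\<integral>x. iexp (q x / sqrt \<mu>) - 1 \<partial>\<kappa>)) * exp (- (\<i> * (sqrt \<mu> * ?Q)))"
    by (subst characteristic_functional[symmetric]) auto
  also have "\<dots> = exp (\<mu> * ((\<integral>x. iexp (q x / sqrt \<mu>) - 1 \<partial>\<kappa>) - \<i> * (?Q / sqrt \<mu>)))"
  proof -
    have "complex_of_real (sqrt \<mu> * ?Q) = complex_of_real \<mu> * complex_of_real (?Q / sqrt \<mu>)"
      unfolding of_real_mult[symmetric] using s0 by (intro arg_cong[where f = of_real]) (simp add: field_simps)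
    then show ?thesis by (simp add: exp_add[symmetric] algebra_simps)
  qed
  also have "(\<integral>x. iexp (q x / sqrt \<mu>) - 1 \<partial>\<kappa>) - \<i> * (?Q / sqrt \<mu>) =
      (\<integral>x. iexp (q x / sqrt \<mu>) - 1 - \<i> * (q x / sqrt \<mu>) \<partial>\<kappa>)"
  proof -
    have "integrable \<kappa> (\<lambda>x. iexp (q x / sqrt \<mu>) - 1)"
      using norm_triangle_ineq4 by (intro K.integrable_const_bound[where B = 2]) (auto intro!: AE_I2 order_trans[OF norm_triangle_ineq4])
    moreover have "integrable \<kappa> (\<lambda>x. \<i> * (q x / sqrt \<mu>))"
      using iq by (intro integrable_mult_right integrable_of_real integrable_divide) auto
    ultimately have "(\<integral>x. iexp (q x / sqrt \<mu>) - 1 - \<i> * (q x / sqrt \<mu>) \<partial>\<kappa>) =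
        (\<integral>x. iexp (q x / sqrt \<mu>) - 1 \<partial>\<kappa>) - (\<integral>x. \<i> * complex_of_real (q x / sqrt \<mu>) \<partial>\<kappa>)"
      by (rule Bochner_Integration.integral_diff)
    moreover have "(\<integral>x. \<i> * complex_of_real (q x / sqrt \<mu>) \<partial>\<kappa>) = \<i> * (\<integral>x. complex_of_real (q x / sqrt \<mu>) \<partial>\<kappa>)"
      by (rule integral_mult_right_zero)
    moreover have "(\<integral>x. complex_of_real (q x / sqrt \<mu>) \<partial>\<kappa>) = complex_of_real (\<integral>x. q x / sqrt \<mu> \<partial>\<kappa>)"
      by (rule integral_complex_of_real)
    moreover have "(\<integral>x. q x / sqrt \<mu> \<partial>\<kappa>) = ?Q / sqrt \<mu>"
      by (rule integral_divide_zero)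
    ultimately show ?thesis by (simp only:)
  qed
  finally show ?thesis .
qed

end


section \<open>The central limit theorem for Poisson U-statistics\<close>

lemma iexp_second_order:
  fixes x :: real
  shows "cmod (iexp x - 1 - \<i> * x + x\<^sup>2 / 2) \<le> \<bar>x\<bar> ^ 3 / 6"
proof -
  have *: "(\<Sum>k\<le>2. (\<i> * x) ^ k / fact k) = 1 + \<i> * x - x\<^sup>2 / 2"
  proof -
    have sum3: "(\<Sum>k\<le>2. f k) = f 0 + f 1 + f 2" for f :: "nat \<Rightarrow> complex"
      by (simp add: numeral_2_eq_2)
    show ?thesis unfolding sum3 by (simp add: power_mult_distrib)
  qed
  show ?thesis using iexp_approx1[of x 2] unfolding * by (simp add: algebra_simps fact_numeral)
qed

text \<open>Second-order Taylor expansion of the exponential: the quadratic term carries the factor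
  m (1 / sqrt m)^2 = 1, and the remainder is at most m (Q / sqrt m)^3 / 6, of order 1 / sqrt
  m.\<close>

lemma poisson_exponent_tendsto:
  fixes q :: "'b \<Rightarrow> real" and \<mu> :: "'i \<Rightarrow> real"
  assumes K: "prob_space \<kappa>" and q[measurable]: "q \<in> borel_measurable \<kappa>" and Q: "\<And>x. \<bar>q x\<bar> \<le> Q"
    and \<mu>: "filterlim \<mu> at_top F"
  shows "((\<lambda>r. \<mu> r * (\<integral>x. iexp (q x / sqrt (\<mu> r)) - 1 - \<i> * (q x / sqrt (\<mu> r)) \<partial>\<kappa>)) \<longlongrightarrow>
    complex_of_real (- (\<integral>x. (q x)\<^sup>2 \<partial>\<kappa>) / 2)) F"
proof -
  interpret K: prob_space \<kappa> by fact
  have Q0: "0 \<le> Q" using Q[of undefined] by linarith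
  have i2: "integrable \<kappa> (\<lambda>x. (q x)\<^sup>2)"
  proof (rule K.integrable_const_bound[where B = "Q\<^sup>2"])
    show "AE x in \<kappa>. norm ((q x)\<^sup>2) \<le> Q\<^sup>2"
      using Q Q0 by (intro AE_I2) (simp add: abs_le_square_iff[symmetric] power2_le_iff_abs_le)
  qed measurable
  have bound: "norm (m * (\<integral>x. iexp (q x / sqrt m) - 1 - \<i> * (q x / sqrt m) \<partial>\<kappa>) - complex_of_real (- (\<integral>x. (q x)\<^sup>2 \<partial>\<kappa>) / 2))
      \<le> Q ^ 3 / 6 / sqrt m" if "m > 0" for m :: real
  proof -
    have s: "sqrt m > 0" "sqrt m * sqrt m = m" using that by auto
    let ?e = "\<lambda>x. m * (iexp (q x / sqrt m) - 1 - \<i> * (q x / sqrt m)) + complex_of_real ((q x)\<^sup>2 / 2)"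
    have e_bd: "norm (?e x) \<le> Q ^ 3 / 6 / sqrt m" for x
    proof -
      let ?y = "q x / sqrt m"
      have y2: "m * ?y\<^sup>2 = (q x)\<^sup>2" using s that by (simp add: power_divide)
      have "?e x = m * (iexp ?y - 1 - \<i> * ?y + ?y\<^sup>2 / 2)"
      proof -
        have "complex_of_real ((q x)\<^sup>2 / 2) = complex_of_real m * complex_of_real (?y\<^sup>2 / 2)"
          unfolding y2[symmetric] by simp
        then show ?thesis by (simp only: distrib_left)
      qed
      then have "norm (?e x) = m * norm (iexp ?y - 1 - \<i> * ?y + ?y\<^sup>2 / 2)"
        using that by (simp only: norm_mult norm_of_real abs_of_pos)
      also have "\<dots> \<le> m * (\<bar>?y\<bar> ^ 3 / 6)"
        using iexp_second_order[of ?y] that by (intro mult_left_mono) auto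
      also have "\<dots> = \<bar>q x\<bar> ^ 3 / 6 / sqrt m"
      proof -
        have "m * \<bar>?y\<bar> ^ 3 = \<bar>q x\<bar> ^ 3 * (m / sqrt m ^ 3)"
          using s by (simp add: power_divide abs_divide)
        also have "m / sqrt m ^ 3 = 1 / sqrt m"
          using s by (simp add: power3_eq_cube divide_simps)
        finally show ?thesis by simp
      qed
      also have "\<dots> \<le> Q ^ 3 / 6 / sqrt m"
        using Q[of x] s by (intro divide_right_mono power_mono) auto
      finally show ?thesis .
    qed
    have int1: "integrable \<kappa> (\<lambda>x. iexp (q x / sqrt m) - 1 - \<i> * (q x / sqrt m))"
    proof (rule K.integrable_const_bound[where B = "2 + Q / sqrt m"])
      show "AE x in \<kappa>. norm (iexp (q x / sqrt m) - 1 - \<i> * (q x / sqrt m)) \<le> 2 + Q / sqrt m"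
      proof (intro AE_I2)
        fix x
        have "norm (iexp (q x / sqrt m) - 1 - \<i> * (q x / sqrt m)) \<le> norm (iexp (q x / sqrt m) - 1) + norm (\<i> * (q x / sqrt m))"
          by (rule norm_triangle_ineq4)
        moreover have "norm (iexp (q x / sqrt m) - 1) \<le> 2"
          using norm_triangle_ineq4[of "iexp (q x / sqrt m)" 1] by simp
        moreover have "norm (\<i> * (q x / sqrt m)) \<le> Q / sqrt m"
        proof -
          have "norm (\<i> * (q x / sqrt m)) = \<bar>q x / sqrt m\<bar>" by (simp only: norm_mult norm_ii norm_of_real mult_1)
          also have "\<dots> = \<bar>q x\<bar> / sqrt m" using s by (simp add: abs_divide)
          finally show ?thesis using Q[of x] s by (simp add: divide_right_mono)
        qed
        ultimately show "norm (iexp (q x / sqrt m) - 1 - \<i> * (q x / sqrt m)) \<le> 2 + Q / sqrt m" by linarith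
      qed
    qed measurable
    have int2: "integrable \<kappa> (\<lambda>x. complex_of_real ((q x)\<^sup>2 / 2))"
      by (intro integrable_of_real integrable_divide i2)
    have "m * (\<integral>x. iexp (q x / sqrt m) - 1 - \<i> * (q x / sqrt m) \<partial>\<kappa>) - complex_of_real (- (\<integral>x. (q x)\<^sup>2 \<partial>\<kappa>) / 2) = (\<integral>x. ?e x \<partial>\<kappa>)"
    proof -
      have "(\<integral>x. ?e x \<partial>\<kappa>) = (\<integral>x. m * (iexp (q x / sqrt m) - 1 - \<i> * (q x / sqrt m)) \<partial>\<kappa>) + (\<integral>x. complex_of_real ((q x)\<^sup>2 / 2) \<partial>\<kappa>)"
        by (rule Bochner_Integration.integral_add[OF integrable_mult_right[OF int1] int2])
      also have "(\<integral>x. complex_of_real ((q x)\<^sup>2 / 2) \<partial>\<kappa>) = complex_of_real ((\<integral>x. (q x)\<^sup>2 \<partial>\<kappa>) / 2)"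
        by (simp only: integral_complex_of_real integral_divide_zero)
      finally show ?thesis by simp
    qed
    then have "norm (m * (\<integral>x. iexp (q x / sqrt m) - 1 - \<i> * (q x / sqrt m) \<partial>\<kappa>) - complex_of_real (- (\<integral>x. (q x)\<^sup>2 \<partial>\<kappa>) / 2)) \<le> (\<integral>x. norm (?e x) \<partial>\<kappa>)"
      by (simp only: integral_norm_bound)
    also have "\<dots> \<le> Q ^ 3 / 6 / sqrt m"
      using e_bd by (intro K.integral_le_const integrable_norm Bochner_Integration.integrable_add integrable_mult_right int1 int2) auto
    finally show ?thesis .
  qed
  have "((\<lambda>r. Q ^ 3 / 6 / sqrt (\<mu> r)) \<longlongrightarrow> 0) F"
    by (intro tendsto_divide_0[OF tendsto_const] filterlim_at_top_imp_at_infinity filterlim_compose[OF sqrt_at_top \<mu>])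
  moreover have "\<forall>\<^sub>F r in F. norm (\<mu> r * (\<integral>x. iexp (q x / sqrt (\<mu> r)) - 1 - \<i> * (q x / sqrt (\<mu> r)) \<partial>\<kappa>) - complex_of_real (- (\<integral>x. (q x)\<^sup>2 \<partial>\<kappa>) / 2))
      \<le> Q ^ 3 / 6 / sqrt (\<mu> r)"
    using filterlim_at_top_dense[THEN iffD1, OF \<mu>, rule_format, of 0] by eventually_elim (rule bound)
  ultimately show ?thesis by (rule Lim_null[THEN iffD2, OF Lim_null_comparison[rotated]])
qed


text \<open>Cosine expectations of Z differ from those of the linear parts by O(1 / sqrt r), and the
  latter converge to the Gaussian ones by \<open>poisson_exponent_tendsto\<close>. Bounded second
  moments give tightness. The limit covariance S is a Gram matrix of the projections, so the
  Gaussian law exists.\<close>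

theorem poisson_clt:
  fixes m :: "'n::finite \<Rightarrow> nat" and h :: "'n \<Rightarrow> 'b list \<Rightarrow> real" and Y :: "real \<Rightarrow> nat \<Rightarrow> 'w \<Rightarrow> 'b"
    and Z :: "real \<Rightarrow> 'w \<Rightarrow> real ^ 'n"
  assumes "c > 0" and po: "\<And>r. r > 0 \<Longrightarrow> poisson_on M \<kappa> W (c * r) (Y r)"
    and ker: "\<And>k. kernel \<kappa> (m k) C (h k)"
    and Z_meas: "\<And>r. r > 0 \<Longrightarrow> Z r \<in> borel_measurable M"
    and Z_eq: "\<And>r k. r > 0 \<Longrightarrow> AE w in M. Z r w $ k = poisson_on.normalized \<kappa> W (c * r) (Y r) (m k) (h k) w"
  defines "S \<equiv> \<chi> i j. \<integral>x. proj \<kappa> (m i) (h i) x * proj \<kappa> (m j) (h j) x \<partial>\<kappa>"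
  shows "\<exists>N. gaussian_law 0 S N \<and> converges_in_distribution M Z N at_top"
proof -
  have po1: "poisson_on M \<kappa> W c (Y 1)" using po[of 1] by simp
  interpret M: prob_space M using po1 by (simp add: poisson_on_def)
  interpret K: prob_space \<kappa> using po1 by (simp add: poisson_on_def)
  have C0: "0 \<le> C" using kernelD(7)[OF ker] by auto
  let ?g = "\<lambda>k. proj \<kappa> (m k) (h k)"
  have gm[measurable]: "?g k \<in> borel_measurable \<kappa>" for k by (rule K.proj_measurable[OF ker])
  have gb: "0 \<le> ?g k x" "?g k x \<le> C" for k x by (rule K.proj_bounds[OF ker])+
  have ggi: "integrable \<kappa> (\<lambda>x. ?g i x * ?g j x)" for i j
  proof (rule K.integrable_const_bound[where B = "C * C"])
    show "AE x in \<kappa>. norm (?g i x * ?g j x) \<le> C * C"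
      using gb C0 by (intro AE_I2) (simp add: abs_mult mult_mono)
  qed measurable
  \<comment> \<open>The quadratic form of S is the integral of a square. This gives positive
    semidefiniteness and identifies the limiting exponent.\<close>
  have quad: "(\<integral>x. (\<Sum>k\<in>UNIV. t k * ?g k x)\<^sup>2 \<partial>\<kappa>) = (\<Sum>i\<in>UNIV. \<Sum>j\<in>UNIV. t i * t j * S $ i $ j)" for t :: "'n \<Rightarrow> real"
  proof -
    have "(\<Sum>k\<in>UNIV. t k * ?g k x)\<^sup>2 = (\<Sum>i\<in>UNIV. \<Sum>j\<in>UNIV. t i * t j * (?g i x * ?g j x))" for x
      unfolding power2_eq_square sum_product by (intro sum.cong refl) simp
    then show ?thesis using ggi by (simp add: Bochner_Integration.integral_sum S_def)
  qed
  obtain N where N: "gaussian_law 0 S N"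
    and cosN: "\<And>t b. (\<integral>x. cos (t \<bullet> x + b) \<partial>N) = exp (- (t \<bullet> (S *v t)) / 2) * cos b"
  proof (rule gaussian_law_exists[of S])
    show "S $ i $ j = S $ j $ i" for i j by (simp add: S_def mult.commute)
    show "0 \<le> (\<Sum>i\<in>UNIV. \<Sum>j\<in>UNIV. t i * t j * S $ i $ j)" for t
      unfolding quad[symmetric] by (intro Bochner_Integration.integral_nonneg) auto
  qed blast
  have pN: "prob_space N" and sN: "sets N = sets borel" using N by (auto simp: gaussian_law_def)
  define A where "A = (\<lambda>r k. poisson_on.normalized \<kappa> W (c * r) (Y r) (m k) (h k))"
  define L where "L = (\<lambda>r k. poisson_on.linear_part \<kappa> W (c * r) (Y r) (m k) (h k))"
  have AE_A: "AE w in M. \<forall>k. Z r w $ k = A r k w" if "r > 0" for r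
    unfolding A_def using Z_eq[OF that] by (simp add: AE_all_countable)
  have L_meas: "L r k \<in> borel_measurable M" and A_meas: "A r k \<in> borel_measurable M" if "r > 0" for r k
    using poisson_on.normalized_measurable[OF po[OF that] ker] unfolding A_def L_def by auto
  let ?K = "\<lambda>k. remainder_const (m k) C"
  have approx: "integrable M (\<lambda>w. \<bar>A r k w - L r k w\<bar>)" "(\<integral>w. \<bar>A r k w - L r k w\<bar> \<partial>M) \<le> (?K k + 1) / (2 * sqrt (c * r))"
    "integrable M (\<lambda>w. (A r k w)\<^sup>2)" "(\<integral>w. (A r k w)\<^sup>2 \<partial>M) \<le> 2 * (C\<^sup>2 * (1 + card_const 0) + ?K k)"
    if "r > 0" "c * r \<ge> 1" for r k
    using poisson_on.normalized_approximation(3-6)[OF po[OF that(1)] ker that(2)] unfolding A_def L_def by auto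
  have cr: "filterlim (\<lambda>r. c * r) at_top at_top"
    using \<open>c > 0\<close> by (intro filterlim_tendsto_pos_mult_at_top[OF tendsto_const] filterlim_ident) auto
  have ev: "\<forall>\<^sub>F r in at_top. r > 0 \<and> c * r \<ge> 1"
    using eventually_gt_at_top[of 0] filterlim_at_top[THEN iffD1, OF cr, rule_format, of 1]
    by eventually_elim auto
  have lim: "((\<lambda>r. \<integral>w. cos (t \<bullet> Z r w + b) \<partial>M) \<longlongrightarrow> (\<integral>x. cos (t \<bullet> x + b) \<partial>N)) at_top" for t b
  proof -
    define q where "q = (\<lambda>x. \<Sum>k\<in>UNIV. t $ k * ?g k x)"
    have qm[measurable]: "q \<in> borel_measurable \<kappa>" unfolding q_def by measurable
    have qb: "\<bar>q x\<bar> \<le> (\<Sum>k\<in>UNIV. \<bar>t $ k\<bar> * C)" for x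
      unfolding q_def using gb by (intro order_trans[OF sum_abs] sum_mono) (simp add: abs_mult mult_left_mono)
    have q2: "(\<integral>x. (q x)\<^sup>2 \<partial>\<kappa>) = t \<bullet> (S *v t)"
      unfolding q_def quad inner_vec_def matrix_vector_mult_def by (simp add: sum_distrib_left mult_ac)
    let ?E = "\<lambda>r. c * r * (\<integral>x. iexp (q x / sqrt (c * r)) - 1 - \<i> * (q x / sqrt (c * r)) \<partial>\<kappa>)"
    have "(?E \<longlongrightarrow> complex_of_real (- (\<integral>x. (q x)\<^sup>2 \<partial>\<kappa>) / 2)) at_top"
      using poisson_exponent_tendsto[OF K.prob_space_axioms qm qb cr] by simp
    then have "((\<lambda>r. Re (exp (?E r) * cis b)) \<longlongrightarrow> Re (exp (complex_of_real (- (\<integral>x. (q x)\<^sup>2 \<partial>\<kappa>) / 2)) * cis b)) at_top"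
      by (intro tendsto_intros)
    moreover have "Re (exp (complex_of_real (- (\<integral>x. (q x)\<^sup>2 \<partial>\<kappa>) / 2)) * cis b) = (\<integral>x. cos (t \<bullet> x + b) \<partial>N)"
      unfolding cosN q2 exp_of_real by simp
    ultimately have limE: "((\<lambda>r. Re (exp (?E r) * cis b)) \<longlongrightarrow> (\<integral>x. cos (t \<bullet> x + b) \<partial>N)) at_top"
      by simp
    have L_cos: "(\<integral>w. cos ((\<Sum>k\<in>UNIV. t $ k * L r k w) + b) \<partial>M) = Re (exp (?E r) * cis b)" if r: "r > 0" for r
    proof -
      note [measurable] = L_meas[OF r]
      have int: "integrable M (\<lambda>w. iexp (\<Sum>k\<in>UNIV. t $ k * L r k w) * cis b)"
        by (intro M.integrable_const_bound[where B = 1]) (auto simp: norm_mult)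
      have "(\<integral>w. cos ((\<Sum>k\<in>UNIV. t $ k * L r k w) + b) \<partial>M) = (\<integral>w. Re (iexp (\<Sum>k\<in>UNIV. t $ k * L r k w) * cis b) \<partial>M)"
        by (intro Bochner_Integration.integral_cong refl) (simp add: cos_add Re_exp Im_exp)
      also have "\<dots> = Re (\<integral>w. iexp (\<Sum>k\<in>UNIV. t $ k * L r k w) * cis b \<partial>M)"
        using int by (rule integral_Re)
      also have "\<dots> = Re ((\<integral>w. iexp (\<Sum>k\<in>UNIV. t $ k * L r k w) \<partial>M) * cis b)" by simp
      also have "(\<integral>w. iexp (\<Sum>k\<in>UNIV. t $ k * L r k w) \<partial>M) = exp (?E r)"
        unfolding L_def q_def using poisson_on.char_linear_part[OF po[OF r] ker, of "\<lambda>k. t $ k"] r \<open>c > 0\<close> by simp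
      finally show ?thesis .
    qed
    define err where "err = (\<lambda>r. \<Sum>k\<in>UNIV. \<bar>t $ k\<bar> * ((?K k + 1) / (2 * sqrt (c * r))))"
    have "(err \<longlongrightarrow> (\<Sum>k\<in>UNIV. \<bar>t $ k\<bar> * 0)) at_top"
      unfolding err_def
      by (intro tendsto_sum tendsto_mult tendsto_const tendsto_divide_0[OF tendsto_const] filterlim_at_top_imp_at_infinity
          filterlim_tendsto_pos_mult_at_top[OF tendsto_const _ filterlim_compose[OF sqrt_at_top cr]]) auto
    then have err0: "(err \<longlongrightarrow> 0) at_top" by simp
    \<comment> \<open>The cosine is 1-Lipschitz, so the L1 error of each linearization passes
      directly to the expectations.\<close>
    have dist: "\<bar>(\<integral>w. cos (t \<bullet> Z r w + b) \<partial>M) - Re (exp (?E r) * cis b)\<bar> \<le> err r" if r: "r > 0" "c * r \<ge> 1" for r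
    proof -
      note [measurable] = L_meas[OF r(1)] A_meas[OF r(1)] Z_meas[OF r(1)]
      have ZA: "(\<integral>w. cos (t \<bullet> Z r w + b) \<partial>M) = (\<integral>w. cos ((\<Sum>k\<in>UNIV. t $ k * A r k w) + b) \<partial>M)"
        by (intro integral_cong_AE, measurable) (use AE_A[OF r(1)] in \<open>eventually_elim, simp add: inner_vec_def\<close>)
      have i1: "integrable M (\<lambda>w. cos ((\<Sum>k\<in>UNIV. t $ k * A r k w) + b))"
        "integrable M (\<lambda>w. cos ((\<Sum>k\<in>UNIV. t $ k * L r k w) + b))"
        by (intro M.integrable_const_bound[where B = 1]; simp)+
      have i2: "integrable M (\<lambda>w. \<Sum>k\<in>UNIV. \<bar>t $ k\<bar> * \<bar>A r k w - L r k w\<bar>)"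
        by (intro Bochner_Integration.integrable_sum integrable_mult_right approx(1)[OF r])
      have cos_lip: "\<bar>cos x - cos y\<bar> \<le> \<bar>x - y\<bar>" for x y :: real
      proof -
        have "cos x - cos y = 2 * sin ((x + y) / 2) * sin ((y - x) / 2)" by (rule cos_diff_cos)
        then have "\<bar>cos x - cos y\<bar> = 2 * (\<bar>sin ((x + y) / 2)\<bar> * \<bar>sin ((y - x) / 2)\<bar>)" by (simp add: abs_mult)
        also have "\<dots> \<le> 2 * (1 * \<bar>(y - x) / 2\<bar>)"
          by (intro mult_left_mono mult_mono abs_sin_x_le_abs_x) auto
        finally show ?thesis by simp
      qed
      have "\<bar>(\<integral>w. cos (t \<bullet> Z r w + b) \<partial>M) - Re (exp (?E r) * cis b)\<bar> =
          \<bar>\<integral>w. cos ((\<Sum>k\<in>UNIV. t $ k * A r k w) + b) - cos ((\<Sum>k\<in>UNIV. t $ k * L r k w) + b) \<partial>M\<bar>"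
        unfolding ZA L_cos[OF r(1), symmetric] using i1 by simp
      also have "\<dots> \<le> (\<integral>w. \<bar>cos ((\<Sum>k\<in>UNIV. t $ k * A r k w) + b) - cos ((\<Sum>k\<in>UNIV. t $ k * L r k w) + b)\<bar> \<partial>M)"
        by (rule integral_abs_bound)
      also have "\<dots> \<le> (\<integral>w. (\<Sum>k\<in>UNIV. \<bar>t $ k\<bar> * \<bar>A r k w - L r k w\<bar>) \<partial>M)"
      proof (rule integral_mono)
        show "integrable M (\<lambda>w. \<bar>cos ((\<Sum>k\<in>UNIV. t $ k * A r k w) + b) - cos ((\<Sum>k\<in>UNIV. t $ k * L r k w) + b)\<bar>)"
          using i1 by (intro integrable_abs Bochner_Integration.integrable_diff)
        show "integrable M (\<lambda>w. \<Sum>k\<in>UNIV. \<bar>t $ k\<bar> * \<bar>A r k w - L r k w\<bar>)" by (rule i2)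
        fix w
        have "\<bar>cos ((\<Sum>k\<in>UNIV. t $ k * A r k w) + b) - cos ((\<Sum>k\<in>UNIV. t $ k * L r k w) + b)\<bar> \<le>
            \<bar>((\<Sum>k\<in>UNIV. t $ k * A r k w) + b) - ((\<Sum>k\<in>UNIV. t $ k * L r k w) + b)\<bar>"
          by (rule cos_lip)
        also have "\<dots> = \<bar>\<Sum>k\<in>UNIV. t $ k * (A r k w - L r k w)\<bar>"
          by (simp add: sum_subtractf right_diff_distrib)
        also have "\<dots> \<le> (\<Sum>k\<in>UNIV. \<bar>t $ k\<bar> * \<bar>A r k w - L r k w\<bar>)"
          by (rule order_trans[OF sum_abs]) (simp add: abs_mult)
        finally show "\<bar>cos ((\<Sum>k\<in>UNIV. t $ k * A r k w) + b) - cos ((\<Sum>k\<in>UNIV. t $ k * L r k w) + b)\<bar> \<le>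
            (\<Sum>k\<in>UNIV. \<bar>t $ k\<bar> * \<bar>A r k w - L r k w\<bar>)" .
      qed
      also have "\<dots> = (\<Sum>k\<in>UNIV. \<bar>t $ k\<bar> * (\<integral>w. \<bar>A r k w - L r k w\<bar> \<partial>M))"
        using approx(1)[OF r] by (simp add: Bochner_Integration.integral_sum)
      also have "\<dots> \<le> err r"
        unfolding err_def by (intro sum_mono mult_left_mono approx(2)[OF r]) auto
      finally show ?thesis .
    qed
    have "((\<lambda>r. (\<integral>w. cos (t \<bullet> Z r w + b) \<partial>M) - Re (exp (?E r) * cis b)) \<longlongrightarrow> 0) at_top"
      by (rule Lim_null_comparison[OF _ err0]) (use ev in \<open>eventually_elim, use dist in auto\<close>)
    from tendsto_add[OF this limE] show ?thesis by simp
  qed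
  define T where "T = (\<Sum>k\<in>UNIV. 2 * (C\<^sup>2 * (1 + card_const 0) + ?K k))"
  have T0: "0 \<le> T" unfolding T_def by (intro sum_nonneg mult_nonneg_nonneg add_nonneg_nonneg remainder_const_nonneg card_const_nonneg) auto
  have tight: "\<exists>R. \<forall>\<^sub>F r in at_top. measure M {w \<in> space M. norm (Z r w) > R} \<le> e" if "e > 0" for e
  proof -
    \<comment> \<open>By Markov's inequality the tail is at most T / R^2 = e T / (T + 1) \<le> e;
      the added 1 keeps R positive if T = 0.\<close>
    define R where "R = sqrt ((T + 1) / e)"
    have R: "R > 0" "R\<^sup>2 = (T + 1) / e" using \<open>e > 0\<close> T0 by (auto simp: R_def)
    have "measure M {w \<in> space M. norm (Z r w) > R} \<le> e" if r: "r > 0" "c * r \<ge> 1" for r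
    proof -
      note [measurable] = A_meas[OF r(1)] Z_meas[OF r(1)]
      let ?N = "\<lambda>w. \<Sum>k\<in>UNIV. (A r k w)\<^sup>2"
      have iN: "integrable M ?N" by (intro Bochner_Integration.integrable_sum approx(3)[OF r])
      have "(\<integral>w. ?N w \<partial>M) = (\<Sum>k\<in>UNIV. \<integral>w. (A r k w)\<^sup>2 \<partial>M)"
        using approx(3)[OF r] by (simp add: Bochner_Integration.integral_sum)
      also have "\<dots> \<le> T" unfolding T_def by (intro sum_mono approx(4)[OF r])
      finally have ET: "(\<integral>w. ?N w \<partial>M) \<le> T" .
      have "measure M {w \<in> space M. norm (Z r w) > R} \<le> measure M {w \<in> space M. ?N w \<ge> R\<^sup>2}"
      proof (rule M.finite_measure_mono_AE)
        show "AE w in M. w \<in> {w \<in> space M. norm (Z r w) > R} \<longrightarrow> w \<in> {w \<in> space M. ?N w \<ge> R\<^sup>2}"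
          using AE_A[OF r(1)]
        proof eventually_elim
          case (elim w)
          have "(norm (Z r w))\<^sup>2 = ?N w"
            using elim unfolding power2_norm_eq_inner by (simp add: inner_vec_def power2_eq_square)
          then show ?case using R(1) by (auto intro: order_trans[OF power_mono[of R "norm (Z r w)" 2]])
        qed
      qed measurable
      also have "\<dots> \<le> (\<integral>w. ?N w \<partial>M) / R\<^sup>2"
        using R(1) by (intro integral_Markov_inequality_measure[OF iN, of "{}"]) (auto intro!: sum_nonneg)
      also have "\<dots> \<le> T / R\<^sup>2" using ET by (intro divide_right_mono) auto
      also have "\<dots> \<le> e"
        unfolding R(2) using \<open>e > 0\<close> T0 by (simp add: field_simps)
      finally show ?thesis .
    qed
    with ev show ?thesis by (intro exI[of _ R]) (auto elim: eventually_mono)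
  qed
  have Zev: "\<forall>\<^sub>F r in at_top. Z r \<in> borel_measurable M"
    using eventually_gt_at_top[of 0] by eventually_elim (rule Z_meas)
  have "converges_in_distribution M Z N at_top"
    unfolding converges_in_distribution_def
    using pN sN Zev weak_convergence_trig[OF M.prob_space_axioms pN sN Zev lim tight] by auto
  with N show ?thesis by blast
qed

section \<open>Hausdorff measure: covers, scaling and measurability\<close>

definition cover_weight :: "nat \<Rightarrow> 'a::metric_space set \<Rightarrow> ennreal" where
  "cover_weight k U = (if U = {} then 0 else ennreal (unit_ball_vol (real k) * (diameter U / 2) ^ k))"

definition covers :: "real \<Rightarrow> 'a::metric_space set \<Rightarrow> (nat \<Rightarrow> 'a set) set" where
  "covers \<delta> A = {U. A \<subseteq> (\<Union>i. U i) \<and> (\<forall>i. bounded (U i) \<and> diameter (U i) \<le> \<delta>)}"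

lemma hausdorff_pre_covers: "hausdorff_pre k \<delta> A = (INF U\<in>covers \<delta> A. \<Sum>i. cover_weight k (U i))"
  unfolding hausdorff_pre_def covers_def cover_weight_def ..

lemma hausdorff_pre_le: "U \<in> covers \<delta> A \<Longrightarrow> hausdorff_pre k \<delta> A \<le> (\<Sum>i. cover_weight k (U i))"
  unfolding hausdorff_pre_covers by (rule INF_lower)

lemma hausdorff_pre_antimono: "\<delta> \<le> \<delta>' \<Longrightarrow> hausdorff_pre k \<delta>' A \<le> hausdorff_pre k \<delta> A"
  unfolding hausdorff_pre_covers by (rule INF_superset_mono) (auto simp: covers_def intro: order_trans)

lemma hausdorff_empty[simp]: "hausdorff k {} = 0"
proof -
  have "hausdorff_pre k \<delta> ({} :: 'a set) = 0" if "\<delta> > 0" for \<delta>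
  proof -
    have "(\<lambda>_. {}) \<in> covers \<delta> ({} :: 'a set)" using that by (simp add: covers_def)
    from hausdorff_pre_le[OF this, of k] show ?thesis by (simp add: cover_weight_def)
  qed
  then show ?thesis unfolding hausdorff_def by (intro antisym SUP_least) auto
qed

text \<open>A finite family is padded to a sequence by empty sets, which have weight 0 even for
  \<open>k = 0\<close>.\<close>

lemma hausdorff_pre_finite_cover:
  assumes J: "finite J" and A: "A \<subseteq> (\<Union>j\<in>J. V j)" and \<delta>: "\<delta> \<ge> 0"
    and V: "\<And>j. j \<in> J \<Longrightarrow> bounded (V j)" "\<And>j. j \<in> J \<Longrightarrow> diameter (V j) \<le> \<delta>"
    and c: "\<And>j. j \<in> J \<Longrightarrow> cover_weight k (V j) \<le> c"
  shows "hausdorff_pre k \<delta> A \<le> of_nat (card J) * c"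
proof -
  obtain e where e: "bij_betw e {0..<card J} J"
    using ex_bij_betw_nat_finite[OF J] by auto
  define U where "U = (\<lambda>i. if i < card J then V (e i) else {})"
  have eJ: "e i \<in> J" if "i < card J" for i using bij_betwE[OF e] that by auto
  have "\<exists>i<card J. e i = j" if "j \<in> J" for j
    using e that unfolding bij_betw_def by (metis atLeastLessThan_iff imageE)
  then have "A \<subseteq> (\<Union>i. U i)" using A unfolding U_def by fastforce
  then have "U \<in> covers \<delta> A"
    using V eJ \<delta> by (auto simp: covers_def U_def)
  then have "hausdorff_pre k \<delta> A \<le> (\<Sum>i. cover_weight k (U i))" by (rule hausdorff_pre_le)
  also have "\<dots> = (\<Sum>i<card J. cover_weight k (U i))"
    by (rule suminf_finite) (auto simp: U_def cover_weight_def)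
  also have "\<dots> \<le> (\<Sum>i<card J. c)"
    using c eJ by (intro sum_mono) (auto simp: U_def)
  finally show ?thesis by simp
qed

lemma diameter_nonneg: "bounded S \<Longrightarrow> 0 \<le> diameter S" for S :: "'a::metric_space set"
  by (rule diameter_ge_0)

lemma cover_weight_scale:
  fixes U :: "'a::real_normed_vector set"
  assumes "s > 0" "bounded U"
  shows "bounded ((*\<^sub>R) s ` U)" "diameter ((*\<^sub>R) s ` U) \<le> s * diameter U"
    "cover_weight k ((*\<^sub>R) s ` U) \<le> ennreal (s ^ k) * cover_weight k U"
proof -
  show b: "bounded ((*\<^sub>R) s ` U)" using assms(2) by (rule bounded_scaling)
  show d: "diameter ((*\<^sub>R) s ` U) \<le> s * diameter U"
  proof (rule diameter_le)
    show "(*\<^sub>R) s ` U \<noteq> {} \<or> 0 \<le> s * diameter U" using assms by (simp add: diameter_nonneg)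
    fix x y assume "x \<in> (*\<^sub>R) s ` U" "y \<in> (*\<^sub>R) s ` U"
    then obtain a c where ac: "a \<in> U" "c \<in> U" "x = s *\<^sub>R a" "y = s *\<^sub>R c" by auto
    have "norm (x - y) = s * dist a c"
      using assms(1) ac by (simp add: scaleR_diff_right[symmetric] dist_norm)
    also have "\<dots> \<le> s * diameter U"
      using assms ac by (intro mult_left_mono diameter_bounded_bound) auto
    finally show "norm (x - y) \<le> s * diameter U" .
  qed
  show "cover_weight k ((*\<^sub>R) s ` U) \<le> ennreal (s ^ k) * cover_weight k U"
  proof (cases "U = {}")
    case False
    have "unit_ball_vol (real k) * (diameter ((*\<^sub>R) s ` U) / 2) ^ k \<le> unit_ball_vol (real k) * (s * diameter U / 2) ^ k"
      using d b by (intro mult_left_mono power_mono divide_right_mono) (auto simp: diameter_nonneg)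
    also have "\<dots> = s ^ k * (unit_ball_vol (real k) * (diameter U / 2) ^ k)"
      by (simp add: power_mult_distrib power_divide)
    finally have "ennreal (unit_ball_vol (real k) * (diameter ((*\<^sub>R) s ` U) / 2) ^ k) \<le>
        ennreal (s ^ k) * ennreal (unit_ball_vol (real k) * (diameter U / 2) ^ k)"
      using assms by (subst ennreal_mult[symmetric]) (auto simp: diameter_nonneg intro: ennreal_leI)
    then show ?thesis using False by (simp add: cover_weight_def)
  qed (simp add: cover_weight_def)
qed

text \<open>Scaling by s turns a cover of A of mesh \<delta> / s into a cover of the image of mesh
  \<delta>, with weights multiplied by at most s^k. The reverse inequality is the same statement for
  1 / s.\<close>

lemma hausdorff_scale_le:
  fixes A :: "'a::real_normed_vector set"
  assumes s: "s > 0"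
  shows "hausdorff k ((*\<^sub>R) s ` A) \<le> ennreal (s ^ k) * hausdorff k A"
  unfolding hausdorff_def
proof (rule SUP_least)
  fix \<delta> :: real assume "\<delta> \<in> {0<..}"
  then have \<delta>: "\<delta> > 0" by simp
  have inv: "ennreal (1 / s ^ k) * hausdorff_pre k \<delta> ((*\<^sub>R) s ` A) \<le> hausdorff_pre k (\<delta> / s) A"
    unfolding hausdorff_pre_covers[of k "\<delta> / s"]
  proof (rule INF_greatest)
    fix U assume U: "U \<in> covers (\<delta> / s) A"
    then have b: "bounded (U i)" "diameter (U i) \<le> \<delta> / s" for i by (auto simp: covers_def)
    have "(\<lambda>i. (*\<^sub>R) s ` U i) \<in> covers \<delta> ((*\<^sub>R) s ` A)"
    proof -
      have "diameter ((*\<^sub>R) s ` U i) \<le> \<delta>" for i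
        using order_trans[OF cover_weight_scale(2)[OF s b(1)] mult_left_mono[OF b(2), of s i]] s by simp
      then show ?thesis
        using U s cover_weight_scale(1)[OF s b(1)] by (auto simp: covers_def image_UN[symmetric] intro!: image_mono)
    qed
    then have "hausdorff_pre k \<delta> ((*\<^sub>R) s ` A) \<le> (\<Sum>i. cover_weight k ((*\<^sub>R) s ` U i))"
      by (rule hausdorff_pre_le)
    also have "\<dots> \<le> (\<Sum>i. ennreal (s ^ k) * cover_weight k (U i))"
      by (intro suminf_le cover_weight_scale(3)[OF s b(1)]) auto
    also have "\<dots> = ennreal (s ^ k) * (\<Sum>i. cover_weight k (U i))" by simp
    finally have "ennreal (1 / s ^ k) * hausdorff_pre k \<delta> ((*\<^sub>R) s ` A) \<le>
        ennreal (1 / s ^ k) * (ennreal (s ^ k) * (\<Sum>i. cover_weight k (U i)))"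
      by (rule mult_left_mono) simp
    also have "\<dots> = (\<Sum>i. cover_weight k (U i))"
      using s by (simp add: mult.assoc[symmetric] ennreal_mult[symmetric])
    finally show "ennreal (1 / s ^ k) * hausdorff_pre k \<delta> ((*\<^sub>R) s ` A) \<le> (\<Sum>i. cover_weight k (U i))" .
  qed
  have "hausdorff_pre k \<delta> ((*\<^sub>R) s ` A) = ennreal (s ^ k) * (ennreal (1 / s ^ k) * hausdorff_pre k \<delta> ((*\<^sub>R) s ` A))"
    using s by (simp add: mult.assoc[symmetric] ennreal_mult[symmetric])
  also have "\<dots> \<le> ennreal (s ^ k) * hausdorff_pre k (\<delta> / s) A"
    by (intro mult_left_mono inv) simp
  also have "\<dots> \<le> ennreal (s ^ k) * (SUP \<delta>\<in>{0<..}. hausdorff_pre k \<delta> A)"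
    using \<delta> s by (intro mult_left_mono SUP_upper) auto
  finally show "hausdorff_pre k \<delta> ((*\<^sub>R) s ` A) \<le> ennreal (s ^ k) * (SUP \<delta>\<in>{0<..}. hausdorff_pre k \<delta> A)" .
qed

lemma hausdorff_scale:
  fixes A :: "'a::real_normed_vector set"
  assumes s: "s > 0"
  shows "hausdorff k ((*\<^sub>R) s ` A) = ennreal (s ^ k) * hausdorff k A"
proof (rule antisym[OF hausdorff_scale_le[OF s]])
  have "(*\<^sub>R) (1 / s) ` (*\<^sub>R) s ` A = A" using s by (simp add: image_image)
  then have "hausdorff k A \<le> ennreal ((1 / s) ^ k) * hausdorff k ((*\<^sub>R) s ` A)"
    using hausdorff_scale_le[of "1 / s" k "(*\<^sub>R) s ` A"] s by simp
  then have "ennreal (s ^ k) * hausdorff k A \<le> ennreal (s ^ k) * (ennreal ((1 / s) ^ k) * hausdorff k ((*\<^sub>R) s ` A))"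
    by (rule mult_left_mono) simp
  also have "\<dots> = hausdorff k ((*\<^sub>R) s ` A)"
    using s by (simp add: mult.assoc[symmetric] ennreal_mult[symmetric] power_divide)
  finally show "ennreal (s ^ k) * hausdorff k A \<le> hausdorff k ((*\<^sub>R) s ` A)" .
qed

lemma vol_scale:
  fixes A :: "'a::real_normed_vector set"
  shows "s > 0 \<Longrightarrow> vol k ((*\<^sub>R) s ` A) = s ^ k * vol k A"
  by (simp add: vol_def hausdorff_scale enn2real_mult)

text \<open>Covers by open sets yield an upper semicontinuous premeasure with the same limit.\<close>

definition open_pre :: "nat \<Rightarrow> real \<Rightarrow> 'a::metric_space set \<Rightarrow> ennreal" where
  "open_pre k \<delta> A = (INF U\<in>{U \<in> covers \<delta> A. \<forall>i. open (U i)}. \<Sum>i. cover_weight k (U i))"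

text \<open>The open t-neighbourhood of S has diameter at most that of S plus 2 t, and the weight is
  a continuous function of the diameter.\<close>

lemma cover_weight_enlarge:
  fixes S :: "'a::real_normed_vector set"
  assumes S: "bounded S" and "\<eta> > 0" "e > 0"
  obtains V where "S \<subseteq> V" "open V" "bounded V" "diameter V \<le> diameter S + \<eta>"
    "cover_weight k V \<le> cover_weight k S + ennreal e"
proof (cases "S = {}")
  case True
  then show ?thesis using that[of "{}"] assms by simp
next
  case False
  let ?f = "\<lambda>x. unit_ball_vol (real k) * (x / 2) ^ k"
  have "isCont ?f (diameter S)" by (intro continuous_intros) auto
  then obtain d where d: "d > 0" "\<And>x. \<bar>x - diameter S\<bar> < d \<Longrightarrow> \<bar>?f x - ?f (diameter S)\<bar> < e"
    using \<open>e > 0\<close> unfolding continuous_at_eps_delta dist_real_def by blast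
  \<comment> \<open>The value of 2 t is the smaller of \<eta> and d / 2, so it respects both the
    mesh and the range of continuity.\<close>
  define t where "t = min \<eta> (d / 2) / 2"
  have t: "t > 0" "2 * t \<le> \<eta>" "2 * t < d" using \<open>\<eta> > 0\<close> d(1) by (auto simp: t_def min_def)
  define V where "V = (\<Union>a\<in>S. ball a t)"
  have SV: "S \<subseteq> V" using t(1) by (auto simp: V_def)
  have dV: "norm (x - y) \<le> diameter S + 2 * t" if xy: "x \<in> V" "y \<in> V" for x y
  proof -
    obtain a b where ab: "a \<in> S" "b \<in> S" "dist a x < t" "dist b y < t"
      using xy unfolding V_def UN_iff mem_ball by blast
    have "dist x y \<le> dist a x + dist a b + dist b y"
      by (metis dist_commute dist_triangle_le add.assoc add_left_mono dist_triangle order_trans)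
    then show ?thesis
      using ab diameter_bounded_bound[OF S ab(1,2)] by (simp add: dist_norm)
  qed
  have diam: "diameter V \<le> diameter S + 2 * t"
    using dV False SV by (intro diameter_le) auto
  have bV: "bounded V"
  proof -
    obtain a where "a \<in> V" using False SV by auto
    then show ?thesis unfolding bounded_def dist_norm using dV by blast
  qed
  have "diameter S \<le> diameter V" using SV bV by (rule diameter_subset)
  then have "?f (diameter V) \<le> ?f (diameter S) + e"
    using d(2)[of "diameter V"] diam t by (simp add: abs_less_iff)
  then have "ennreal (?f (diameter V)) \<le> ennreal (?f (diameter S) + e)" by (rule ennreal_leI)
  also have "\<dots> = ennreal (?f (diameter S)) + ennreal e"
    using \<open>e > 0\<close> S by (intro ennreal_plus mult_nonneg_nonneg zero_le_power) (auto simp: diameter_nonneg)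
  finally have "cover_weight k V \<le> cover_weight k S + ennreal e"
    using False SV by (auto simp: cover_weight_def)
  then show ?thesis
    using that[of V] SV bV diam t by (auto simp: V_def)
qed

lemma open_pre_le:
  fixes A :: "'a::real_normed_vector set"
  assumes "\<delta> < \<delta>'"
  shows "open_pre k \<delta>' A \<le> hausdorff_pre k \<delta> A"
  unfolding hausdorff_pre_covers
proof (rule INF_greatest)
  fix U assume U: "U \<in> covers \<delta> A"
  show "open_pre k \<delta>' A \<le> (\<Sum>i. cover_weight k (U i))"
  proof (rule ennreal_le_epsilon)
    fix e :: real assume "e > 0"
    \<comment> \<open>The i-th set is enlarged at a cost of e / 2^(i + 1), so that the total cost is
      e.\<close>
    have "\<exists>V. U i \<subseteq> V \<and> open V \<and> bounded V \<and> diameter V \<le> diameter (U i) + (\<delta>' - \<delta>) \<and>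
        cover_weight k V \<le> cover_weight k (U i) + ennreal (e * (1 / 2) ^ Suc i)" for i
    proof -
      have "bounded (U i)" using U by (auto simp: covers_def)
      from cover_weight_enlarge[OF this, of "\<delta>' - \<delta>" "e * (1 / 2) ^ Suc i" k] assms \<open>e > 0\<close>
      show ?thesis by (metis diff_gt_0_iff_gt mult_pos_pos zero_less_power half_gt_zero_iff zero_less_one)
    qed
    then obtain V where V: "\<And>i. U i \<subseteq> V i" "\<And>i. open (V i)" "\<And>i. bounded (V i)"
      "\<And>i. diameter (V i) \<le> diameter (U i) + (\<delta>' - \<delta>)"
      "\<And>i. cover_weight k (V i) \<le> cover_weight k (U i) + ennreal (e * (1 / 2) ^ Suc i)" by metis
    have "diameter (V i) \<le> \<delta>'" for i
      using V(4)[of i] U by (auto simp: covers_def intro: order_trans)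
    moreover have "A \<subseteq> (\<Union>i. V i)" using U V(1) by (fastforce simp: covers_def)
    ultimately have "V \<in> {V \<in> covers \<delta>' A. \<forall>i. open (V i)}"
      using V by (auto simp: covers_def)
    then have "open_pre k \<delta>' A \<le> (\<Sum>i. cover_weight k (V i))"
      unfolding open_pre_def by (rule INF_lower)
    also have "\<dots> \<le> (\<Sum>i. cover_weight k (U i) + ennreal (e * (1 / 2) ^ Suc i))"
      by (intro suminf_le V(5)) auto
    also have "\<dots> = (\<Sum>i. cover_weight k (U i)) + (\<Sum>i. ennreal (e * (1 / 2) ^ Suc i))"
      by (rule suminf_add[symmetric]) auto
    also have "(\<Sum>i. ennreal (e * (1 / 2) ^ Suc i)) = ennreal e"
      using sums_mult[OF power_half_series, of e] \<open>e > 0\<close> by (intro suminf_ennreal_eq) auto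
    finally show "open_pre k \<delta>' A \<le> (\<Sum>i. cover_weight k (U i)) + ennreal e" .
  qed
qed

text \<open>Open covers are fewer, and by \<open>open_pre_le\<close> they do no worse than arbitrary
  covers of slightly smaller mesh. The meshes 1 / (n + 1) make the supremum countable, as
  measurability requires.\<close>

lemma hausdorff_open_pre:
  fixes A :: "'a::real_normed_vector set"
  shows "hausdorff k A = (SUP n. open_pre k (1 / real (Suc n)) A)"
proof (rule antisym)
  show "hausdorff k A \<le> (SUP n. open_pre k (1 / real (Suc n)) A)"
    unfolding hausdorff_def
  proof (rule SUP_least)
    fix \<delta> :: real assume "\<delta> \<in> {0<..}"
    then obtain n where n: "1 / real (Suc n) < \<delta>" using nat_approx_posE[of \<delta>] by auto
    have "hausdorff_pre k \<delta> A \<le> hausdorff_pre k (1 / real (Suc n)) A"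
      using n by (intro hausdorff_pre_antimono) simp
    also have "\<dots> \<le> open_pre k (1 / real (Suc n)) A"
      unfolding hausdorff_pre_covers open_pre_def by (rule INF_superset_mono) auto
    also have "\<dots> \<le> (SUP n. open_pre k (1 / real (Suc n)) A)" by (rule SUP_upper) simp
    finally show "hausdorff_pre k \<delta> A \<le> (SUP n. open_pre k (1 / real (Suc n)) A)" .
  qed
  show "(SUP n. open_pre k (1 / real (Suc n)) A) \<le> hausdorff k A"
  proof (rule SUP_least)
    fix n
    have "open_pre k (1 / real (Suc n)) A \<le> hausdorff_pre k (1 / real (Suc n) / 2) A"
      by (rule open_pre_le) (simp add: field_simps)
    also have "\<dots> \<le> hausdorff k A" unfolding hausdorff_def by (rule SUP_upper) simp
    finally show "open_pre k (1 / real (Suc n)) A \<le> hausdorff k A" .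
  qed
qed

text \<open>The value of \<open>open_pre\<close> at a section is below c iff some cover by open sets
  of total weight below c contains it. This set of parameters is a union of open sets, hence open,
  even though the union is uncountable. The Hausdorff measure is a countable supremum of such
  functions.\<close>

lemma vol_measurable:
  fixes sec :: "'x::topological_space \<Rightarrow> 'a::real_normed_vector set"
  assumes sec: "\<And>U. open U \<Longrightarrow> open {x. sec x \<subseteq> U}"
  shows "(\<lambda>x. vol k (sec x)) \<in> borel_measurable borel"
proof -
  have "(\<lambda>x. open_pre k \<delta> (sec x)) \<in> borel_measurable borel" for \<delta>
  proof (rule borel_measurableI_less)
    fix c
    let ?G = "{U. (\<forall>i. open (U i) \<and> bounded (U i) \<and> diameter (U i) \<le> \<delta>) \<and> (\<Sum>i. cover_weight k (U i)) < c}"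
    have "{x \<in> space borel. open_pre k \<delta> (sec x) < c} = (\<Union>U\<in>?G. {x. sec x \<subseteq> (\<Union>i. U i)})"
      unfolding open_pre_def INF_less_iff by (auto simp: covers_def)
    also have "open \<dots>" by (intro open_UN ballI sec) auto
    finally show "{x \<in> space borel. open_pre k \<delta> (sec x) < c} \<in> sets borel" by (simp add: borel_open)
  qed
  then show ?thesis
    unfolding vol_def hausdorff_open_pre by measurable
qed

lemma chi_measurable:
  fixes sec :: "'x::topological_space \<Rightarrow> 'a set"
  assumes "open {x. sec x \<subseteq> {}}"
  shows "(\<lambda>x. chi (sec x)) \<in> borel_measurable borel"
proof -
  have "Measurable.pred borel (\<lambda>x. sec x = {})"
    using borel_open[OF assms] by (simp add: pred_def)
  then show ?thesis unfolding chi_def by measurable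
qed

section \<open>Sections of a ball by hyperplanes: measurability and volume\<close>

definition section_of :: "real \<Rightarrow> (real \<times> 'a::real_inner) list \<Rightarrow> 'a set" where
  "section_of r xs = (\<Inter>x\<in>set xs. hyperplane x) \<inter> cball 0 r"

lemma flat_section_eq: "flat_section r x (set js) = section_of r (map x js)"
  by (simp add: flat_section_def section_of_def image_image)

lemma mem_section_of: "y \<in> section_of r (map x [0..<m]) \<longleftrightarrow> (\<forall>i<m. y \<bullet> snd (x i) = fst (x i)) \<and> norm y \<le> r"
  by (auto simp: section_of_def hyperplane_def)

text \<open>Upper semicontinuity of sections. Every point of the ball outside U violates one of the
  equations, and an inequation persists under small changes of point and hyperplanes; compactness of
  the ball (tube lemma) makes the neighbourhood uniform.\<close>

lemma open_section_subset:
  fixes U :: "'a::euclidean_space set"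
  assumes "open U"
  shows "open {x :: nat \<Rightarrow> real \<times> 'a. section_of r (map x [0..<m]) \<subseteq> U}"
proof (subst open_subopen, intro ballI)
  fix x0 :: "nat \<Rightarrow> real \<times> 'a" assume x0: "x0 \<in> {x. section_of r (map x [0..<m]) \<subseteq> U}"
  \<comment> \<open>The open set of pairs (hyperplanes, point) for which some equation fails or the
    point lies in U; all pairs with first component \<open>x0\<close> and second in the ball belong
    to it.\<close>
  define W where "W = (\<Union>i<m. {p :: (nat \<Rightarrow> real \<times> 'a) \<times> 'a. snd p \<bullet> snd (fst p i) \<noteq> fst (fst p i)}) \<union> UNIV \<times> U"
  have c: "continuous_on UNIV (\<lambda>p :: (nat \<Rightarrow> real \<times> 'a) \<times> 'a. fst p i)" for i
    by (rule continuous_on_compose2[OF continuous_on_product_coordinates[of i] continuous_on_fst[OF continuous_on_id]]) auto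
  have "open {p :: (nat \<Rightarrow> real \<times> 'a) \<times> 'a. snd p \<bullet> snd (fst p i) \<noteq> fst (fst p i)}" for i
    by (intro open_Collect_neq continuous_on_inner continuous_on_snd continuous_on_fst c continuous_on_id)
  then have W: "open W" unfolding W_def using assms by (intro open_Un open_UN ballI open_Times open_UNIV) auto
  have "{x0} \<times> cball 0 r \<subseteq> W"
    using x0 by (auto simp: W_def mem_section_of subset_iff)
  from Elementary_Topology.tube_lemma[OF compact_cball W this]
  obtain X0 where X0: "x0 \<in> X0" "open X0" "X0 \<times> cball 0 r \<subseteq> W" by blast
  have "X0 \<subseteq> {x. section_of r (map x [0..<m]) \<subseteq> U}"
  proof (intro subsetI CollectI)
    fix x y assume x: "x \<in> X0" and y: "y \<in> section_of r (map x [0..<m])"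
    then have "(x, y) \<in> W" using X0(3) by (auto simp: mem_section_of)
    then show "y \<in> U" using y by (auto simp: W_def mem_section_of)
  qed
  then show "\<exists>T. open T \<and> x0 \<in> T \<and> T \<subseteq> {x. section_of r (map x [0..<m]) \<subseteq> U}" using X0 by blast
qed

lemma measurable_section_functional:
  fixes \<phi> :: "'a::euclidean_space set \<Rightarrow> real"
  assumes \<phi>: "(\<lambda>x :: nat \<Rightarrow> real \<times> 'a. \<phi> (section_of r (map x [0..<m]))) \<in> borel_measurable borel"
    and \<kappa>: "(\<lambda>x. x) \<in> measurable \<kappa> borel"
  shows "(\<lambda>z. \<phi> (section_of r (map z [0..<m]))) \<in> borel_measurable (PiM {..<m} (\<lambda>_. \<kappa>))"
proof -
  \<comment> \<open>Finite tuples are padded by 0 to infinite sequences, on which the product and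
    the Borel sigma-algebra coincide.\<close>
  let ?e = "\<lambda>z i. if i < m then z i else (0 :: real \<times> 'a)"
  have "?e \<in> measurable (PiM {..<m} (\<lambda>_. \<kappa>)) (PiM UNIV (\<lambda>_. borel))"
  proof (rule measurable_PiM_single')
    fix i :: nat
    show "(\<lambda>z. ?e z i) \<in> measurable (PiM {..<m} (\<lambda>_. \<kappa>)) borel"
    proof (cases "i < m")
      case True
      then have "(\<lambda>z. z i) \<in> measurable (PiM {..<m} (\<lambda>_. \<kappa>)) \<kappa>"
        by (intro measurable_component_singleton) simp
      from measurable_compose[OF this \<kappa>] show ?thesis using True by simp
    qed simp
  qed auto
  then have e: "?e \<in> measurable (PiM {..<m} (\<lambda>_. \<kappa>)) borel"
    using measurable_cong_sets[OF refl sets_PiM_equal_borel] by blast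
  have "(\<lambda>z. \<phi> (section_of r (map (?e z) [0..<m]))) \<in> borel_measurable (PiM {..<m} (\<lambda>_. \<kappa>))"
    by (rule measurable_compose[OF e \<phi>])
  moreover have "map (?e z) [0..<m] = map z [0..<m]" for z by simp
  ultimately show ?thesis by (simp only:)
qed

text \<open>With m independent normals the section lies in a flat of dimension k = DIM - m. Relative
  to one of its points, its coordinates in an orthonormal basis of the direction space are at most 2
  r in absolute value. A grid of N^k cells of side 4 r / N, each of diameter at most 4 k r / N,
  covers it, and in the total weight N cancels.\<close>

lemma hausdorff_section_bound:
  fixes v :: "nat \<Rightarrow> 'a::euclidean_space"
  assumes m: "m + k = DIM('a)" and ind: "independent (v ` {..<m})" "inj_on v {..<m}" and "r > 0"
  shows "hausdorff k {y \<in> cball 0 r. \<forall>i<m. y \<bullet> v i = p i} \<le> ennreal (unit_ball_vol (real k) * (2 * real k * r) ^ k)"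
    (is "hausdorff k ?S \<le> _")
proof (cases "?S = {}")
  case False
  then obtain a where a: "a \<in> ?S" by blast
  define L where "L = {u. \<forall>x\<in>span (v ` {..<m}). orthogonal x u}"
  have subL: "subspace L"
    unfolding L_def by (auto simp: subspace_def orthogonal_clauses)
  have "dim (v ` {..<m}) = m"
    using ind by (simp add: dim_eq_card_independent card_image)
  then have dimL: "dim L = k"
    using dim_subspace_orthogonal_to_vectors[of "span (v ` {..<m})" UNIV] m by (simp add: L_def)
  obtain B where B: "B \<subseteq> L" "pairwise orthogonal B" "\<And>x. x \<in> B \<Longrightarrow> norm x = 1" "independent B" "card B = dim L" "span B = L"
    using orthonormal_basis_subspace[OF subL] by blast
  have finB: "finite B" using B(4) by (rule independent_imp_finite)
  have cardB: "card B = k" using B(5) dimL by simp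
  have diff_L: "y - y' \<in> L" if "y \<in> ?S" "y' \<in> ?S" for y y'
  proof -
    have "span (v ` {..<m}) \<subseteq> {x. orthogonal x (y - y')}"
    proof (rule span_minimal)
      show "v ` {..<m} \<subseteq> {x. orthogonal x (y - y')}"
        using that by (auto simp: orthogonal_def inner_diff_right inner_commute)
      show "subspace {x. orthogonal x (y - y')}"
        by (auto simp: subspace_def orthogonal_clauses)
    qed
    then show ?thesis by (auto simp: L_def)
  qed
  have expand: "(\<Sum>b\<in>B. ((y - y') \<bullet> b) *\<^sub>R b) = y - y'" if "y \<in> ?S" "y' \<in> ?S" for y y'
    using B diff_L[OF that] finB by (intro orthonormal_basis_expand) auto
  have coord: "\<bar>(y - a) \<bullet> b\<bar> \<le> 2 * r" if "y \<in> ?S" "b \<in> B" for y b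
  proof -
    have "\<bar>(y - a) \<bullet> b\<bar> \<le> norm (y - a) * norm b" by (rule Cauchy_Schwarz_ineq2)
    also have "\<dots> = norm (y - a)" using B(3)[OF that(2)] by simp
    also have "\<dots> \<le> norm y + norm a" by (rule norm_triangle_ineq4)
    also have "\<dots> \<le> 2 * r" using that a by auto
    finally show ?thesis .
  qed
  show ?thesis
    unfolding hausdorff_def
  proof (rule SUP_least)
    fix \<delta> :: real assume "\<delta> \<in> {0<..}"
    then have \<delta>: "\<delta> > 0" by simp
    \<comment> \<open>Fine enough for cells of diameter at most \<delta>; the added 1 gives N > 1
      even for k = 0.\<close>
    obtain N :: nat where N: "real N > 4 * real k * r / \<delta> + 1"
      using reals_Archimedean2 by blast
    have "4 * real k * r / \<delta> \<ge> 0" using \<delta> \<open>r > 0\<close> by simp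
    then have N0: "real N > 1" "4 * real k * r / \<delta> < real N" using N by linarith+
    then have N\<delta>: "real k * (4 * r / real N) \<le> \<delta>" using \<delta> by (simp add: field_simps)
    define J where "J = PiE B (\<lambda>_. {..<N})"
    have finJ: "finite J" unfolding J_def using finB by (intro finite_PiE) auto
    have cardJ: "card J = N ^ k" unfolding J_def using finB by (simp add: card_PiE cardB)
    define c where "c = (\<lambda>y b. ((y - a) \<bullet> b + 2 * r) * real N / (4 * r))"
    define V where "V = (\<lambda>f. {y \<in> ?S. \<forall>b\<in>B. real (f b) \<le> c y b \<and> c y b \<le> real (f b) + 1})"
    have cover: "?S \<subseteq> (\<Union>f\<in>J. V f)"
    proof
      fix y assume y: "y \<in> ?S"
      have c: "0 \<le> c y b" "c y b \<le> real N" if "b \<in> B" for b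
      proof -
        have t: "0 \<le> (y - a) \<bullet> b + 2 * r" "(y - a) \<bullet> b + 2 * r \<le> 4 * r"
          using coord[OF y that] by (auto simp: abs_le_iff)
        show "0 \<le> c y b" unfolding c_def using t(1) \<open>r > 0\<close> by simp
        have "c y b \<le> 4 * r * real N / (4 * r)"
          unfolding c_def using t(2) \<open>r > 0\<close> by (intro divide_right_mono mult_right_mono) auto
        then show "c y b \<le> real N" using \<open>r > 0\<close> by simp
      qed
      \<comment> \<open>The minimum puts points on the far boundary, where \<open>c y b\<close>
        equals N, into the last cell.\<close>
      define f where "f = (\<lambda>b\<in>B. min (N - 1) (nat \<lfloor>c y b\<rfloor>))"
      have "real (f b) \<le> c y b \<and> c y b \<le> real (f b) + 1" if "b \<in> B" for b
      proof (cases "c y b < real N - 1")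
        case True
        then have "nat \<lfloor>c y b\<rfloor> \<le> N - 1" using c(1)[OF that] by linarith
        then have "f b = nat \<lfloor>c y b\<rfloor>" using that by (simp add: f_def)
        then show ?thesis using c(1)[OF that] by simp
      next
        case False
        then have "f b = N - 1" using that N0 by (simp add: f_def le_nat_iff le_floor_iff of_nat_diff)
        then show ?thesis using False c(2)[OF that] N0 by (simp add: of_nat_diff)
      qed
      moreover have "f \<in> J" using N0 by (auto simp: J_def f_def)
      ultimately show "y \<in> (\<Union>f\<in>J. V f)" using y by (auto simp: V_def)
    qed
    have V_sub: "V f \<subseteq> cball 0 r" for f by (auto simp: V_def)
    have bV: "bounded (V f)" for f using V_sub bounded_cball bounded_subset by blast
    have diam: "diameter (V f) \<le> real k * (4 * r / real N)" for f
    proof (rule diameter_le)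
      show "V f \<noteq> {} \<or> 0 \<le> real k * (4 * r / real N)" using \<open>r > 0\<close> by simp
      fix y y' assume yy: "y \<in> V f" "y' \<in> V f"
      then have S: "y \<in> ?S" "y' \<in> ?S" by (auto simp: V_def)
      have "norm (y - y') = norm (\<Sum>b\<in>B. ((y - y') \<bullet> b) *\<^sub>R b)" using expand[OF S] by simp
      also have "\<dots> \<le> (\<Sum>b\<in>B. 4 * r / real N)"
      proof (rule sum_norm_le)
        fix b assume b: "b \<in> B"
        have "real (f b) \<le> c y b" "c y b \<le> real (f b) + 1" "real (f b) \<le> c y' b" "c y' b \<le> real (f b) + 1"
          using yy b by (auto simp: V_def)
        then have "\<bar>c y b - c y' b\<bar> \<le> 1" by linarith
        moreover have "c y b - c y' b = ((y - y') \<bullet> b) * (real N / (4 * r))"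
          by (simp add: c_def inner_diff_left diff_divide_distrib[symmetric] algebra_simps)
        ultimately have "\<bar>(y - y') \<bullet> b\<bar> * (real N / (4 * r)) \<le> 1"
          using \<open>r > 0\<close> by (simp add: abs_mult)
        then have "\<bar>(y - y') \<bullet> b\<bar> \<le> 4 * r / real N" using \<open>r > 0\<close> N0 by (simp add: field_simps)
        then show "norm (((y - y') \<bullet> b) *\<^sub>R b) \<le> 4 * r / real N" using B(3)[OF b] by simp
      qed
      also have "\<dots> = real k * (4 * r / real N)" by (simp add: cardB)
      finally show "norm (y - y') \<le> real k * (4 * r / real N)" .
    qed
    have "cover_weight k (V f) \<le> ennreal (unit_ball_vol (real k) * (2 * real k * r / real N) ^ k)" for f
    proof (cases "V f = {}")
      case False
      have "diameter (V f) / 2 \<le> 2 * real k * r / real N" using diam[of f] by (simp add: mult_ac)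
      then have "unit_ball_vol (real k) * (diameter (V f) / 2) ^ k \<le> unit_ball_vol (real k) * (2 * real k * r / real N) ^ k"
        using diameter_nonneg[OF bV[of f]] by (intro mult_left_mono power_mono) auto
      then show ?thesis using False by (simp add: cover_weight_def ennreal_leI)
    qed (simp add: cover_weight_def)
    then have "hausdorff_pre k \<delta> ?S \<le> of_nat (card J) * ennreal (unit_ball_vol (real k) * (2 * real k * r / real N) ^ k)"
      using finJ cover \<delta> bV order_trans[OF diam N\<delta>] by (intro hausdorff_pre_finite_cover[where V = V]) auto
    also have "\<dots> = ennreal (real (N ^ k) * (unit_ball_vol (real k) * (2 * real k * r / real N) ^ k))"
      unfolding cardJ ennreal_of_nat_eq_real_of_nat using \<open>r > 0\<close> by (subst ennreal_mult) auto
    also have "real (N ^ k) * (unit_ball_vol (real k) * (2 * real k * r / real N) ^ k) = unit_ball_vol (real k) * (2 * real k * r) ^ k"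
      using N0 by (simp add: power_divide)
    finally show "hausdorff_pre k \<delta> ?S \<le> ennreal (unit_ball_vol (real k) * (2 * real k * r) ^ k)" .
  qed
next
  case True
  then show ?thesis by (simp only: hausdorff_empty zero_le)
qed

lemma independent_family:
  fixes v :: "nat \<Rightarrow> 'a::euclidean_space"
  assumes "\<And>j. j < m \<Longrightarrow> v j \<notin> span (v ` {..<j})"
  shows "independent (v ` {..<m}) \<and> inj_on v {..<m}"
  using assms
proof (induction m)
  case (Suc m)
  have IH: "independent (v ` {..<m})" "inj_on v {..<m}"
    using Suc.IH Suc.prems less_SucI by blast+
  have new: "v m \<notin> span (v ` {..<m})" by (rule Suc.prems) simp
  have new': "v m \<notin> v ` {..<m}" by (rule contrapos_nn[OF new]) (rule span_base)
  have "independent (insert (v m) (v ` {..<m}))"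
    by (rule independent_insertI[OF new IH(1)])
  moreover have "inj_on v (insert m {..<m})"
    unfolding inj_on_insert using IH(2) new' by auto
  ultimately show ?case unfolding lessThan_Suc image_insert by (rule conjI)
qed (simp add: independent_empty)

lemma span_image_family:
  fixes g :: "nat \<Rightarrow> 'a::real_vector"
  shows "x \<in> span (g ` {..<j}) \<longleftrightarrow> (\<exists>c. x = (\<Sum>i<j. c i *\<^sub>R g i))"
proof
  assume "x \<in> span (g ` {..<j})"
  moreover have "span (g ` {..<j}) \<subseteq> {x. \<exists>c. x = (\<Sum>i<j. c i *\<^sub>R g i)}"
  proof (rule span_minimal)
    show "g ` {..<j} \<subseteq> {x. \<exists>c. x = (\<Sum>i<j. c i *\<^sub>R g i)}"
    proof (rule image_subsetI, rule CollectI)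
      fix i assume "i \<in> {..<j}"
      then have "g i = (\<Sum>l<j. (if l = i then 1 else 0 :: real) *\<^sub>R g l)"
        by (simp add: if_distrib[of "\<lambda>a. a *\<^sub>R _"] cong: if_cong)
      then show "\<exists>c. g i = (\<Sum>l<j. c l *\<^sub>R g l)" by (rule exI[of _ "\<lambda>l. if l = i then 1 else 0"])
    qed
    show "subspace {x. \<exists>c. x = (\<Sum>i<j. c i *\<^sub>R g i)}"
      unfolding subspace_def
    proof (intro conjI ballI allI)
      show "0 \<in> {x. \<exists>c. x = (\<Sum>i<j. c i *\<^sub>R g i)}" by (auto intro!: exI[of _ "\<lambda>_. 0"])
    next
      fix x y assume "x \<in> {x. \<exists>c. x = (\<Sum>i<j. c i *\<^sub>R g i)}" "y \<in> {x. \<exists>c. x = (\<Sum>i<j. c i *\<^sub>R g i)}"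
      then obtain c d where "x = (\<Sum>i<j. c i *\<^sub>R g i)" "y = (\<Sum>i<j. d i *\<^sub>R g i)" by auto
      then have "x + y = (\<Sum>i<j. (c i + d i) *\<^sub>R g i)" by (simp add: scaleR_add_left sum.distrib)
      then show "x + y \<in> {x. \<exists>c. x = (\<Sum>i<j. c i *\<^sub>R g i)}"
        by (intro CollectI exI[of _ "\<lambda>i. c i + d i"])
    next
      fix a :: real and x assume "x \<in> {x. \<exists>c. x = (\<Sum>i<j. c i *\<^sub>R g i)}"
      then obtain c where "x = (\<Sum>i<j. c i *\<^sub>R g i)" by auto
      then have "a *\<^sub>R x = (\<Sum>i<j. (a * c i) *\<^sub>R g i)" by (simp add: scaleR_sum_right)
      then show "a *\<^sub>R x \<in> {x. \<exists>c. x = (\<Sum>i<j. c i *\<^sub>R g i)}"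
        by (intro CollectI exI[of _ "\<lambda>i. a * c i"])
    qed
  qed
  ultimately show "\<exists>c. x = (\<Sum>i<j. c i *\<^sub>R g i)" by auto
next
  assume "\<exists>c. x = (\<Sum>i<j. c i *\<^sub>R g i)"
  then obtain c where "x = (\<Sum>i<j. c i *\<^sub>R g i)" by blast
  then show "x \<in> span (g ` {..<j})" by (simp only:) (intro span_sum span_scale, auto intro: span_base)
qed

text \<open>Spans are closed, so membership is the same as approximability by rational combinations.
  This is a countable condition, which makes membership in a random span measurable; lists of
  rationals serve as a countable type of coefficients.\<close>

lemma span_rational_approx:
  fixes g :: "nat \<Rightarrow> 'a::euclidean_space"
  shows "x \<in> span (g ` {..<j}) \<longleftrightarrow> (\<forall>n::nat. \<exists>c::rat list. norm (x - (\<Sum>i<j. real_of_rat (c ! i) *\<^sub>R g i)) < 1 / real (Suc n))"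
proof
  assume "x \<in> span (g ` {..<j})"
  then obtain r where x: "x = (\<Sum>i<j. r i *\<^sub>R g i)" unfolding span_image_family by blast
  show "\<forall>n::nat. \<exists>c::rat list. norm (x - (\<Sum>i<j. real_of_rat (c ! i) *\<^sub>R g i)) < 1 / real (Suc n)"
  proof
    fix n :: nat
    define e where "e = (\<lambda>i. 1 / real (Suc n) / ((real j + 1) * (norm (g i) + 1)))"
    have e: "e i > 0" for i by (simp add: e_def add_nonneg_pos mult_pos_pos)
    have "\<exists>q::rat. \<bar>r i - real_of_rat q\<bar> < e i" for i
    proof -
      obtain q where "q \<in> \<rat>" "r i - e i < q" "q < r i + e i" using Rats_dense_in_real[of "r i - e i" "r i + e i"] e[of i] by auto
      moreover from this obtain q' where "q = real_of_rat q'" by (auto simp: Rats_def)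
      ultimately show ?thesis by (intro exI[of _ q']) (auto simp: abs_less_iff)
    qed
    then obtain q :: "nat \<Rightarrow> rat" where q: "\<And>i. \<bar>r i - real_of_rat (q i)\<bar> < e i" by metis
    have "norm (x - (\<Sum>i<j. real_of_rat (map q [0..<j] ! i) *\<^sub>R g i)) = norm (\<Sum>i<j. (r i - real_of_rat (q i)) *\<^sub>R g i)"
      unfolding x by (simp add: sum_subtractf scaleR_diff_left)
    also have "\<dots> \<le> (\<Sum>i<j. 1 / real (Suc n) / (real j + 1))"
    proof (rule sum_norm_le)
      fix i
      have "norm ((r i - real_of_rat (q i)) *\<^sub>R g i) \<le> e i * (norm (g i) + 1)"
        using q[of i] e[of i] by (simp add: mult_mono)
      also have "\<dots> = 1 / real (Suc n) / (real j + 1)"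
      proof -
        have "norm (g i) + 1 \<noteq> 0" using norm_ge_zero[of "g i"] by linarith
        then show ?thesis by (simp add: e_def)
      qed
      finally show "norm ((r i - real_of_rat (q i)) *\<^sub>R g i) \<le> 1 / real (Suc n) / (real j + 1)" .
    qed
    also have "\<dots> = 1 / real (Suc n) * (real j / (real j + 1))" by simp
    also have "\<dots> < 1 / real (Suc n) * 1"
      by (intro mult_strict_left_mono) (auto simp: divide_less_eq)
    finally have "norm (x - (\<Sum>i<j. real_of_rat (map q [0..<j] ! i) *\<^sub>R g i)) < 1 / real (Suc n)" by simp
    then show "\<exists>c::rat list. norm (x - (\<Sum>i<j. real_of_rat (c ! i) *\<^sub>R g i)) < 1 / real (Suc n)" by (rule exI)
  qed
next
  assume *: "\<forall>n::nat. \<exists>c::rat list. norm (x - (\<Sum>i<j. real_of_rat (c ! i) *\<^sub>R g i)) < 1 / real (Suc n)"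
  have "x \<in> closure (span (g ` {..<j}))"
    unfolding closure_approachable
  proof (intro allI impI)
    fix e :: real assume "e > 0"
    then obtain n where n: "1 / real (Suc n) < e" using nat_approx_posE by blast
    obtain c :: "rat list" where "norm (x - (\<Sum>i<j. real_of_rat (c ! i) *\<^sub>R g i)) < 1 / real (Suc n)" using * by blast
    then have "dist (\<Sum>i<j. real_of_rat (c ! i) *\<^sub>R g i) x < e" using n by (simp add: dist_norm norm_minus_commute)
    moreover have "(\<Sum>i<j. real_of_rat (c ! i) *\<^sub>R g i) \<in> span (g ` {..<j})"
      by (intro span_sum span_scale) (auto intro: span_base)
    ultimately show "\<exists>y\<in>span (g ` {..<j}). dist y x < e" by blast
  qed
  then show "x \<in> span (g ` {..<j})" by (simp add: closed_span)
qed

lemma measurable_in_span: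
  fixes g :: "nat \<Rightarrow> 'w \<Rightarrow> 'a::euclidean_space"
  assumes [measurable]: "f \<in> borel_measurable N" and g: "\<And>i. i < j \<Longrightarrow> g i \<in> borel_measurable N"
  shows "Measurable.pred N (\<lambda>w. f w \<in> span ((\<lambda>i. g i w) ` {..<j}))"
proof -
  have [measurable]: "(\<lambda>w. \<Sum>i<j. real_of_rat (c ! i) *\<^sub>R g i w) \<in> borel_measurable N" for c :: "rat list"
    using g by (intro borel_measurable_sum borel_measurable_scaleR borel_measurable_const) auto
  show ?thesis unfolding span_rational_approx by measurable
qed

section \<open>The law of a hyperplane hitting the ball, and general position\<close>

text \<open>The law of the auxiliary variables for radius \<rho>. As a measurable space its first
  component is the whole real line, so \<open>window\<close> is a proper subset of full
  measure.\<close>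

definition mark_law :: "real \<Rightarrow> (real ^ 'n::{finite,linorder}) measure \<Rightarrow> (real \<times> (real ^ 'n::{finite,linorder})) measure" where
  "mark_law \<rho> \<Theta> = uniform_measure lborel {-\<rho>..\<rho>} \<Otimes>\<^sub>M \<Theta>"

definition window :: "real \<Rightarrow> (real \<times> (real ^ 'n::{finite,linorder})) set" where
  "window \<rho> = {-\<rho>..\<rho>} \<times> half_sphere"

context
  fixes \<Theta> :: "(real ^ 'n::{finite,linorder}) measure" and \<rho> :: real
  assumes \<Theta>: "orientation_distribution \<Theta>" and \<rho>: "\<rho> > 0"
begin

lemma prob_space_orientation: "prob_space \<Theta>"
  using \<Theta> by (simp add: orientation_distribution_def)

lemma sets_orientation: "sets \<Theta> = sets (restrict_space borel half_sphere)"
  using \<Theta> by (simp add: orientation_distribution_def)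

lemma space_orientation: "space \<Theta> = half_sphere"
  using sets_eq_imp_space_eq[OF sets_orientation] by (simp add: space_restrict_space)

lemma prob_space_uniform: "prob_space (uniform_measure lborel {-\<rho>..\<rho>})"
  using \<rho> by (intro prob_space_uniform_measure) auto

lemma prob_space_mark_law: "prob_space (mark_law \<rho> \<Theta>)"
proof -
  interpret U: prob_space "uniform_measure lborel {-\<rho>..\<rho>}" by (rule prob_space_uniform)
  interpret T: prob_space \<Theta> by (rule prob_space_orientation)
  interpret UT: pair_prob_space "uniform_measure lborel {-\<rho>..\<rho>}" \<Theta> ..
  show ?thesis unfolding mark_law_def by (rule UT.prob_space_axioms)
qed

lemma sets_mark_law: "sets (mark_law \<rho> \<Theta>) = sets (lborel \<Otimes>\<^sub>M \<Theta>)"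
  unfolding mark_law_def by (intro sets_pair_measure_cong) auto

lemma space_mark_law: "space (mark_law \<rho> \<Theta>) = UNIV \<times> half_sphere"
  by (simp add: mark_law_def space_pair_measure space_orientation)

lemma orientation_borel: "(\<lambda>v. v) \<in> borel_measurable \<Theta>"
  unfolding measurable_cong_sets[OF sets_orientation refl] by (rule measurable_restrict_space1) simp

lemma mark_law_borel: "(\<lambda>x. x) \<in> borel_measurable (mark_law \<rho> \<Theta>)"
proof -
  have "(\<lambda>x. (fst x, snd x)) \<in> measurable (mark_law \<rho> \<Theta>) (borel \<Otimes>\<^sub>M borel)"
    unfolding mark_law_def
    by (intro measurable_Pair measurable_compose[OF measurable_snd orientation_borel])
      (rule measurable_compose[OF measurable_fst], simp add: measurable_ident_sets)
  then show ?thesis by (simp add: borel_prod)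
qed

lemma window_sets: "window \<rho> \<in> sets (mark_law \<rho> \<Theta>)"
proof -
  have "half_sphere \<in> sets \<Theta>" using sets.top[of \<Theta>] by (simp add: space_orientation)
  then show ?thesis unfolding window_def mark_law_def by (intro pair_measureI) auto
qed

lemma emeasure_mark_law:
  assumes "A \<in> sets (mark_law \<rho> \<Theta>)"
  shows "emeasure (mark_law \<rho> \<Theta>) A = (\<integral>\<^sup>+v. emeasure lborel ({-\<rho>..\<rho>} \<inter> (\<lambda>p. (p, v)) -` A) / ennreal (2 * \<rho>) \<partial>\<Theta>)"
proof -
  interpret U: prob_space "uniform_measure lborel {-\<rho>..\<rho>}" by (rule prob_space_uniform)
  interpret T: prob_space \<Theta> by (rule prob_space_orientation)
  interpret UT: pair_prob_space "uniform_measure lborel {-\<rho>..\<rho>}" \<Theta> ..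
  have A: "A \<in> sets (uniform_measure lborel {-\<rho>..\<rho>} \<Otimes>\<^sub>M \<Theta>)" using assms unfolding mark_law_def .
  have "emeasure (mark_law \<rho> \<Theta>) A = (\<integral>\<^sup>+v. emeasure (uniform_measure lborel {-\<rho>..\<rho>}) ((\<lambda>p. (p, v)) -` A) \<partial>\<Theta>)"
    unfolding mark_law_def by (rule UT.emeasure_pair_measure_alt2[OF A])
  also have "\<dots> = (\<integral>\<^sup>+v. emeasure lborel ({-\<rho>..\<rho>} \<inter> (\<lambda>p. (p, v)) -` A) / ennreal (2 * \<rho>) \<partial>\<Theta>)"
  proof (intro nn_integral_cong)
    fix v
    have "(\<lambda>p. (p, v)) -` A \<in> sets borel" using sets_Pair2[OF A, of v] by (simp only: sets_uniform_measure sets_lborel)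
    then show "emeasure (uniform_measure lborel {-\<rho>..\<rho>}) ((\<lambda>p. (p, v)) -` A) =
        emeasure lborel ({-\<rho>..\<rho>} \<inter> (\<lambda>p. (p, v)) -` A) / ennreal (2 * \<rho>)"
      using \<rho> by simp
  qed
  finally show ?thesis .
qed

lemma emeasure_window: "emeasure (mark_law \<rho> \<Theta>) (window \<rho>) = 1"
proof -
  interpret T: prob_space \<Theta> by (rule prob_space_orientation)
  have "emeasure (mark_law \<rho> \<Theta>) (window \<rho>) = (\<integral>\<^sup>+v. 1 \<partial>\<Theta>)"
    unfolding emeasure_mark_law[OF window_sets]
  proof (intro nn_integral_cong)
    fix v assume "v \<in> space \<Theta>"
    then have "{-\<rho>..\<rho>} \<inter> (\<lambda>p. (p, v)) -` window \<rho> = {-\<rho>..\<rho>}" by (auto simp: window_def space_orientation)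
    then show "emeasure lborel ({-\<rho>..\<rho>} \<inter> (\<lambda>p. (p, v)) -` window \<rho>) / ennreal (2 * \<rho>) = 1"
      using \<rho> by (simp add: divide_ennreal)
  qed
  also have "\<dots> = 1" using T.emeasure_space_1 by simp
  finally show ?thesis .
qed

text \<open>A subspace not containing \<open>(1, 0)\<close> is a graph over its second components.\<close>

lemma subspace_null:
  fixes T :: "(real \<times> (real ^ 'n::{finite,linorder})) set"
  assumes T: "subspace T" "(1, 0) \<notin> T"
  shows "AE x in mark_law \<rho> \<Theta>. x \<notin> T"
proof -
  have A: "T \<inter> space (mark_law \<rho> \<Theta>) \<in> sets (mark_law \<rho> \<Theta>)"
    using measurable_sets[OF mark_law_borel, of T] closed_subspace[OF T(1)] by (simp add: vimage_def Int_def borel_closed conj_commute)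
  have "emeasure lborel ({-\<rho>..\<rho>} \<inter> (\<lambda>p. (p, v)) -` (T \<inter> space (mark_law \<rho> \<Theta>))) = 0" for v
  proof -
    have "p = p'" if "(p, v) \<in> T" "(p', v) \<in> T" for p p'
    proof (rule ccontr)
      assume "p \<noteq> p'"
      have "(1 / (p - p')) *\<^sub>R ((p, v) - (p', v)) \<in> T"
        by (intro subspace_scale[OF T(1)] subspace_diff[OF T(1)] that)
      then show False using T(2) \<open>p \<noteq> p'\<close> by simp
    qed
    then have "\<exists>q. {-\<rho>..\<rho>} \<inter> (\<lambda>p. (p, v)) -` (T \<inter> space (mark_law \<rho> \<Theta>)) \<subseteq> {q}" by blast
    then obtain q where "{-\<rho>..\<rho>} \<inter> (\<lambda>p. (p, v)) -` (T \<inter> space (mark_law \<rho> \<Theta>)) \<subseteq> {q}" by blast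
    then have "countable ({-\<rho>..\<rho>} \<inter> (\<lambda>p. (p, v)) -` (T \<inter> space (mark_law \<rho> \<Theta>)))"
      by (rule countable_subset) simp
    then show ?thesis by (rule emeasure_lborel_countable)
  qed
  then have "emeasure (mark_law \<rho> \<Theta>) (T \<inter> space (mark_law \<rho> \<Theta>)) = 0"
    unfolding emeasure_mark_law[OF A] by simp
  then show ?thesis
    using A by (intro AE_I[of _ _ "T \<inter> space (mark_law \<rho> \<Theta>)"]) auto
qed

text \<open>Fix all coordinates except the j-th. The span of the earlier ones is then a fixed
  subspace, and if it omits (1, 0), \<open>z j\<close> avoids it almost surely by
  \<open>subspace_null\<close>; Fubini finishes.\<close>

lemma AE_span:
  fixes j m :: nat
  assumes "j < m"
  shows "AE z in PiM {..<m} (\<lambda>_. mark_law \<rho> \<Theta>). \<not> (z j \<in> span (z ` {..<j}) \<and> (1, 0) \<notin> span (z ` {..<j}))"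
proof -
  interpret K: prob_space "mark_law \<rho> \<Theta>" by (rule prob_space_mark_law)
  interpret P: product_sigma_finite "\<lambda>_. mark_law \<rho> \<Theta>" by standard
  let ?P = "PiM {..<m} (\<lambda>_. mark_law \<rho> \<Theta>)"
  let ?I = "{..<m} - {j}"
  have I: "insert j ?I = {..<m}" using assms by auto
  let ?bad = "\<lambda>z. z j \<in> span (z ` {..<j}) \<and> (1, 0) \<notin> span (z ` {..<j})"
  have comp: "(\<lambda>z. z i) \<in> borel_measurable ?P" if "i < m" for i
    using measurable_compose[OF measurable_component_singleton[of i "{..<m}" "\<lambda>_. mark_law \<rho> \<Theta>"] mark_law_borel] that by simp
  have "Measurable.pred ?P (\<lambda>z. z j \<in> span ((\<lambda>i. z i) ` {..<j}))"
    using assms by (intro measurable_in_span[where f = "\<lambda>z. z j" and g = "\<lambda>i z. z i"] comp) auto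
  moreover have "Measurable.pred ?P (\<lambda>z. (1, 0) \<in> span ((\<lambda>i. z i) ` {..<j}))"
    using assms by (intro measurable_in_span[where f = "\<lambda>z. (1, 0)" and g = "\<lambda>i z. z i"] comp borel_measurable_const) auto
  ultimately have meas: "Measurable.pred ?P ?bad" by measurable
  then have ind: "(\<lambda>z. indicator {z. ?bad z} z :: ennreal) \<in> borel_measurable (PiM (insert j ?I) (\<lambda>_. mark_law \<rho> \<Theta>))"
    unfolding I by (simp add: borel_measurable_indicator_iff pred_def Int_def conj_commute)
  have "(\<integral>\<^sup>+z. indicator {z. ?bad z} z \<partial>?P) =
      (\<integral>\<^sup>+x. (\<integral>\<^sup>+y. indicator {z. ?bad z} (x(j := y)) \<partial>mark_law \<rho> \<Theta>) \<partial>PiM ?I (\<lambda>_. mark_law \<rho> \<Theta>))"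
    using P.product_nn_integral_insert[of ?I j, OF _ _ ind] unfolding I by simp
  also have "\<dots> = (\<integral>\<^sup>+x. 0 \<partial>PiM ?I (\<lambda>_. mark_law \<rho> \<Theta>))"
  proof (intro nn_integral_cong)
    fix x :: "nat \<Rightarrow> real \<times> (real ^ 'n::{finite,linorder})"
    have upd: "(x(j := y)) ` {..<j} = x ` {..<j}" for y by (auto simp: image_iff)
    have "AE y in mark_law \<rho> \<Theta>. \<not> ?bad (x(j := y))"
    proof (cases "(1, 0) \<in> span (x ` {..<j})")
      case False
      from subspace_null[OF subspace_span False] show ?thesis
        by eventually_elim (simp add: upd)
    qed (simp add: upd)
    then have "AE y in mark_law \<rho> \<Theta>. indicator {z. ?bad z} (x(j := y)) = (0 :: ennreal)"
      by eventually_elim simp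
    then have "(\<integral>\<^sup>+y. indicator {z. ?bad z} (x(j := y)) \<partial>mark_law \<rho> \<Theta>) = (\<integral>\<^sup>+y. 0 \<partial>mark_law \<rho> \<Theta>)"
      by (rule nn_integral_cong_AE)
    then show "(\<integral>\<^sup>+y. indicator {z. ?bad z} (x(j := y)) \<partial>mark_law \<rho> \<Theta>) = 0" by simp
  qed
  finally have "(\<integral>\<^sup>+z. indicator {z. ?bad z} z \<partial>?P) = 0" by simp
  then have "AE z in ?P. indicator {z. ?bad z} z = (0 :: ennreal)"
    using ind unfolding I by (subst (asm) nn_integral_0_iff_AE) auto
  then show ?thesis by eventually_elim (simp add: indicator_eq_0_iff)
qed

text \<open>A common point y gives p_i = \<langle>y, v_i\<rangle>, so any linear relation among the
  normals v_i is one among the pairs (p_i, v_i). \<open>AE_span\<close> excludes such relations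
  almost surely, hence the normals are independent and \<open>hausdorff_section_bound\<close>
  applies. Empty sections have volume 0.\<close>

lemma AE_vol_section_bound:
  assumes m: "m + k = CARD('n)"
  shows "AE z in PiM {..<m} (\<lambda>_. mark_law \<rho> \<Theta>).
    vol k (section_of \<rho> (map z [0..<m])) \<le> unit_ball_vol (real k) * (2 * real k * \<rho>) ^ k"
proof -
  have "AE z in PiM {..<m} (\<lambda>_. mark_law \<rho> \<Theta>). \<forall>j\<in>{..<m}. \<not> (z j \<in> span (z ` {..<j}) \<and> (1, 0) \<notin> span (z ` {..<j}))"
    using AE_span by (subst AE_ball_countable) auto
  then show ?thesis
  proof eventually_elim
    case (elim z)
    let ?c = "unit_ball_vol (real k) * (2 * real k * \<rho>) ^ k"
    have c: "0 \<le> ?c" using \<rho> by simp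
    show ?case
    proof (cases "section_of \<rho> (map z [0..<m]) = {}")
      case True
      then show ?thesis using c by (simp add: vol_def)
    next
      case False
      then obtain y where "y \<in> section_of \<rho> (map z [0..<m])" by blast
      then have y: "y \<bullet> snd (z i) = fst (z i)" if "i < m" for i using that by (simp add: mem_section_of)
      have "snd (z j) \<notin> span ((\<lambda>i. snd (z i)) ` {..<j})" if j: "j < m" for j
      proof
        assume "snd (z j) \<in> span ((\<lambda>i. snd (z i)) ` {..<j})"
        then obtain c where c: "snd (z j) = (\<Sum>i<j. c i *\<^sub>R snd (z i))" unfolding span_image_family by blast
        have "fst (z j) = y \<bullet> snd (z j)" using y[OF j] by simp
        also have "\<dots> = (\<Sum>i<j. c i * fst (z i))"
          unfolding c inner_sum_right using y j by (intro sum.cong) auto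
        finally have "z j = (\<Sum>i<j. c i *\<^sub>R z i)"
          using c by (simp add: prod_eq_iff fst_sum snd_sum)
        then have "z j \<in> span (z ` {..<j})" unfolding span_image_family by blast
        \<comment> \<open>All pairs satisfy p = \<langle>y, v\<rangle>, and so does their span; (1,
          0) does not.\<close>
        moreover have "(1, 0) \<notin> span (z ` {..<j})"
        proof
          assume "(1, 0) \<in> span (z ` {..<j})"
          then obtain d where d: "(1, 0) = (\<Sum>i<j. d i *\<^sub>R z i)" unfolding span_image_family by blast
          have "(1::real) = (\<Sum>i<j. d i * fst (z i))" using arg_cong[OF d, of fst] by (simp add: fst_sum)
          also have "\<dots> = (\<Sum>i<j. d i * (y \<bullet> snd (z i)))" using y j by (intro sum.cong) auto
          also have "\<dots> = y \<bullet> (\<Sum>i<j. d i *\<^sub>R snd (z i))" by (simp add: inner_sum_right)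
          also have "(\<Sum>i<j. d i *\<^sub>R snd (z i)) = 0" using arg_cong[OF d, of snd] by (simp add: snd_sum)
          finally show False by simp
        qed
        ultimately show False using elim j by auto
      qed
      then have ind: "independent ((\<lambda>i. snd (z i)) ` {..<m}) \<and> inj_on (\<lambda>i. snd (z i)) {..<m}"
        by (rule independent_family)
      have "section_of \<rho> (map z [0..<m]) = {y \<in> cball 0 \<rho>. \<forall>i<m. y \<bullet> snd (z i) = fst (z i)}"
        by (auto simp: mem_section_of)
      then have "hausdorff k (section_of \<rho> (map z [0..<m])) \<le> ennreal ?c"
        using hausdorff_section_bound[of m k "\<lambda>i. snd (z i)" \<rho> "\<lambda>i. fst (z i)"] ind m \<rho> by simp
      then show ?thesis unfolding vol_def by (rule enn2real_leI[OF c])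
    qed
  qed
qed

text \<open>The map (p, v) to (p \<rho> / r, v) carries the hyperplanes meeting the ball of radius r
  onto those meeting the ball of radius \<rho>. The mass of the intensity on the former is lam times
  2 r, and inside the window its normalized image is the uniform law times \<Theta>.\<close>

lemma poisson_on_window:
  assumes lam: "lam > 0" and r: "r > 0" and X: "poisson_process M (hyperplane_intensity lam \<Theta>) X"
  shows "poisson_on M (mark_law \<rho> \<Theta>) (window \<rho>) (2 * lam * r) (\<lambda>i w. (fst (X i w) * (\<rho> / r), snd (X i w)))"
proof -
  let ?\<Lambda> = "hyperplane_intensity lam \<Theta>" and ?\<kappa> = "mark_law \<rho> \<Theta>"
  interpret T: prob_space \<Theta> by (rule prob_space_orientation)
  interpret LT: pair_sigma_finite lborel \<Theta> ..
  define t where "t = (\<lambda>x :: real \<times> (real ^ 'n::{finite,linorder}). (fst x * (\<rho> / r), snd x))"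
  have sets\<Lambda>: "sets ?\<Lambda> = sets (lborel \<Otimes>\<^sub>M \<Theta>)" by (simp add: hyperplane_intensity_def)
  have space\<Lambda>: "space ?\<Lambda> = UNIV \<times> half_sphere"
    by (simp add: hyperplane_intensity_def space_scale_measure space_pair_measure space_orientation)
  have t_meas: "t \<in> measurable ?\<Lambda> ?\<kappa>"
  proof -
    have "t \<in> measurable (lborel \<Otimes>\<^sub>M \<Theta>) (lborel \<Otimes>\<^sub>M \<Theta>)"
      unfolding t_def by measurable
    then show ?thesis using measurable_cong_sets[OF sets\<Lambda> sets_mark_law] by blast
  qed
  have pre_sets: "t -` A \<in> sets ?\<Lambda>" if A: "A \<in> sets ?\<kappa>" for A
  proof -
    have "t -` A \<inter> space ?\<Lambda> = t -` A"
      using sets.sets_into_space[OF A] by (auto simp: space_mark_law space\<Lambda> t_def)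
    then show ?thesis using measurable_sets[OF t_meas A] by simp
  qed
  \<comment> \<open>Scaling by \<rho> / r multiplies Lebesgue measure of preimages by r / \<rho> = 2
    r / (2 \<rho>). The denominator is the normalization of the uniform law on [-\<rho>, \<rho>],
    and 2 r remains.\<close>
  have pre_measure: "emeasure ?\<Lambda> (t -` A) = ennreal (2 * lam * r) * emeasure ?\<kappa> A"
    if A: "A \<in> sets ?\<kappa>" "A \<subseteq> window \<rho>" for A
  proof -
    have "emeasure (lborel \<Otimes>\<^sub>M \<Theta>) (t -` A) = (\<integral>\<^sup>+v. emeasure lborel ((\<lambda>p. (p, v)) -` (t -` A)) \<partial>\<Theta>)"
      using pre_sets[OF A(1)] sets\<Lambda> by (intro LT.emeasure_pair_measure_alt2) simp
    also have "\<dots> = (\<integral>\<^sup>+v. ennreal (2 * r) * (emeasure lborel ({-\<rho>..\<rho>} \<inter> (\<lambda>p. (p, v)) -` A) / ennreal (2 * \<rho>)) \<partial>\<Theta>)"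
    proof (intro nn_integral_cong)
      fix v
      let ?B = "(\<lambda>p. (p, v)) -` A"
      have B: "?B \<in> sets borel"
        using sets_Pair2[OF A(1)[unfolded mark_law_def], of v] by (simp only: sets_uniform_measure sets_lborel)
      have BW: "{-\<rho>..\<rho>} \<inter> ?B = ?B" using A(2) by (auto simp: window_def)
      have s: "\<rho> / r \<noteq> 0" "\<rho> / r > 0" using \<rho> r by auto
      have pre: "(\<lambda>p. (p, v)) -` (t -` A) = (*) (\<rho> / r) -` ?B"
        unfolding t_def vimage_def by (simp add: mult.commute)
      have "emeasure (distr lborel borel ((*) (\<rho> / r))) ?B = emeasure lborel ((*) (\<rho> / r) -` ?B \<inter> space lborel)"
        using B by (intro emeasure_distr) auto
      then have "emeasure lborel ((\<lambda>p. (p, v)) -` (t -` A)) = emeasure (distr lborel borel ((*) (\<rho> / r))) ?B"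
        unfolding pre space_lborel space_borel Int_UNIV_right by (rule sym)
      also have "\<dots> = emeasure (density lborel (\<lambda>_. inverse \<bar>\<rho> / r\<bar>)) ?B"
        by (subst lborel_distr_mult[OF s(1)]) simp
      also have "\<dots> = ennreal (r / \<rho>) * emeasure lborel ?B"
        using B s(2) \<rho> r by (subst emeasure_density_const) auto
      also have "ennreal (r / \<rho>) = ennreal (2 * r) / ennreal (2 * \<rho>)"
        using \<rho> r by (subst divide_ennreal) auto
      finally show "emeasure lborel ((\<lambda>p. (p, v)) -` (t -` A)) =
          ennreal (2 * r) * (emeasure lborel ({-\<rho>..\<rho>} \<inter> ?B) / ennreal (2 * \<rho>))"
        unfolding BW by (simp add: divide_ennreal_def mult_ac)
    qed
    also have "\<dots> = ennreal (2 * r) * emeasure ?\<kappa> A"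
      unfolding emeasure_mark_law[OF A(1)]
    proof (rule nn_integral_cmult)
      show "(\<lambda>v. emeasure lborel ({-\<rho>..\<rho>} \<inter> (\<lambda>p. (p, v)) -` A) / ennreal (2 * \<rho>)) \<in> borel_measurable \<Theta>"
      proof -
        have "({-\<rho>..\<rho>} \<times> space \<Theta>) \<inter> A \<in> sets (lborel \<Otimes>\<^sub>M \<Theta>)"
          using A(1) by (intro sets.Int pair_measureI) (auto simp: sets_mark_law)
        from LT.measurable_emeasure_Pair2[OF this]
        have "(\<lambda>v. emeasure lborel ((\<lambda>p. (p, v)) -` (({-\<rho>..\<rho>} \<times> space \<Theta>) \<inter> A))) \<in> borel_measurable \<Theta>" .
        moreover have "(\<lambda>p. (p, v)) -` (({-\<rho>..\<rho>} \<times> space \<Theta>) \<inter> A) = {-\<rho>..\<rho>} \<inter> (\<lambda>p. (p, v)) -` A" if "v \<in> space \<Theta>" for v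
          using that by auto
        ultimately have "(\<lambda>v. emeasure lborel ({-\<rho>..\<rho>} \<inter> (\<lambda>p. (p, v)) -` A)) \<in> borel_measurable \<Theta>"
          by (simp cong: measurable_cong)
        then show ?thesis by measurable
      qed
    qed
    finally have *: "emeasure (lborel \<Otimes>\<^sub>M \<Theta>) (t -` A) = ennreal (2 * r) * emeasure ?\<kappa> A" .
    have "2 * lam * r = lam * (2 * r)" by simp
    then have "ennreal (2 * lam * r) = ennreal lam * ennreal (2 * r)"
      using lam r by (metis ennreal_mult less_eq_real_def mult_pos_pos zero_less_numeral)
    then show ?thesis
      unfolding hyperplane_intensity_def emeasure_scale_measure * by (simp only: mult.assoc)
  qed
  have count: "point_count (\<lambda>i w. (fst (X i w) * (\<rho> / r), snd (X i w))) A = point_count X (t -` A)" for A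
    by (simp add: point_count_def fun_eq_iff t_def)
  note X' = X[unfolded poisson_process_def]
  have counts: "measure M {w \<in> space M. point_count X A w = of_nat n} = exp (- measure ?\<Lambda> A) * measure ?\<Lambda> A ^ n / fact n"
    if "A \<in> sets ?\<Lambda>" "emeasure ?\<Lambda> A < \<infinity>" for A and n :: nat
    using X' that by blast
  interpret M: prob_space M using X' by blast
  interpret K: prob_space ?\<kappa> by (rule prob_space_mark_law)
  show ?thesis
    unfolding poisson_on_def poisson_on_axioms_def
  proof (intro conjI allI impI)
    show "prob_space M" by (rule M.prob_space_axioms)
    show "prob_space ?\<kappa>" by (rule K.prob_space_axioms)
    show "0 \<le> 2 * lam * r" using lam r by simp
    show "window \<rho> \<in> sets ?\<kappa>" by (rule window_sets)
    show "emeasure ?\<kappa> (window \<rho>) = 1" by (rule emeasure_window)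
    show "(\<lambda>w. (fst (X i w) * (\<rho> / r), snd (X i w))) \<in> measurable M ?\<kappa>" for i
    proof -
      have "X i \<in> measurable M ?\<Lambda>" using X' by blast
      from measurable_compose[OF this t_meas] show ?thesis by (simp add: t_def)
    qed
  next
    fix A and n :: nat assume A: "A \<in> sets ?\<kappa>" "A \<subseteq> window \<rho>"
    have em: "emeasure ?\<Lambda> (t -` A) = ennreal (2 * lam * r * measure ?\<kappa> A)"
      unfolding pre_measure[OF A] K.emeasure_eq_measure using lam r by (simp add: ennreal_mult)
    then have "measure ?\<Lambda> (t -` A) = 2 * lam * r * measure ?\<kappa> A"
      using lam r by (simp add: measure_def)
    moreover have "emeasure ?\<Lambda> (t -` A) < \<infinity>" unfolding em by simp
    ultimately show "measure M {w \<in> space M. point_count (\<lambda>i w. (fst (X i w) * (\<rho> / r), snd (X i w))) A w = of_nat n} =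
        exp (- (2 * lam * r * measure ?\<kappa> A)) * (2 * lam * r * measure ?\<kappa> A) ^ n / fact n"
      unfolding count using counts[OF pre_sets[OF A(1)], of n] by simp
  next
    fix n and A :: "nat \<Rightarrow> (real \<times> (real ^ 'n::{finite,linorder})) set"
    assume A: "A ` {..<n} \<subseteq> sets ?\<kappa>" "disjoint_family_on A {..<n}"
    have "(\<lambda>j. t -` A j) ` {..<n} \<subseteq> sets ?\<Lambda>" using pre_sets A(1) by auto
    moreover have "disjoint_family_on (\<lambda>j. t -` A j) {..<n}"
      using A(2) unfolding disjoint_family_on_def by (metis Int_emptyI disjoint_iff vimage_eq)
    ultimately have "M.indep_vars (\<lambda>_. borel) (\<lambda>j. point_count X (t -` A j)) {..<n}"
      using X' by blast
    then show "M.indep_vars (\<lambda>_. borel) (\<lambda>j. point_count (\<lambda>i w. (fst (X i w) * (\<rho> / r), snd (X i w))) (A j)) {..<n}"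
      unfolding count .
  qed
qed

end

section \<open>The functionals of the intersection process as U-statistics\<close>

text \<open>Valid without summability: in the divergent case the infinite sum is 0 by default, and
  so is the real value of an infinite integral. Measurability of integrals over the countable index
  type then carries over to \<open>infsum\<close>.\<close>

lemma infsum_eq_nn_integral:
  fixes f :: "'c \<Rightarrow> real"
  assumes nn: "\<And>c. c \<in> A \<Longrightarrow> 0 \<le> f c"
  shows "infsum f A = enn2real (\<integral>\<^sup>+c. ennreal (f c) \<partial>count_space A)"
proof (cases "f summable_on A")
  case True
  then have "Infinite_Sum.abs_summable_on f A"
    by (rule summable_on_iff_abs_summable_on_real[THEN iffD1])
  then have a: "Infinite_Set_Sum.abs_summable_on f A"
    by (rule abs_summable_equivalent[THEN iffD1])
  have "(\<integral>\<^sup>+c. ennreal (f c) \<partial>count_space A) = ennreal (infsetsum f A)"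
    by (rule nn_integral_conv_infsetsum[OF a]) (rule nn)
  also have "infsetsum f A = infsum f A"
    by (rule infsetsum_infsum[OF a])
  finally show ?thesis using infsum_nonneg[of A f] nn by simp
next
  case False
  have "(\<integral>\<^sup>+c. ennreal (f c) \<partial>count_space A) = \<infinity>"
  proof (rule ccontr)
    assume "(\<integral>\<^sup>+c. ennreal (f c) \<partial>count_space A) \<noteq> \<infinity>"
    then have "integrable (count_space A) f"
      using nn by (intro integrableI_nonneg) (auto simp: less_top AE_count_space)
    then have "Infinite_Set_Sum.abs_summable_on f A" by (simp add: abs_summable_on_def)
    then have "Infinite_Sum.abs_summable_on f A" by (rule abs_summable_equivalent[THEN iffD2])
    then have "f summable_on A" by (rule summable_on_iff_abs_summable_on_real[THEN iffD2])
    with False show False by simp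
  qed
  then show ?thesis using False by (simp add: infsum_not_exists)
qed

lemma borel_measurable_infsum:
  fixes f :: "'c::countable \<Rightarrow> 'w \<Rightarrow> real"
  assumes f[measurable]: "\<And>c. c \<in> A \<Longrightarrow> f c \<in> borel_measurable M" and nn: "\<And>c w. c \<in> A \<Longrightarrow> 0 \<le> f c w"
  shows "(\<lambda>w. \<Sum>\<^sub>\<infinity>c\<in>A. f c w) \<in> borel_measurable M"
proof -
  have "(\<lambda>w. ennreal (if c \<in> A then f c w else 0)) \<in> borel_measurable M" for c
    by (cases "c \<in> A") auto
  then have "(\<lambda>w. \<integral>\<^sup>+c. ennreal (if c \<in> A then f c w else 0) \<partial>count_space UNIV) \<in> borel_measurable M"
    by (rule borel_measurable_nn_integral_countable)
  then have "(\<lambda>w. enn2real (\<integral>\<^sup>+c. ennreal (if c \<in> A then f c w else 0) \<partial>count_space UNIV)) \<in> borel_measurable M"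
    by measurable
  moreover have "(\<Sum>\<^sub>\<infinity>c\<in>A. f c w) = enn2real (\<integral>\<^sup>+c. ennreal (if c \<in> A then f c w else 0) \<partial>count_space UNIV)" for w
  proof -
    have "(\<Sum>\<^sub>\<infinity>c\<in>A. f c w) = enn2real (\<integral>\<^sup>+c. ennreal (f c w) \<partial>count_space A)"
      by (rule infsum_eq_nn_integral) (rule nn)
    also have "(\<integral>\<^sup>+c. ennreal (f c w) \<partial>count_space A) = (\<integral>\<^sup>+c. ennreal (f c w) * indicator A c \<partial>count_space UNIV)"
      by (simp add: nn_integral_count_space_indicator)
    also have "\<dots> = (\<integral>\<^sup>+c. ennreal (if c \<in> A then f c w else 0) \<partial>count_space UNIV)"
      by (intro nn_integral_cong) (auto simp: indicator_def)
    finally show ?thesis .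
  qed
  ultimately show ?thesis by simp
qed

lemma pos_less: "pos (i :: 'n::{finite,linorder}) < CARD('n)"
  unfolding pos_def by (rule psubset_card_mono) auto

lemma flat_section_scale:
  fixes x :: "nat \<Rightarrow> real \<times> (real ^ 'n)"
  assumes "r > 0" "\<rho> > 0"
  shows "flat_section r x (set js) = (*\<^sub>R) (r / \<rho>) ` section_of \<rho> (map (\<lambda>i. (fst (x i) * (\<rho> / r), snd (x i))) js)"
proof (intro equalityI subsetI)
  fix y assume y: "y \<in> flat_section r x (set js)"
  have "(\<rho> / r) *\<^sub>R y \<in> section_of \<rho> (map (\<lambda>i. (fst (x i) * (\<rho> / r), snd (x i))) js)"
  proof -
    have "norm y \<le> r" using y by (auto simp: flat_section_def)
    then have "\<rho> / r * norm y \<le> \<rho> / r * r" using assms by (intro mult_left_mono) auto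
    then have "norm ((\<rho> / r) *\<^sub>R y) \<le> \<rho>" using assms by simp
    moreover have "((\<rho> / r) *\<^sub>R y) \<bullet> snd (x i) = fst (x i) * (\<rho> / r)" if "i \<in> set js" for i
      using y that by (auto simp: flat_section_def hyperplane_def)
    ultimately show ?thesis by (auto simp: section_of_def hyperplane_def)
  qed
  moreover have "y = (r / \<rho>) *\<^sub>R ((\<rho> / r) *\<^sub>R y)" using assms by simp
  ultimately show "y \<in> (*\<^sub>R) (r / \<rho>) ` section_of \<rho> (map (\<lambda>i. (fst (x i) * (\<rho> / r), snd (x i))) js)" by (rule rev_image_eqI)
next
  fix y assume "y \<in> (*\<^sub>R) (r / \<rho>) ` section_of \<rho> (map (\<lambda>i. (fst (x i) * (\<rho> / r), snd (x i))) js)"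
  then obtain u where u: "u \<in> section_of \<rho> (map (\<lambda>i. (fst (x i) * (\<rho> / r), snd (x i))) js)" "y = (r / \<rho>) *\<^sub>R u" by blast
  have "norm u \<le> \<rho>" using u by (auto simp: section_of_def)
  then have "r / \<rho> * norm u \<le> r / \<rho> * \<rho>" using assms by (intro mult_left_mono) auto
  then have "norm y \<le> r" using assms u(2) by simp
  moreover have "y \<bullet> snd (x i) = fst (x i)" if "i \<in> set js" for i
  proof -
    have "u \<bullet> snd (x i) = fst (x i) * (\<rho> / r)" using u(1) that by (auto simp: section_of_def hyperplane_def)
    then show ?thesis using u(2) assms by simp
  qed
  ultimately show "y \<in> flat_section r x (set js)" by (auto simp: flat_section_def hyperplane_def)
qed

text \<open>By Cauchy-Schwarz, a hyperplane with unit normal and offset larger than \<rho> in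
  absolute value misses the ball. This makes the sums over all lists effectively finite.\<close>

lemma section_of_outside_window:
  fixes xs :: "(real \<times> (real ^ 'n::{finite,linorder})) list"
  assumes "x \<in> set xs" "snd x \<in> half_sphere" "x \<notin> window \<rho>"
  shows "section_of \<rho> xs = {}"
proof (rule ccontr)
  assume "section_of \<rho> xs \<noteq> {}"
  then obtain y where y: "y \<bullet> snd x = fst x" "norm y \<le> \<rho>"
    using assms(1) unfolding section_of_def hyperplane_def by fastforce
  have "norm (snd x) = 1" using assms(2) by (simp add: half_sphere_def)
  then have "\<bar>fst x\<bar> \<le> \<rho>" using Cauchy_Schwarz_ineq2[of y "snd x"] y by simp
  then have "x \<in> window \<rho>" using assms(2) by (cases x) (auto simp: window_def abs_le_iff)
  with assms(3) show False by simp
qed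

text \<open>Both halves of the theorem at once, for functionals \<phi> k that vanish on the empty
  set, are homogeneous of degree \<open>s k\<close> and almost surely bounded on sections. Rescaling
  to radius \<rho> identifies the normalized functional almost surely with \<open>normalized\<close>
  of a fixed kernel, so \<open>poisson_clt\<close> applies, and \<open>integral_overlap\<close>
  recognizes its covariances as \<sigma>.\<close>

theorem intersection_clt:
  fixes M :: "'w measure" and X :: "nat \<Rightarrow> 'w \<Rightarrow> real \<times> (real ^ 'n::{finite,linorder})"
    and \<Theta> :: "(real ^ 'n::{finite,linorder}) measure" and \<phi> :: "nat \<Rightarrow> (real ^ 'n::{finite,linorder}) set \<Rightarrow> real" and s :: "nat \<Rightarrow> nat"
    and lam \<rho> C :: real
  assumes lam: "lam > 0" and \<Theta>: "orientation_distribution \<Theta>" and \<rho>: "\<rho> > 0"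
    and X: "poisson_process M (hyperplane_intensity lam \<Theta>) X"
    and \<phi>_empty: "\<And>k. \<phi> k {} = 0" and \<phi>_nonneg: "\<And>k S. 0 \<le> \<phi> k S"
    and \<phi>_meas: "\<And>k m. (\<lambda>x :: nat \<Rightarrow> real \<times> (real ^ 'n::{finite,linorder}). \<phi> k (section_of \<rho> (map x [0..<m]))) \<in> borel_measurable borel"
    and \<phi>_scale: "\<And>k c S. c > 0 \<Longrightarrow> \<phi> k ((*\<^sub>R) c ` S) = c ^ s k * \<phi> k S"
    and \<phi>_bound: "\<And>k. k < CARD('n) \<Longrightarrow> AE z in PiM {..<CARD('n) - k} (\<lambda>_. mark_law \<rho> \<Theta>).
      \<phi> k (section_of \<rho> (map z [0..<CARD('n) - k])) \<le> C * \<rho> ^ s k"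
    and C: "0 \<le> C"
  defines "stat \<equiv> \<lambda>k r x. 1 / fact (CARD('n) - k) *
      (\<Sum>\<^sub>\<infinity>js\<in>{js. length js = CARD('n) - k \<and> distinct js}. \<phi> k (flat_section r x (set js)))"
  defines "Z \<equiv> \<lambda>k r w. fact (CARD('n) - k - 1) * r powi (- int (s k)) / (2 * lam * r) powr (real CARD('n) - real k - 1 / 2) *
      (stat k r (\<lambda>i. X i w) - (\<integral>w'. stat k r (\<lambda>i. X i w') \<partial>M))"
  defines "\<sigma> \<equiv> \<lambda>k l. \<rho> powi (- int (s k + s l)) *
      (\<integral>x. \<phi> k (flat_section \<rho> x {1..CARD('n) - k}) * \<phi> l (flat_section \<rho> x {CARD('n) - k..2 * CARD('n) - k - l - 1}) \<partial>iid_law \<rho> \<Theta>)"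
  shows "\<exists>N :: (real ^ 'n::{finite,linorder}) measure. gaussian_law 0 (mat_of \<sigma>) N \<and>
    converges_in_distribution M (\<lambda>r w. vec_of (\<lambda>k. Z k r w)) N at_top"
proof -
  let ?d = "CARD('n)" and ?\<kappa> = "mark_law \<rho> \<Theta>"
  interpret K: prob_space ?\<kappa> by (rule prob_space_mark_law[OF \<Theta> \<rho>])
  interpret M: prob_space M using X by (simp add: poisson_process_def)
  define Y where "Y = (\<lambda>r i w. (fst (X i w) * (\<rho> / r), snd (X i w)))"
  \<comment> \<open>Truncation at C makes the kernel bounded everywhere; by
    \<open>\<phi>_bound\<close> it changes values only on a null set of arguments. Dividing by
    \<rho>^(s k) makes the value of \<phi> on the original section equal to r^(s k) times h.\<close>
  define h where "h = (\<lambda>k xs. min (\<phi> k (section_of \<rho> xs) / \<rho> ^ s k) C)"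
  have po: "poisson_on M ?\<kappa> (window \<rho>) (2 * lam * r) (Y r)" if "r > 0" for r
    unfolding Y_def by (rule poisson_on_window[OF \<Theta> \<rho> lam that X])
  have \<phi>_kappa: "(\<lambda>z. \<phi> k (section_of \<rho> (map z [0..<m]))) \<in> borel_measurable (PiM {..<m} (\<lambda>_. ?\<kappa>))" for k m
    by (rule measurable_section_functional[OF \<phi>_meas mark_law_borel[OF \<Theta> \<rho>]])
  have ker: "kernel ?\<kappa> (?d - k) C (h k)" if k: "k < ?d" for k
    unfolding kernel_def
  proof (intro conjI allI impI)
    show "1 \<le> ?d - k" using k by simp
    note [measurable] = \<phi>_kappa[of k "?d - k"]
    show "(\<lambda>z. h k (map z [0..<?d - k])) \<in> borel_measurable (PiM {..<?d - k} (\<lambda>_. ?\<kappa>))"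
      unfolding h_def by measurable
    show "0 \<le> h k xs" for xs using \<phi>_nonneg \<rho> C by (simp add: h_def)
    show "h k xs \<le> C" for xs by (simp add: h_def)
    show "h k xs = h k ys" if "mset xs = mset ys" for xs ys
      using mset_eq_setD[OF that] by (simp add: h_def section_of_def)
  qed
  have h_eq: "\<phi> k (section_of \<rho> xs) = \<rho> ^ s k * h k xs" if "\<phi> k (section_of \<rho> xs) \<le> C * \<rho> ^ s k" for k xs
  proof -
    have "\<phi> k (section_of \<rho> xs) / \<rho> ^ s k \<le> C" using that \<rho> by (simp add: divide_le_eq)
    then show ?thesis using \<rho> by (simp add: h_def min_def)
  qed
  have X_half: "snd (X i w) \<in> half_sphere" if "w \<in> space M" for i w
  proof -
    have "X i \<in> measurable M (hyperplane_intensity lam \<Theta>)" using X by (simp add: poisson_process_def)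
    from measurable_space[OF this that] show ?thesis
      by (auto simp: hyperplane_intensity_def space_scale_measure space_pair_measure space_orientation[OF \<Theta> \<rho>])
  qed
  have scaled: "\<phi> k (flat_section r (\<lambda>i. X i w) (set js)) = (r / \<rho>) ^ s k * \<phi> k (section_of \<rho> (map (\<lambda>i. Y r i w) js))"
    if "r > 0" for k r js w
    unfolding flat_section_scale[OF that \<rho>] Y_def using that \<rho> by (intro \<phi>_scale) simp
  have stat_meas: "(\<lambda>w. stat k r (\<lambda>i. X i w)) \<in> borel_measurable M" if r: "r > 0" for k r
  proof -
    have "(\<lambda>w. \<phi> k (flat_section r (\<lambda>i. X i w) (set js))) \<in> borel_measurable M" for js
    proof -
      have Ym: "Y r i \<in> measurable M ?\<kappa>" for i using poisson_on.Y_meas[OF po[OF r]] .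
      have "(\<lambda>w. \<phi> k (section_of \<rho> (map (\<lambda>j. Y r (js ! j) w) [0..<length js]))) \<in> borel_measurable M"
        by (rule measurable_on_list[where F = "\<lambda>xs. \<phi> k (section_of \<rho> xs)", OF \<phi>_kappa]) (rule Ym)
      moreover have "map (\<lambda>j. Y r (js ! j) w) [0..<length js] = map (\<lambda>i. Y r i w) js" for w
        by (rule nth_equalityI) auto
      ultimately show ?thesis unfolding scaled[OF r] by simp
    qed
    then show ?thesis unfolding stat_def using \<phi>_nonneg
      by (intro borel_measurable_times borel_measurable_const borel_measurable_infsum) auto
  qed
  have stat_eq: "AE w in M. stat k r (\<lambda>i. X i w) = r ^ s k / fact (?d - k) * poisson_on.usum (window \<rho>) (Y r) (?d - k) (h k) w"
    if r: "r > 0" and k: "k < ?d" for k r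
  proof -
    interpret P: poisson_on M ?\<kappa> "window \<rho>" "2 * lam * r" "Y r" by (rule po[OF r])
    let ?m = "?d - k"
    \<comment> \<open>Transfers a null set of the product law to the random points: this indicator
      kernel has integral 0, so by the Campbell formula its nonnegative U-statistic has mean 0 and
      vanishes almost surely. Hence the truncation is inactive at every list of window
      points.\<close>
    define bad where "bad = (\<lambda>xs. if \<phi> k (section_of \<rho> xs) \<le> C * \<rho> ^ s k then 0 else 1 :: real)"
    note [measurable] = \<phi>_kappa[of k ?m]
    have bad_meas: "(\<lambda>z. bad (map z [0..<?m])) \<in> borel_measurable (PiM {..<?m} (\<lambda>_. ?\<kappa>))"
      unfolding bad_def by measurable
    have bad_le: "norm (bad xs) \<le> 1" for xs by (simp add: bad_def)
    have "(\<integral>z. bad (map z [0..<?m]) \<partial>PiM {..<?m} (\<lambda>_. ?\<kappa>)) = (\<integral>z. 0 \<partial>PiM {..<?m} (\<lambda>_. ?\<kappa>))"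
      using bad_meas \<phi>_bound[OF k] by (intro integral_cong_AE) (auto simp: bad_def elim: eventually_mono)
    then have "(\<integral>w. P.usum ?m bad w \<partial>M) = 0"
      using P.usum_integral[OF bad_meas bad_le] by simp
    then have ae0: "AE w in M. P.usum ?m bad w = 0"
      using P.usum_integrable[OF bad_meas bad_le]
      by (subst (asm) integral_nonneg_eq_0_iff_AE) (auto simp: P.usum_def bad_def intro!: sum_nonneg)
    show ?thesis
      using ae0 P.AE_finite_idx[OF P.W_sets subset_refl] AE_space
    proof eventually_elim
      case (elim w)
      let ?D = "dlists ?m (P.idx (window \<rho>) w)"
      have finD: "finite ?D" using elim(2) by (rule finite_dlists)
      have good: "\<phi> k (section_of \<rho> (map (\<lambda>i. Y r i w) js)) = \<rho> ^ s k * h k (map (\<lambda>i. Y r i w) js)" if "js \<in> ?D" for js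
      proof (rule h_eq)
        have "(\<Sum>js\<in>?D. bad (map (\<lambda>i. Y r i w) js)) = 0" using elim(1,2) by (simp add: P.usum_def)
        then have "bad (map (\<lambda>i. Y r i w) js) = 0"
          using finD that by (subst (asm) sum_nonneg_eq_0_iff) (auto simp: bad_def)
        then show "\<phi> k (section_of \<rho> (map (\<lambda>i. Y r i w) js)) \<le> C * \<rho> ^ s k"
          by (simp add: bad_def split: if_splits)
      qed
      have "(\<Sum>\<^sub>\<infinity>js\<in>{js. length js = ?m \<and> distinct js}. \<phi> k (flat_section r (\<lambda>i. X i w) (set js))) =
          (\<Sum>\<^sub>\<infinity>js\<in>?D. (r / \<rho>) ^ s k * \<phi> k (section_of \<rho> (map (\<lambda>i. Y r i w) js)))"
      \<comment> \<open>A list outside \<open>?D\<close> has an entry whose hyperplane misses the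
        ball; its section is empty and contributes 0.\<close>
      proof (rule infsum_cong_neutral)
        fix js assume "js \<in> {js. length js = ?m \<and> distinct js} - ?D"
        then obtain i where i: "i \<in> set js" "Y r i w \<notin> window \<rho>" by (auto simp: dlists_def P.idx_def)
        have "section_of \<rho> (map (\<lambda>i. Y r i w) js) = {}"
          using i X_half[OF elim(3), of i] by (intro section_of_outside_window[of "Y r i w"]) (auto simp: Y_def)
        then show "\<phi> k (flat_section r (\<lambda>i. X i w) (set js)) = 0"
          unfolding scaled[OF r] by (simp add: \<phi>_empty)
      qed (auto simp: dlists_def scaled[OF r])
      also have "\<dots> = (\<Sum>js\<in>?D. (r / \<rho>) ^ s k * \<phi> k (section_of \<rho> (map (\<lambda>i. Y r i w) js)))"
        by (rule infsum_finite[OF finD])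
      also have "\<dots> = (\<Sum>js\<in>?D. r ^ s k * h k (map (\<lambda>i. Y r i w) js))"
        using good \<rho> by (intro sum.cong refl) (simp add: power_divide)
      also have "\<dots> = r ^ s k * P.usum ?m (h k) w"
        using elim(2) by (simp add: P.usum_def sum_distrib_left)
      finally show ?case unfolding stat_def by simp
    qed
  qed
  have Z_meas: "(\<lambda>w. Z k r w) \<in> borel_measurable M" if "r > 0" for k r
    unfolding Z_def by (intro borel_measurable_times borel_measurable_diff borel_measurable_const stat_meas[OF that])
  have Z_eq: "AE w in M. Z k r w = poisson_on.normalized ?\<kappa> (window \<rho>) (2 * lam * r) (Y r) (?d - k) (h k) w"
    if r: "r > 0" and k: "k < ?d" for k r
  proof -
    interpret P: poisson_on M ?\<kappa> "window \<rho>" "2 * lam * r" "Y r" by (rule po[OF r])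
    let ?m = "?d - k" and ?\<mu> = "2 * lam * r"
    have \<mu>: "?\<mu> > 0" using lam r by simp
    note us = P.usum_kernel[OF ker[OF k]]
    have E: "(\<integral>w. stat k r (\<lambda>i. X i w) \<partial>M) = r ^ s k / fact ?m * (?\<mu> ^ ?m * theta ?\<kappa> ?m (h k))"
    proof -
      have "(\<integral>w. stat k r (\<lambda>i. X i w) \<partial>M) = (\<integral>w. r ^ s k / fact ?m * P.usum ?m (h k) w \<partial>M)"
        using stat_eq[OF r k] us(1) by (intro integral_cong_AE stat_meas[OF r] borel_measurable_times borel_measurable_const) auto
      also have "\<dots> = r ^ s k / fact ?m * (\<integral>w. P.usum ?m (h k) w \<partial>M)" by (rule integral_mult_right_zero)
      finally show ?thesis unfolding us(3) .
    qed
    obtain p where p: "?m = Suc p" using k by (metis Suc_diff_Suc)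
    \<comment> \<open>The exponent d - k - 1/2 is (m - 1) + 1/2, matching the divisor \<mu>^(m - 1)
      sqrt \<mu> of \<open>normalized\<close>.\<close>
    have pw: "?\<mu> powr (real ?d - real k - 1 / 2) = ?\<mu> ^ p * sqrt ?\<mu>"
    proof -
      have "real ?d - real k = real ?m" using k by simp
      then have "real ?d - real k - 1 / 2 = real p + 1 / 2" unfolding p by simp
      then have "?\<mu> powr (real ?d - real k - 1 / 2) = ?\<mu> powr (real p + 1 / 2)" by (simp only:)
      also have "\<dots> = ?\<mu> powr real p * ?\<mu> powr (1 / 2)" by (rule powr_add)
      finally show ?thesis using \<mu> by (simp add: powr_realpow powr_half_sqrt)
    qed
    have rs: "r powi (- int (s k)) = 1 / r ^ s k" by (simp add: power_int_minus divide_inverse)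
    \<comment> \<open>With a the power of r, the factors a and 1 / a cancel, and (m - 1)! / m!
      supplies the 1 / m of \<open>normalized\<close>.\<close>
    have final: "fact (?m - 1) * (1 / a) / (b * q) * (a / fact ?m * u - a / fact ?m * v) = (u - v) / (real ?m * b * q)"
      if "a \<noteq> 0" for a b q u v :: real
    proof -
      have f: "fact ?m = real ?m * fact (?m - 1)" unfolding p by simp
      have m0: "real ?m \<noteq> 0" "fact (?m - 1) \<noteq> (0::real)" using p by auto
      have "a / fact ?m * u - a / fact ?m * v = a * (u - v) / fact ?m"
        by (simp add: diff_divide_distrib right_diff_distrib)
      then have "fact (?m - 1) * (1 / a) / (b * q) * (a / fact ?m * u - a / fact ?m * v) =
          (fact (?m - 1) / fact ?m) * (a / a) * ((u - v) / (b * q))" by (simp add: mult_ac)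
      also have "\<dots> = (1 / real ?m) * ((u - v) / (b * q))" unfolding f using m0 that by simp
      finally show ?thesis by (simp add: mult_ac)
    qed
    show ?thesis
      using stat_eq[OF r k]
    proof eventually_elim
      case (elim w)
      show ?case
        unfolding Z_def E elim pw rs P.normalized_def p[symmetric]
        using final[of "r ^ s k" "?\<mu> ^ p" "sqrt ?\<mu>" "P.usum ?m (h k) w" "?\<mu> ^ ?m * theta ?\<kappa> ?m (h k)"] r
        unfolding p by simp
    qed
  qed
  have \<sigma>_eq: "\<sigma> k l = (\<integral>x. proj ?\<kappa> (?d - k) (h k) x * proj ?\<kappa> (?d - l) (h l) x \<partial>?\<kappa>)"
    if k: "k < ?d" and l: "l < ?d" for k l
  proof -
    let ?m = "?d - k" and ?n = "?d - l"
    \<comment> \<open>Indices 1 to m and m to m + n - 1: the lists share exactly the index m, as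
      \<open>integral_overlap\<close> requires.\<close>
    define as bs where "as = [1..<Suc ?m]" and "bs = [?m..<?m + ?n]"
    have mn: "?m \<ge> 1" "?n \<ge> 1" using k l by auto
    have sets: "{1..?m} = set as" "{?m..2 * ?d - k - l - 1} = set bs"
      using k l by (auto simp: as_def bs_def)
    have len: "length as = ?m" "length bs = ?n" unfolding as_def bs_def length_upt by simp_all
    have dist: "distinct as" "distinct bs" unfolding as_def bs_def by (rule distinct_upt)+
    have int: "set as \<inter> set bs = {?m}" using mn by (auto simp: as_def bs_def)
    let ?I = "PiM (UNIV :: nat set) (\<lambda>_. ?\<kappa>)"
    have iid: "iid_law \<rho> \<Theta> = ?I" by (simp add: iid_law_def mark_law_def)
    have F: "(\<lambda>x. \<phi> k (section_of \<rho> (map x js))) \<in> borel_measurable ?I" for k and js :: "nat list"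
      by (rule measurable_map_list[where F = "\<lambda>xs. \<phi> k (section_of \<rho> xs)", OF \<phi>_kappa]) simp
    have H: "(\<lambda>x. h k (map x js)) \<in> borel_measurable ?I" for k and js :: "nat list"
      unfolding h_def by (intro borel_measurable_min borel_measurable_divide borel_measurable_const F)
    have AE_bd: "AE x in ?I. \<phi> k (section_of \<rho> (map x js)) = \<rho> ^ s k * h k (map x js)"
      if "k < ?d" "distinct js" "length js = ?d - k" for k and js :: "nat list"
    proof -
      let ?t = "\<lambda>x. \<lambda>n\<in>{..<length js}. x (js ! n)"
      let ?Q = "\<lambda>z. \<phi> k (section_of \<rho> (map z [0..<length js])) \<le> C * \<rho> ^ s k"
      have t: "?t \<in> measurable ?I (PiM {..<length js} (\<lambda>_. ?\<kappa>))"
        by (intro measurable_restrict measurable_component_singleton) simp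
      have d: "distr ?I (PiM {..<length js} (\<lambda>_. ?\<kappa>)) ?t = PiM {..<length js} (\<lambda>_. ?\<kappa>)"
        using that by (intro distr_PiM_reindex K.prob_space_axioms) (auto simp: inj_on_def nth_eq_iff_index_eq)
      note [measurable] = \<phi>_kappa[of k "length js"]
      have "AE z in distr ?I (PiM {..<length js} (\<lambda>_. ?\<kappa>)) ?t. ?Q z"
        unfolding d unfolding that(3) by (rule \<phi>_bound[OF that(1)])
      then have "AE x in ?I. ?Q (?t x)"
        using AE_distrD[OF t] by blast
      then show ?thesis
      proof eventually_elim
        case (elim x)
        have "map (?t x) [0..<length js] = map x js" by (rule nth_equalityI) auto
        then show ?case using elim by (intro h_eq) simp
      qed
    qed
    have "(\<integral>x. \<phi> k (flat_section \<rho> x {1..?m}) * \<phi> l (flat_section \<rho> x {?m..2 * ?d - k - l - 1}) \<partial>iid_law \<rho> \<Theta>) =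
        (\<integral>x. \<phi> k (section_of \<rho> (map x as)) * \<phi> l (section_of \<rho> (map x bs)) \<partial>?I)"
      unfolding iid sets flat_section_eq ..
    also have "\<dots> = (\<integral>x. \<rho> ^ (s k + s l) * (h k (map x as) * h l (map x bs)) \<partial>?I)"
    proof (rule integral_cong_AE)
      show "AE x in ?I. \<phi> k (section_of \<rho> (map x as)) * \<phi> l (section_of \<rho> (map x bs)) = \<rho> ^ (s k + s l) * (h k (map x as) * h l (map x bs))"
        using AE_bd[OF k dist(1) len(1)] AE_bd[OF l dist(2) len(2)]
        by eventually_elim (simp add: power_add)
    qed (intro borel_measurable_times borel_measurable_const F H)+
    also have "\<dots> = \<rho> ^ (s k + s l) * (\<integral>x. h k (map x as) * h l (map x bs) \<partial>?I)"
      by (rule integral_mult_right_zero)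
    also have "(\<integral>x. h k (map x as) * h l (map x bs) \<partial>?I) = (\<integral>x. proj ?\<kappa> ?m (h k) x * proj ?\<kappa> ?n (h l) x \<partial>?\<kappa>)"
      by (rule K.integral_overlap[OF ker[OF k] ker[OF l] dist(1) len(1) dist(2) len(2) int]) simp
    finally have E: "(\<integral>x. \<phi> k (flat_section \<rho> x {1..?m}) * \<phi> l (flat_section \<rho> x {?m..2 * ?d - k - l - 1}) \<partial>iid_law \<rho> \<Theta>) =
        \<rho> ^ (s k + s l) * (\<integral>x. proj ?\<kappa> ?m (h k) x * proj ?\<kappa> ?n (h l) x \<partial>?\<kappa>)" .
    have "\<rho> powi (- int (s k + s l)) * \<rho> ^ (s k + s l) = 1"
      unfolding power_int_minus power_int_of_nat using \<rho> by simp
    then show ?thesis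
      unfolding \<sigma>_def E mult.assoc[symmetric] by simp
  qed
  let ?S = "\<chi> i j. \<integral>x. proj ?\<kappa> (?d - pos i) (h (pos i)) x * proj ?\<kappa> (?d - pos j) (h (pos j)) x \<partial>?\<kappa> :: real ^ 'n::{finite,linorder} ^ 'n::{finite,linorder}"
  have S: "mat_of \<sigma> = ?S"
    unfolding mat_of_def by (simp add: \<sigma>_eq[OF pos_less pos_less])
  have "\<exists>N. gaussian_law 0 ?S N \<and> converges_in_distribution M (\<lambda>r w. vec_of (\<lambda>k. Z k r w)) N at_top"
  proof (rule poisson_clt[where c = "2 * lam" and C = C and m = "\<lambda>i. ?d - pos i" and h = "\<lambda>i. h (pos i)" and Y = Y and W = "window \<rho>"])
    show "2 * lam > 0" using lam by simp
    show "poisson_on M ?\<kappa> (window \<rho>) (2 * lam * r) (Y r)" if "r > 0" for r by (rule po[OF that])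
    show "kernel ?\<kappa> (?d - pos i) C (h (pos i))" for i :: 'n by (rule ker[OF pos_less])
    show "(\<lambda>w. vec_of (\<lambda>k. Z k r w)) \<in> borel_measurable M" if "r > 0" for r
      unfolding vec_of_def by (rule borel_measurable_vec_lambda) (rule Z_meas[OF that])
    show "AE w in M. vec_of (\<lambda>k. Z k r w) $ i = poisson_on.normalized ?\<kappa> (window \<rho>) (2 * lam * r) (Y r) (?d - pos i) (h (pos i)) w"
      if "r > 0" for r and i :: 'n
      using Z_eq[OF that pos_less[of i]] by eventually_elim (simp add: vec_of_def)
  qed
  then show ?thesis unfolding S .
qed

text \<open>Both parts are instances of \<open>intersection_clt\<close>: \<open>chi\<close> is
  invariant under scaling and bounded by 1, while \<open>vol k\<close> scales with degree k and is
  bounded on almost every section by \<open>AE_vol_section_bound\<close>.\<close>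

theorem theorem4p3:
  fixes M :: "'w measure"
    and X :: "nat \<Rightarrow> 'w \<Rightarrow> real \<times> (real ^ 'n::{finite,linorder})"
    and \<Theta> :: "(real ^ 'n::{finite,linorder}) measure"
    and lam \<rho> :: real
  assumes "lam > 0"
    and "orientation_distribution \<Theta>"
    and "nondegenerate \<Theta>"
    and "poisson_process M (hyperplane_intensity lam \<Theta>) X"
    and "\<rho> > 0"
  shows "(\<exists>N :: (real ^ 'n::{finite,linorder}) measure.
            gaussian_law 0 (mat_of (sigma_chi \<rho> \<Theta>)) N \<and>
            converges_in_distribution M (\<lambda>r w. vec_of (\<lambda>k. Z_chi M lam X k r w)) N at_top) \<and>
         (\<exists>N :: (real ^ 'n::{finite,linorder}) measure.
            gaussian_law 0 (mat_of (sigma_nu \<rho> \<Theta>)) N \<and>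
            converges_in_distribution M (\<lambda>r w. vec_of (\<lambda>k. Z_nu M lam X k r w)) N at_top)"
proof (rule conjI)
  have "\<exists>N :: (real ^ 'n::{finite,linorder}) measure. gaussian_law 0 (mat_of (\<lambda>k l. \<rho> powi (- int (0 + 0)) *
      (\<integral>x. chi (flat_section \<rho> x {1..CARD('n) - k}) * chi (flat_section \<rho> x {CARD('n) - k..2 * CARD('n) - k - l - 1}) \<partial>iid_law \<rho> \<Theta>))) N \<and>
    converges_in_distribution M (\<lambda>r w. vec_of (\<lambda>k. fact (CARD('n) - k - 1) * r powi (- int 0) / (2 * lam * r) powr (real CARD('n) - real k - 1 / 2) *
      (1 / fact (CARD('n) - k) * (\<Sum>\<^sub>\<infinity>js\<in>{js. length js = CARD('n) - k \<and> distinct js}. chi (flat_section r (\<lambda>i. X i w) (set js))) -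
       (\<integral>w'. 1 / fact (CARD('n) - k) * (\<Sum>\<^sub>\<infinity>js\<in>{js. length js = CARD('n) - k \<and> distinct js}. chi (flat_section r (\<lambda>i. X i w') (set js))) \<partial>M)))) N at_top"
  proof (rule intersection_clt[OF assms(1,2,5,4), where \<phi> = "\<lambda>_. chi" and s = "\<lambda>_. 0" and C = 1])
    show "(\<lambda>x :: nat \<Rightarrow> real \<times> (real ^ 'n::{finite,linorder}). chi (section_of \<rho> (map x [0..<m]))) \<in> borel_measurable borel" for m
      by (intro chi_measurable open_section_subset open_empty)
  qed (auto simp: chi_def)
  then show "\<exists>N :: (real ^ 'n::{finite,linorder}) measure. gaussian_law 0 (mat_of (sigma_chi \<rho> \<Theta>)) N \<and>
      converges_in_distribution M (\<lambda>r w. vec_of (\<lambda>k. Z_chi M lam X k r w)) N at_top"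
    by (simp add: sigma_chi_def[abs_def] Z_chi_def[abs_def] Psi_def Let_def)
next
  define c where "c = (\<lambda>k. unit_ball_vol (real k) * (2 * real k * \<rho>) ^ k)"
  \<comment> \<open>One constant for all k: a sum of nonnegative terms dominates each of
    them.\<close>
  define C where "C = (\<Sum>k<CARD('n). c k / \<rho> ^ k)"
  have c0: "0 \<le> c k" for k using assms(5) by (simp add: c_def)
  have "\<exists>N :: (real ^ 'n::{finite,linorder}) measure. gaussian_law 0 (mat_of (\<lambda>k l. \<rho> powi (- int (k + l)) *
      (\<integral>x. vol k (flat_section \<rho> x {1..CARD('n) - k}) * vol l (flat_section \<rho> x {CARD('n) - k..2 * CARD('n) - k - l - 1}) \<partial>iid_law \<rho> \<Theta>))) N \<and>
    converges_in_distribution M (\<lambda>r w. vec_of (\<lambda>k. fact (CARD('n) - k - 1) * r powi (- int k) / (2 * lam * r) powr (real CARD('n) - real k - 1 / 2) *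
      (1 / fact (CARD('n) - k) * (\<Sum>\<^sub>\<infinity>js\<in>{js. length js = CARD('n) - k \<and> distinct js}. vol k (flat_section r (\<lambda>i. X i w) (set js))) -
       (\<integral>w'. 1 / fact (CARD('n) - k) * (\<Sum>\<^sub>\<infinity>js\<in>{js. length js = CARD('n) - k \<and> distinct js}. vol k (flat_section r (\<lambda>i. X i w') (set js))) \<partial>M)))) N at_top"
  proof (rule intersection_clt[OF assms(1,2,5,4), where \<phi> = vol and s = "\<lambda>k. k" and C = C])
    show "(\<lambda>x :: nat \<Rightarrow> real \<times> (real ^ 'n::{finite,linorder}). vol k (section_of \<rho> (map x [0..<m]))) \<in> borel_measurable borel" for k m
      by (intro vol_measurable open_section_subset)
    show "vol k ((*\<^sub>R) a ` S) = a ^ k * vol k S" if "a > 0" for a k and S :: "(real ^ 'n::{finite,linorder}) set"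
      by (rule vol_scale[OF that])
    show "AE z in PiM {..<CARD('n) - k} (\<lambda>_. mark_law \<rho> \<Theta>). vol k (section_of \<rho> (map z [0..<CARD('n) - k])) \<le> C * \<rho> ^ k"
      if k: "k < CARD('n)" for k
    proof -
      have "c k / \<rho> ^ k \<le> C"
        unfolding C_def using k c0 assms(5) by (intro member_le_sum) auto
      then have "c k \<le> C * \<rho> ^ k" using assms(5) by (simp add: divide_le_eq)
      moreover have "AE z in PiM {..<CARD('n) - k} (\<lambda>_. mark_law \<rho> \<Theta>). vol k (section_of \<rho> (map z [0..<CARD('n) - k])) \<le> c k"
        unfolding c_def using k by (intro AE_vol_section_bound[OF assms(2,5)]) simp
      ultimately show ?thesis by (auto elim: eventually_mono)
    qed
    show "0 \<le> C" unfolding C_def using c0 assms(5) by (intro sum_nonneg) auto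
  qed (auto simp: vol_def)
  then show "\<exists>N :: (real ^ 'n::{finite,linorder}) measure. gaussian_law 0 (mat_of (sigma_nu \<rho> \<Theta>)) N \<and>
      converges_in_distribution M (\<lambda>r w. vec_of (\<lambda>k. Z_nu M lam X k r w)) N at_top"
    by (simp add: sigma_nu_def[abs_def] Z_nu_def[abs_def] zeta_def Let_def)
qed

end
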